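(* In the subspace setting with $\boldsymbol y_l=\mathrm{diag}(\boldsymbol B\boldsymbol b)\boldsymbol A_l\boldsymbol Z\boldsymbol z$, given $\delta\in(0,1)$ and $t\ge1$, assume $n\gtrsim t\log(mp)$, $mp\gtrsim t\delta^{-2}(k+\mu_{\max}^2h)\log^2(m(p+n))\log\frac1\delta$ and $\rho<\frac{1-4\delta}{31}$; set $\eta=1-31\rho-4\delta$. There is a universal constant $c>0$ such that with $\mu_0=c\,\eta/m$, for any $0<\mu<\mu_0$ and with probability exceeding $1-C(mp)^{-t}$ for some $C>0$, the iterates $$\boldsymbol\zeta_0=\tfrac1{mp}\textstyle\sum_l(\boldsymbol A_l\boldsymbol Z)^\top\boldsymbol y_l,\ \boldsymbol\beta_0=(\sqrt m,\boldsymbol 0_{h-1}^\top)^\top,\quad \boldsymbol\zeta_{j+1}=\boldsymbol\zeta_j-\mu\nabla_{\boldsymbol\zeta}f^{\rm s}(\boldsymbol\zeta_j,\boldsymbol\beta_j),\quad \boldsymbol\beta_{j+1}=\mathcal P_{\mathcal B_\rho}\Big(\boldsymbol\beta_j-\mu\tfrac m{\|\boldsymbol z\|^2}\nabla^\perp_{\boldsymbol\beta}f^{\rm s}(\boldsymbol\zeta_j,\boldsymbol\beta_j)\Big)$$ satisfy $\Delta(\boldsymbol\zeta_j,\boldsymbol\beta_j)\le(1-\eta\mu)^j(\delta^2+\rho^2)\|\boldsymbol z\|^2$ for all $j\ge0$; hence $\Delta(\boldsymbol\zeta_j,\boldsymbol\beta_j)\to0$.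
   Context: Random model: $X$ centred with $\mathbb EX^2=1$ and sub-Gaussian norm $\alpha<\infty$; $\boldsymbol a\in\mathbb R^n$ with i.i.d. entries $\sim X$; $\boldsymbol a_{i,l}$ ($i\in[m],l\in[p]$) i.i.d. copies; $\boldsymbol A_l$ has rows $\boldsymbol a_{i,l}^\top$. Bernoulli restriction: if $\mathbb EX^4=1$ then $n>1$ and $\|\boldsymbol x/\|\boldsymbol x\|\|_4^4\le1-c_0/n$. $\gtrsim$ hides large constants depending only on $\alpha$ (and $c_0$). Subspace setting: $\boldsymbol Z\in\mathbb R^{n\times k}$, $\boldsymbol Z^\top\boldsymbol Z=\boldsymbol I_k$; $\boldsymbol B=(\boldsymbol 1_m/\sqrt m,\boldsymbol B^\perp)\in\mathbb R^{m\times h}$ with orthonormal columns, columns of $\boldsymbol B^\perp$ in $\boldsymbol 1_m^\perp$; $\boldsymbol x=\boldsymbol Z\boldsymbol z\ne\boldsymbol 0$; $\boldsymbol g=\boldsymbol B\boldsymbol b$, $\boldsymbol b=(\sqrt m,(\boldsymbol b^\perp)^\top)^\top$, $\boldsymbol g\in\mathcal G_\rho=\{\boldsymbol 1_m+\boldsymbol e:\boldsymbol 1_m^\top\boldsymbol e=0,\|\boldsymbol e\|_\infty\le\rho\}$. $\mu_{\max}=\sqrt{m/h}\max_i\|\boldsymbol B^\top\boldsymbol c_i\|$. $f^{\rm s}(\boldsymbol\zeta,\boldsymbol\beta)=\frac1{2mp}\sum_l\|\mathrm{diag}(\boldsymbol B\boldsymbol\beta)\boldsymbol A_l\boldsymbol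 Z\boldsymbol\zeta-\boldsymbol y_l\|^2$; $\nabla_{\boldsymbol\zeta}f^{\rm s},\nabla_{\boldsymbol\beta}f^{\rm s}$ its partial gradients, $\nabla^\perp_{\boldsymbol\beta}f^{\rm s}=\mathrm{diag}(0,1,\dots,1)\nabla_{\boldsymbol\beta}f^{\rm s}$. $\mathcal B_\rho=\{\boldsymbol v\in\mathbb R^h:\boldsymbol B\boldsymbol v\in\mathcal G_\rho\}$ (closed convex), $\mathcal P_{\mathcal B_\rho}$ the Euclidean projection onto it. $\Delta(\boldsymbol\zeta,\boldsymbol\beta)=\|\boldsymbol\zeta-\boldsymbol z\|^2+\frac{\|\boldsymbol z\|^2}m\|\boldsymbol\beta-\boldsymbol b\|^2$. *)

theory Defs
  imports "HOL-Probability.Probability"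
begin

text \<open>Vectors in R^d are functions nat => real of which only the indices < d matter;
  matrices are functions nat => nat => real (row index, column index).\<close>

type_synonym vect = "nat \<Rightarrow> real"
type_synonym matr = "nat \<Rightarrow> nat \<Rightarrow> real"

definition sqn :: "nat \<Rightarrow> vect \<Rightarrow> real" where
  "sqn d v = (\<Sum>i<d. (v i)\<^sup>2)"

definition mv :: "nat \<Rightarrow> nat \<Rightarrow> matr \<Rightarrow> vect \<Rightarrow> vect" where
  "mv r c M v = (\<lambda>i. if i < r then (\<Sum>j<c. M i j * v j) else 0)"

definition orthonormal_cols :: "nat \<Rightarrow> nat \<Rightarrow> matr \<Rightarrow> bool" where
  "orthonormal_cols r c M \<longleftrightarrow>
     (\<forall>i<c. \<forall>j<c. (\<Sum>s<r. M s i * M s j) = (if i = j then 1 else 0))"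

definition subspace_setting :: "nat \<Rightarrow> nat \<Rightarrow> nat \<Rightarrow> nat \<Rightarrow> matr \<Rightarrow> matr \<Rightarrow> bool" where
  "subspace_setting n m k h Z B \<longleftrightarrow>
     orthonormal_cols n k Z \<and> 1 \<le> h \<and> orthonormal_cols m h B \<and>
     (\<forall>i<m. B i 0 = 1 / sqrt (real m)) \<and>
     (\<forall>j. 1 \<le> j \<and> j < h \<longrightarrow> (\<Sum>i<m. B i j) = 0)"

definition in_G :: "real \<Rightarrow> nat \<Rightarrow> vect \<Rightarrow> bool" where
  "in_G \<rho> m g \<longleftrightarrow> (\<exists>e. (\<forall>i<m. g i = 1 + e i) \<and> (\<Sum>i<m. e i) = 0 \<and> (\<forall>i<m. \<bar>e i\<bar> \<le> \<rho>))"

definition mu_max :: "nat \<Rightarrow> nat \<Rightarrow> matr \<Rightarrow> real" where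
  "mu_max m h B = sqrt (real m / real h) * Max ((\<lambda>i. sqrt (\<Sum>j<h. (B i j)\<^sup>2)) ` {..<m})"

text \<open>Sub-Gaussian norm of the distribution D of X: inf{s>0 : E exp(X^2/s^2) <= 2};
  finiteness means the set is nonempty.\<close>
definition subg_set :: "real measure \<Rightarrow> real set" where
  "subg_set D = {s. s > 0 \<and> (\<integral>\<^sup>+x. ennreal (exp (x\<^sup>2 / s\<^sup>2)) \<partial>D) \<le> 2}"

definition has_subg_norm :: "real measure \<Rightarrow> real \<Rightarrow> bool" where
  "has_subg_norm D \<alpha> \<longleftrightarrow> subg_set D \<noteq> {} \<and> \<alpha> = Inf (subg_set D)"

text \<open>The random entries: omega (l,i,r) is the r-th entry of a_{i,l}, i.e. (A_l)_{i r}.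
  A_l Z zeta:\<close>
definition AZ :: "nat \<Rightarrow> nat \<Rightarrow> nat \<Rightarrow> matr \<Rightarrow> (nat \<times> nat \<times> nat \<Rightarrow> real) \<Rightarrow> nat \<Rightarrow> vect \<Rightarrow> vect" where
  "AZ m n k Z \<omega> l \<zeta> = mv m n (\<lambda>i r. \<omega> (l, i, r)) (mv n k Z \<zeta>)"

definition meas :: "nat \<Rightarrow> nat \<Rightarrow> nat \<Rightarrow> nat \<Rightarrow> matr \<Rightarrow> matr \<Rightarrow> (nat \<times> nat \<times> nat \<Rightarrow> real)
                     \<Rightarrow> vect \<Rightarrow> vect \<Rightarrow> nat \<Rightarrow> vect" where
  "meas m n k h Z B \<omega> z b l = (\<lambda>i. mv m h B b i * AZ m n k Z \<omega> l z i)"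

definition fs :: "nat \<Rightarrow> nat \<Rightarrow> nat \<Rightarrow> nat \<Rightarrow> nat \<Rightarrow> matr \<Rightarrow> matr \<Rightarrow> (nat \<times> nat \<times> nat \<Rightarrow> real)
                  \<Rightarrow> (nat \<Rightarrow> vect) \<Rightarrow> vect \<Rightarrow> vect \<Rightarrow> real" where
  "fs m p n k h Z B \<omega> y \<zeta> \<beta> =
     1 / (2 * real m * real p) *
     (\<Sum>l<p. \<Sum>i<m. (mv m h B \<beta> i * AZ m n k Z \<omega> l \<zeta> i - y l i)\<^sup>2)"

definition grad_zeta :: "nat \<Rightarrow> nat \<Rightarrow> nat \<Rightarrow> nat \<Rightarrow> nat \<Rightarrow> matr \<Rightarrow> matr \<Rightarrow> (nat \<times> nat \<times> nat \<Rightarrow> real)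
                  \<Rightarrow> (nat \<Rightarrow> vect) \<Rightarrow> vect \<Rightarrow> vect \<Rightarrow> vect" where
  "grad_zeta m p n k h Z B \<omega> y \<zeta> \<beta> =
     (\<lambda>s. if s < k then deriv (\<lambda>\<tau>. fs m p n k h Z B \<omega> y (\<zeta>(s := \<zeta> s + \<tau>)) \<beta>) 0 else 0)"

definition grad_beta :: "nat \<Rightarrow> nat \<Rightarrow> nat \<Rightarrow> nat \<Rightarrow> nat \<Rightarrow> matr \<Rightarrow> matr \<Rightarrow> (nat \<times> nat \<times> nat \<Rightarrow> real)
                  \<Rightarrow> (nat \<Rightarrow> vect) \<Rightarrow> vect \<Rightarrow> vect \<Rightarrow> vect" where
  "grad_beta m p n k h Z B \<omega> y \<zeta> \<beta> =
     (\<lambda>s. if s < h then deriv (\<lambda>\<tau>. fs m p n k h Z B \<omega> y \<zeta> (\<beta>(s := \<beta> s + \<tau>))) 0 else 0)"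

definition grad_beta_perp :: "nat \<Rightarrow> nat \<Rightarrow> nat \<Rightarrow> nat \<Rightarrow> nat \<Rightarrow> matr \<Rightarrow> matr \<Rightarrow> (nat \<times> nat \<times> nat \<Rightarrow> real)
                  \<Rightarrow> (nat \<Rightarrow> vect) \<Rightarrow> vect \<Rightarrow> vect \<Rightarrow> vect" where
  "grad_beta_perp m p n k h Z B \<omega> y \<zeta> \<beta> =
     (\<lambda>s. if s = 0 then 0 else grad_beta m p n k h Z B \<omega> y \<zeta> \<beta> s)"

definition Bset :: "real \<Rightarrow> nat \<Rightarrow> nat \<Rightarrow> matr \<Rightarrow> vect set" where
  "Bset \<rho> m h B = {v. (\<forall>i\<ge>h. v i = 0) \<and> in_G \<rho> m (mv m h B v)}"

definition proj :: "nat \<Rightarrow> vect set \<Rightarrow> vect \<Rightarrow> vect" where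
  "proj h S v = (THE w. w \<in> S \<and> (\<forall>u\<in>S. sqn h (\<lambda>i. v i - w i) \<le> sqn h (\<lambda>i. v i - u i)))"

definition zeta0 :: "nat \<Rightarrow> nat \<Rightarrow> nat \<Rightarrow> nat \<Rightarrow> matr \<Rightarrow> (nat \<times> nat \<times> nat \<Rightarrow> real) \<Rightarrow> (nat \<Rightarrow> vect) \<Rightarrow> vect" where
  "zeta0 m p n k Z \<omega> y =
     (\<lambda>s. if s < k then 1 / (real m * real p) *
            (\<Sum>l<p. \<Sum>i<m. (\<Sum>r<n. \<omega> (l, i, r) * Z r s) * y l i) else 0)"

definition beta0 :: "nat \<Rightarrow> vect" where
  "beta0 m = (\<lambda>s. if s = 0 then sqrt (real m) else 0)"

primrec iterates :: "nat \<Rightarrow> nat \<Rightarrow> nat \<Rightarrow> nat \<Rightarrow> nat \<Rightarrow> matr \<Rightarrow> matr \<Rightarrow> (nat \<times> nat \<times> nat \<Rightarrow> real)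
                  \<Rightarrow> vect \<Rightarrow> vect \<Rightarrow> real \<Rightarrow> real \<Rightarrow> nat \<Rightarrow> vect \<times> vect" where
  "iterates m p n k h Z B \<omega> z b \<rho> \<mu> 0 =
     (zeta0 m p n k Z \<omega> (meas m n k h Z B \<omega> z b), beta0 m)"
| "iterates m p n k h Z B \<omega> z b \<rho> \<mu> (Suc j) =
     (let (\<zeta>, \<beta>) = iterates m p n k h Z B \<omega> z b \<rho> \<mu> j;
          y = meas m n k h Z B \<omega> z b
      in ((\<lambda>s. \<zeta> s - \<mu> * grad_zeta m p n k h Z B \<omega> y \<zeta> \<beta> s),
          proj h (Bset \<rho> m h B)
            (\<lambda>s. \<beta> s - \<mu> * (real m / sqn k z) * grad_beta_perp m p n k h Z B \<omega> y \<zeta> \<beta> s)))"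

definition Delta :: "nat \<Rightarrow> nat \<Rightarrow> nat \<Rightarrow> vect \<Rightarrow> vect \<Rightarrow> vect \<Rightarrow> vect \<Rightarrow> real" where
  "Delta m k h z b \<zeta> \<beta> =
     sqn k (\<lambda>i. \<zeta> i - z i) + sqn k z / real m * sqn h (\<lambda>i. \<beta> i - b i)"

end

theory Submission
  imports Defs
begin

text \<open>
  For a row \<open>a\<close>, put \<open>u = a \<cdot> Z (\<zeta> - z)\<close>, \<open>X = a \<cdot> Z z\<close>, \<open>d = B \<beta>\<close> and \<open>w = B (\<beta> - b)\<close>.  The residual is
  \<open>r = d u + w X\<close>, and in the metric of \<open>\<Delta>\<close> the inner product of gradient and error is the mean of
  \<open>r\<^sup>2 + r w u\<close>.  As \<open>\<bar>w\<bar> \<le> 2\<rho>\<close>, the step contracts as soon as the mean of \<open>u\<^sup>2\<close> is at most \<open>8 \<parallel>\<zeta> - z\<parallel>\<^sup>2\<close> and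
  the mean of \<open>(u + w X)\<^sup>2\<close> is at least \<open>9/10 \<Delta>\<close>; the energy of a single row is at most \<open>m\<close> times the
  mean, which is why steps of order \<open>1/m\<close> are safe with a universal constant.

  The upper bound holds by a union bound over a lattice net.  The lower bound concerns the smallest
  eigenvalue of a sum of independent, not identically distributed rank-one matrices.  For a lower
  bound the rows may be truncated at a constant multiple of their mean square norm, which costs only
  fourth moments; the even moments of the trace of the truncated, centred sum are then bounded by
  resampling one row at a time, and a moment of order \<open>t log(mp)\<close> loses just one logarithm.  The
  starting point is controlled coordinate by coordinate with Bernstein's inequality.
\<close>

section \<open>Traces of powers of symmetric matrices\<close>

text \<open>The unknowns are stacked into one vector
  \<open>(e, \<parallel>z\<parallel> / sqrt m * v)\<close> whose squared norm is exactly
  \<open>\<Delta>\<close>. As the first gain coefficient is known, the gain error sums to zero over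
  the sensors, so the cross terms between signal and gain error cancel in expectation and the mean
  row covariance acts as the identity on these vectors. The 9/10 is what remains after 1/20 is spent
  on truncation and 1/20 on fluctuation. The 8 may be crude, because the upper bound enters the
  contraction only with a factor \<open>\<rho>\<close> or through the second-order term in
  \<open>\<mu>\<close>. The obstacle on the lower side is that lifted rows have squared norm of
  order \<open>Dim = k + mu_max^2 h\<close>; a net would pay for the dimension on top of the row
  size. A trace pays for the dimension only by a prefactor: a moment of order \<open>q\<close> fails
  with probability about \<open>(k + h) * (const * Dim * q / (mp)) ^ q\<close>, so \<open>q\<close>
  of order \<open>t (1 + log(mp))\<close> is enough. Orders are powers of two because a quadratic
  form is compared with the trace by repeated squaring.\<close>

definition mmult :: "nat \<Rightarrow> matr \<Rightarrow> matr \<Rightarrow> matr" where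
  "mmult d A B = (\<lambda>i j. \<Sum>k<d. A i k * B k j)"

definition tr :: "nat \<Rightarrow> matr \<Rightarrow> real" where
  "tr d A = (\<Sum>i<d. A i i)"

definition transp :: "matr \<Rightarrow> matr" where
  "transp A = (\<lambda>i j. A j i)"

text \<open>Matrices are total functions of two indices. Vanishing outside the \<open>d\<close> by
  \<open>d\<close> block makes \<open>mpow d A 0\<close> a two-sided unit and lets matrix identities
  be stated as equalities of functions.\<close>

definition in_dim :: "nat \<Rightarrow> matr \<Rightarrow> bool" where
  "in_dim d A \<longleftrightarrow> (\<forall>i j. A i j \<noteq> 0 \<longrightarrow> i < d \<and> j < d)"

primrec mpow :: "nat \<Rightarrow> matr \<Rightarrow> nat \<Rightarrow> matr" where
  "mpow d A 0 = (\<lambda>i j. if i = j \<and> i < d then 1 else 0)"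
| "mpow d A (Suc n) = mmult d A (mpow d A n)"

definition qform :: "nat \<Rightarrow> matr \<Rightarrow> vect \<Rightarrow> real" where
  "qform d A v = (\<Sum>i<d. \<Sum>j<d. v i * A i j * v j)"

lemma mmult_assoc: "mmult d (mmult d A B) C = mmult d A (mmult d B C)"
proof (intro ext)
  fix i j
  have "(\<Sum>k<d. (\<Sum>l<d. A i l * B l k) * C k j) = (\<Sum>k<d. \<Sum>l<d. A i l * B l k * C k j)"
    by (simp add: sum_distrib_right)
  also have "\<dots> = (\<Sum>l<d. \<Sum>k<d. A i l * B l k * C k j)" by (rule sum.swap)
  finally show "mmult d (mmult d A B) C i j = mmult d A (mmult d B C) i j"
    by (simp add: mmult_def sum_distrib_left mult.assoc)
qed

lemma mmult_plus: "mmult d (\<lambda>i j. A i j + B i j) C = (\<lambda>i j. mmult d A C i j + mmult d B C i j)"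
  "mmult d C (\<lambda>i j. A i j + B i j) = (\<lambda>i j. mmult d C A i j + mmult d C B i j)"
  by (simp_all add: mmult_def ring_distribs sum.distrib)

lemma mmult_minus: "mmult d (\<lambda>i j. A i j - B i j) C = (\<lambda>i j. mmult d A C i j - mmult d B C i j)"
  "mmult d C (\<lambda>i j. A i j - B i j) = (\<lambda>i j. mmult d C A i j - mmult d C B i j)"
  by (simp_all add: mmult_def ring_distribs sum_subtractf)

lemma mmult_scale: "mmult d (\<lambda>i j. c * A i j) C = (\<lambda>i j. c * mmult d A C i j)"
  by (simp add: mmult_def sum_distrib_left mult.assoc)

lemma tr_plus: "tr d (\<lambda>i j. A i j + B i j) = tr d A + tr d B"
  by (simp add: tr_def sum.distrib)

lemma tr_minus: "tr d (\<lambda>i j. A i j - B i j) = tr d A - tr d B"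
  by (simp add: tr_def sum_subtractf)

lemma tr_scale: "tr d (\<lambda>i j. c * A i j) = c * tr d A"
  by (simp add: tr_def sum_distrib_left)

lemma tr_comm: "tr d (mmult d A B) = tr d (mmult d B A)"
  unfolding tr_def mmult_def by (subst sum.swap) (simp add: mult.commute)

lemma tr_sum: "tr d (\<lambda>i j. \<Sum>l\<in>L. A l i j) = (\<Sum>l\<in>L. tr d (A l))"
  unfolding tr_def by (rule sum.swap)

lemma mmult_sum: "mmult d (\<lambda>i j. \<Sum>l\<in>L. A l i j) C = (\<lambda>i j. \<Sum>l\<in>L. mmult d (A l) C i j)"
  unfolding mmult_def by (intro ext, subst sum.swap) (simp add: sum_distrib_right)

lemma mmult_sum2: "mmult d C (\<lambda>i j. \<Sum>l\<in>L. A l i j) = (\<lambda>i j. \<Sum>l\<in>L. mmult d C (A l) i j)"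
  unfolding mmult_def by (intro ext, subst sum.swap) (simp add: sum_distrib_left)

lemma transp_mmult: "transp (mmult d A B) = mmult d (transp B) (transp A)"
  by (simp add: transp_def mmult_def mult.commute)

lemma in_dim_diff: "in_dim d A \<Longrightarrow> in_dim d B \<Longrightarrow> in_dim d (\<lambda>i j. A i j - B i j)"
  unfolding in_dim_def by (metis diff_self)

lemma in_dim_mmult: "in_dim d A \<Longrightarrow> in_dim d B \<Longrightarrow> in_dim d (mmult d A B)"
proof -
  assume A: "in_dim d A" and B: "in_dim d B"
  have "mmult d A B i j = 0" if "\<not> (i < d \<and> j < d)" for i j
    unfolding mmult_def using that A B by (intro sum.neutral) (auto simp: in_dim_def)
  then show ?thesis by (auto simp: in_dim_def)
qed

lemma in_dim_mpow: "in_dim d A \<Longrightarrow> in_dim d (mpow d A n)"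
proof (induction n)
  case (Suc n)
  then show ?case by (simp add: in_dim_mmult)
qed (simp add: in_dim_def)

lemma mmult_one: 
  assumes "in_dim d A" 
  shows "mmult d (mpow d B 0) A = A" "mmult d A (mpow d B 0) = A"
proof -
  have "mmult d (mpow d B 0) A i j = A i j" for i j
  proof (cases "i < d")
    case True
    then have "mmult d (mpow d B 0) A i j = (\<Sum>k<d. if k = i then A i j else 0)"
      unfolding mmult_def by (intro sum.cong) auto
    then show ?thesis using True by simp
  next
    case False
    then have "A i j = 0" using assms by (auto simp: in_dim_def)
    then show ?thesis using False by (simp add: mmult_def)
  qed
  moreover have "mmult d A (mpow d B 0) i j = A i j" for i j
  proof (cases "j < d")
    case True
    then have "mmult d A (mpow d B 0) i j = (\<Sum>k<d. if k = j then A i j else 0)"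
      unfolding mmult_def by (intro sum.cong) auto
    then show ?thesis using True by simp
  next
    case False
    then have "A i j = 0" using assms by (auto simp: in_dim_def)
    then show ?thesis using False by (simp add: mmult_def)
  qed
  ultimately show "mmult d (mpow d B 0) A = A" "mmult d A (mpow d B 0) = A" by blast+
qed

lemma mpow_add:
  assumes "in_dim d A"
  shows "mpow d A (a + b) = mmult d (mpow d A a) (mpow d A b)"
proof (induction a)
  case 0
  show ?case using mmult_one(1)[OF in_dim_mpow[OF assms], of A b] by simp
next
  case (Suc a)
  then show ?case by (simp add: mmult_assoc)
qed

lemma mpow_1: "in_dim d A \<Longrightarrow> mpow d A (Suc 0) = A"
  using mmult_one(2)[of d A A] by simp

lemma mpow_Suc2:
  assumes "in_dim d A"
  shows "mpow d A (Suc n) = mmult d (mpow d A n) A"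
  using mpow_add[OF assms, of n "Suc 0"] by (simp add: mpow_1[OF assms] del: mpow.simps)

lemma transp_mpow:
  assumes "in_dim d A" "transp A = A"
  shows "transp (mpow d A n) = mpow d A n"
proof (induction n)
  case 0
  show ?case by (auto simp: transp_def fun_eq_iff)
next
  case (Suc n)
  have "transp (mpow d A (Suc n)) = mmult d (mpow d A n) A" using Suc assms(2) by (simp add: transp_mmult)
  then show ?case using mpow_Suc2[OF assms(1)] by simp
qed

section \<open>Frobenius inner products and trace inequalities for matrix powers\<close>

lemma tr_mmult_transp: "tr d (mmult d A (transp A)) = (\<Sum>i<d. \<Sum>j<d. (A i j)\<^sup>2)"
  by (simp add: tr_def mmult_def transp_def power2_eq_square)

lemma tr_mmult_transp_nonneg: "0 \<le> tr d (mmult d A (transp A))"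
  by (simp add: tr_mmult_transp sum_nonneg)

text \<open>The trace of the product is the Frobenius inner product of \<open>A\<close> and
  \<open>transp B\<close>, so this is the arithmetic-geometric mean inequality entry by
  entry.\<close>

lemma tr_mmult_le: "tr d (mmult d A B) \<le> (tr d (mmult d A (transp A)) + tr d (mmult d (transp B) B)) / 2"
proof -
  have "tr d (mmult d A B) = (\<Sum>i<d. \<Sum>j<d. A i j * B j i)" by (simp add: tr_def mmult_def)
  also have "\<dots> \<le> (\<Sum>i<d. \<Sum>j<d. ((A i j)\<^sup>2 + (transp B i j)\<^sup>2) / 2)"
  proof (intro sum_mono)
    fix i j
    have "0 \<le> (A i j - B j i)\<^sup>2" by simp
    then show "A i j * B j i \<le> ((A i j)\<^sup>2 + (transp B i j)\<^sup>2) / 2"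
      by (simp add: transp_def power2_eq_square algebra_simps)
  qed
  also have "\<dots> = (tr d (mmult d A (transp A)) + tr d (mmult d (transp B) (transp (transp B)))) / 2"
    by (simp add: tr_mmult_transp sum.distrib flip: sum_divide_distrib)
  finally show ?thesis by (simp add: transp_def)
qed

lemma tr_even_nonneg:
  assumes "in_dim d A" "transp A = A"
  shows "0 \<le> tr d (mpow d A (2 * n))"
  using tr_mmult_transp_nonneg[of d "mpow d A n"] mpow_add[OF assms(1), of n n] transp_mpow[OF assms, of n]
  by (simp add: mult_2)

text \<open>A discrete maximum principle: at the leftmost index attaining the maximum, the midpoint
  inequality at an interior point would force the left neighbour to attain it as well.\<close>

lemma midpoint_convex_le_ends:
  fixes f :: "nat \<Rightarrow> real"
  assumes conv: "\<And>j. 0 < j \<Longrightarrow> j < r \<Longrightarrow> 2 * f j \<le> f (j - 1) + f (j + 1)" and "j \<le> r"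
  shows "f j \<le> max (f 0) (f r)"
proof (rule ccontr)
  assume neg: "\<not> f j \<le> max (f 0) (f r)"
  define K where "K = Max (f ` {..r})"
  have Kge: "f i \<le> K" if "i \<le> r" for i unfolding K_def using that by auto
  have "K \<in> f ` {..r}" unfolding K_def by (intro Max_in) auto
  then have ex: "\<exists>i. i \<le> r \<and> f i = K" by auto
  define i where "i = (LEAST i. i \<le> r \<and> f i = K)"
  have i: "i \<le> r" "f i = K" unfolding i_def using LeastI_ex[OF ex] by auto
  have least: "f i' \<noteq> K" if "i' < i" for i'
    using not_less_Least[of i' "\<lambda>i. i \<le> r \<and> f i = K"] that i(1) unfolding i_def by auto
  have K: "K > f 0" "K > f r" using neg Kge[OF assms(2)] by auto
  have "i \<noteq> 0" "i \<noteq> r" using i(2) K by (metis less_irrefl)+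
  then have "0 < i" "i < r" using i by simp_all
  have "2 * f i \<le> f (i - 1) + f (i + 1)" using \<open>0 < i\<close> \<open>i < r\<close> by (rule conv)
  moreover have "f (i + 1) \<le> K" using \<open>i < r\<close> by (intro Kge) simp
  moreover have "f (i - 1) \<le> K" "f (i - 1) \<noteq> K" using \<open>0 < i\<close> \<open>i < r\<close> by (intro Kge least, simp)+
  ultimately show False using i(2) by simp
qed

text \<open>Both factors are distributed evenly by Cauchy--Schwarz in the Frobenius norm, so the even-indexed
  traces form a midpoint-convex sequence; no spectral theorem is needed.\<close>
lemma trace_mixed_power_le:
  assumes H: "in_dim d H" "transp H = H" and W: "in_dim d W" "transp W = W"
    and Y: "in_dim d Y" "transp Y = Y" and k: "k \<le> 2 * r"
  shows "tr d (mmult d (mmult d H (mpow d W k)) (mmult d H (mpow d Y (2 * r - k))))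
     \<le> tr d (mmult d (mmult d H H) (mpow d W (2 * r))) + tr d (mmult d (mmult d H H) (mpow d Y (2 * r)))"
proof -
  define f where "f k = tr d (mmult d (mmult d H (mpow d W k)) (mmult d H (mpow d Y (2 * r - k))))" for k
  \<comment> \<open>Cutting the cyclic word once inside the power of \<open>Y\<close> and once
    inside the power of \<open>W\<close> writes \<open>f (a + b)\<close> as the Frobenius inner
    product of \<open>F a\<close> and \<open>F b\<close>, because \<open>G b\<close> is the
    transpose of \<open>F b\<close>. In particular \<open>f (2 * a)\<close> is a squared
    norm.\<close>
  define F where "F a = mmult d (mpow d Y (r - a)) (mmult d H (mpow d W a))" for a
  define G where "G a = mmult d (mpow d W a) (mmult d H (mpow d Y (r - a)))" for a
  have FG: "transp (F a) = G a" "transp (G a) = F a" for a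
    by (simp_all add: F_def G_def transp_mmult transp_mpow[OF W] transp_mpow[OF Y] H(2) mmult_assoc)
  have split: "f (a + b) = tr d (mmult d (F a) (G b))" if "a \<le> r" "b \<le> r" for a b
  proof -
    have e: "2 * r - (a + b) = (r - b) + (r - a)" using that by auto
    have "f (a + b) = tr d (mmult d (mmult d (mmult d H (mpow d W a)) (mmult d (mpow d W b) (mmult d H (mpow d Y (r - b))))) (mpow d Y (r - a)))"
      unfolding f_def e mpow_add[OF W(1)] mpow_add[OF Y(1)] by (simp add: mmult_assoc)
    also have "\<dots> = tr d (mmult d (F a) (G b))"
      by (subst tr_comm) (simp add: F_def G_def mmult_assoc)
    finally show ?thesis .
  qed
  have mid: "f (a + b) \<le> (f (2 * a) + f (2 * b)) / 2" if "a \<le> r" "b \<le> r" for a b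
  proof -
    have "f (a + b) \<le> (tr d (mmult d (F a) (G a)) + tr d (mmult d (F b) (G b))) / 2"
      unfolding split[OF that] using tr_mmult_le[of d "F a" "G b"] by (simp add: FG)
    then show ?thesis using split[of a a] split[of b b] that by (simp add: mult_2)
  qed
  have nn: "0 \<le> f (2 * a)" if "a \<le> r" for a
    using split[of a a] that tr_mmult_transp_nonneg[of d "F a"] by (simp add: FG mult_2)
  have ends: "f (2 * j) \<le> max (f (2 * 0)) (f (2 * r))" if "j \<le> r" for j
  proof (rule midpoint_convex_le_ends[where f = "\<lambda>j. f (2 * j)" and r = r, OF _ that])
    fix j assume j: "0 < j" "j < r"
    have "f ((j - 1) + (j + 1)) \<le> (f (2 * (j - 1)) + f (2 * (j + 1))) / 2"
      using j by (intro mid) auto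
    moreover have "(j - 1) + (j + 1) = 2 * j" using j by simp
    ultimately show "2 * f (2 * j) \<le> f (2 * (j - 1)) + f (2 * (j + 1))" by (simp only: field_simps)
  qed
  have "f k \<le> max (f (2 * 0)) (f (2 * r))"
  proof (cases "even k")
    case True
    then show ?thesis using ends[of "k div 2"] k by auto
  next
    case False
    then obtain a where a: "k = 2 * a + 1" by (elim oddE)
    then have "a < r" using k by auto
    then have "f (a + (a + 1)) \<le> (f (2 * a) + f (2 * (a + 1))) / 2" by (intro mid) auto
    also have "\<dots> \<le> max (f (2 * 0)) (f (2 * r))"
      using ends[of a] ends[of "a+1"] \<open>a < r\<close> by auto
    finally show ?thesis by (simp add: a mult_2)
  qed
  also have "\<dots> \<le> f 0 + f (2 * r)" using nn[of 0] nn[of r] by auto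
  also have "f 0 = tr d (mmult d (mmult d H H) (mpow d Y (2 * r)))"
    unfolding f_def using mmult_one(2)[OF H(1), of W] by (simp add: mmult_assoc)
  also have "f (2 * r) = tr d (mmult d (mmult d H H) (mpow d W (2 * r)))"
  proof -
    have "f (2 * r) = tr d (mmult d (mmult d H (mpow d W (2 * r))) H)"
      unfolding f_def using mmult_one(2)[OF H(1), of Y] by simp
    then show ?thesis by (subst (asm) tr_comm) (simp add: mmult_assoc)
  qed
  finally show ?thesis unfolding f_def by (simp add: add.commute)
qed

text \<open>Telescoping without commutativity: the factors \<open>T\<close> are replaced by
  \<open>S\<close> one at a time.\<close>

lemma mpow_diff:
  assumes S: "in_dim d S" and T: "in_dim d T"
  shows "(\<lambda>i j. mpow d S (Suc n) i j - mpow d T (Suc n) i j)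
    = (\<lambda>i j. \<Sum>k\<le>n. mmult d (mpow d S k) (mmult d (\<lambda>i j. S i j - T i j) (mpow d T (n - k))) i j)"
proof (induction n)
  case 0
  have "in_dim d (\<lambda>i j. S i j - T i j)" using S T by (rule in_dim_diff)
  then show ?case using mmult_one[of d "\<lambda>i j. S i j - T i j"] mmult_one[OF S] mmult_one[OF T] by simp
next
  case (Suc n)
  define H where "H = (\<lambda>i j. S i j - T i j)"
  have Hd: "in_dim d H" unfolding H_def using S T by (rule in_dim_diff)
  have "(\<lambda>i j. mpow d S (Suc (Suc n)) i j - mpow d T (Suc (Suc n)) i j)
      = (\<lambda>i j. mmult d S (\<lambda>i j. mpow d S (Suc n) i j - mpow d T (Suc n) i j) i j + mmult d H (mpow d T (Suc n)) i j)"
    unfolding H_def mmult_minus by simp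
  also have "\<dots> = (\<lambda>i j. (\<Sum>k\<le>n. mmult d (mpow d S (Suc k)) (mmult d H (mpow d T (n - k))) i j) + mmult d H (mpow d T (Suc n)) i j)"
  proof -
    have "mmult d S (\<lambda>i j. mpow d S (Suc n) i j - mpow d T (Suc n) i j)
      = (\<lambda>i j. \<Sum>k\<le>n. mmult d (mpow d S (Suc k)) (mmult d H (mpow d T (n - k))) i j)"
      unfolding arg_cong[OF Suc.IH, of "mmult d S"] mmult_sum2 H_def by (simp only: mpow.simps mmult_assoc)
    then show ?thesis by (simp only:)
  qed
  also have "\<dots> = (\<lambda>i j. (\<Sum>k\<le>Suc n. mmult d (mpow d S k) (mmult d H (mpow d T (Suc n - k))) i j))"
  proof -
    have z: "mmult d (mpow d S 0) (mmult d H (mpow d T (Suc n))) = mmult d H (mpow d T (Suc n))"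
      by (intro mmult_one in_dim_mmult in_dim_mpow Hd T)
    show ?thesis by (subst sum.atMost_Suc_shift) (simp add: z add.commute del: mpow.simps)
  qed
  finally show ?case unfolding H_def .
qed

text \<open>A mean value trace inequality for odd powers. Telescoping gives \<open>2 * r + 1\<close>
  cyclic words in which two factors \<open>H\<close> are separated by powers of \<open>S\<close> and
  \<open>T\<close>; the mixed-power bound moves each word to its two extreme cases.\<close>

lemma tr_mmult_power_diff_le:
  assumes S: "in_dim d S" "transp S = S" and T: "in_dim d T" "transp T = T"
  defines "H \<equiv> \<lambda>i j. S i j - T i j"
  shows "tr d (mmult d H (\<lambda>i j. mpow d S (Suc (2 * r)) i j - mpow d T (Suc (2 * r)) i j))
    \<le> (2 * real r + 1) * (tr d (mmult d (mmult d H H) (mpow d S (2 * r))) + tr d (mmult d (mmult d H H) (mpow d T (2 * r))))"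
proof -
  have H: "in_dim d H" "transp H = H" using in_dim_diff[OF S(1) T(1)] S(2) T(2) by (auto simp: H_def transp_def fun_eq_iff)
  have "tr d (mmult d H (\<lambda>i j. mpow d S (Suc (2 * r)) i j - mpow d T (Suc (2 * r)) i j))
    = tr d (mmult d (\<lambda>i j. mpow d S (Suc (2 * r)) i j - mpow d T (Suc (2 * r)) i j) H)"
    by (rule tr_comm)
  also have "\<dots> = (\<Sum>k\<le>2*r. tr d (mmult d (mmult d (mpow d S k) (mmult d H (mpow d T (2 * r - k)))) H))"
    unfolding mpow_diff[OF S(1) T(1)] H_def[symmetric] mmult_sum tr_sum ..
  also have "\<dots> = (\<Sum>k\<le>2*r. tr d (mmult d (mmult d H (mpow d S k)) (mmult d H (mpow d T (2 * r - k)))))"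
    by (intro sum.cong refl, subst tr_comm) (simp add: mmult_assoc)
  also have "\<dots> \<le> (\<Sum>k\<le>2*r. tr d (mmult d (mmult d H H) (mpow d S (2 * r))) + tr d (mmult d (mmult d H H) (mpow d T (2 * r))))"
    by (intro sum_mono trace_mixed_power_le H S T) auto
  finally show ?thesis by (simp add: add.commute del: mpow.simps)
qed

text \<open>An even power is the square of a symmetric matrix, so the trace is the sum of the form
  of \<open>A\<close> over the columns of \<open>mpow d S r\<close>, and the order between the forms
  passes to the traces.\<close>

lemma tr_mmult_even_mono:
  assumes S: "in_dim d S" "transp S = S" and "\<And>v. qform d A v \<le> qform d B v"
  shows "tr d (mmult d A (mpow d S (2 * r))) \<le> tr d (mmult d B (mpow d S (2 * r)))"
proof -
  have *: "tr d (mmult d A (mpow d S (2 * r))) = (\<Sum>i<d. qform d A (\<lambda>j. mpow d S r j i))" for A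
  proof -
    have sym: "mpow d S r i j = mpow d S r j i" for i j
      using transp_mpow[OF S, of r] by (metis transp_def)
    have "tr d (mmult d A (mpow d S (2 * r))) = tr d (mmult d (mpow d S r) (mmult d A (mpow d S r)))"
      unfolding mult_2 mpow_add[OF S(1)] mmult_assoc[symmetric] by (subst tr_comm) (simp add: mmult_assoc)
    also have "\<dots> = (\<Sum>i<d. qform d A (\<lambda>j. mpow d S r j i))"
      unfolding tr_def mmult_def qform_def
    proof (rule sum.cong[OF refl])
      fix i
      show "(\<Sum>k<d. mpow d S r i k * (\<Sum>l<d. A k l * mpow d S r l i))
        = (\<Sum>ia<d. \<Sum>j<d. mpow d S r ia i * A ia j * mpow d S r j i)"
        by (subst sym) (simp add: sum_distrib_left mult.assoc)
    qed
    finally show ?thesis .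
  qed
  show ?thesis unfolding * by (intro sum_mono assms)
qed

text \<open>Odd traces have no sign, so they are interpolated between their even neighbours. The
  free weight \<open>\<tau>\<close> is what later lets the higher even moment be absorbed.\<close>

lemma tr_odd_le:
  assumes S: "in_dim d S" "transp S = S" and "0 < \<tau>"
  shows "tr d (mpow d S (Suc (2 * r))) \<le> (\<tau> * tr d (mpow d S (2 * r)) + tr d (mpow d S (2 * Suc r)) / \<tau>) / 2"
proof -
  define Q where "Q = mpow d S r"
  define T where "T = mpow d S (Suc r)"
  define c where "c = sqrt \<tau>"
  have c: "c > 0" "c * c = \<tau>" using assms(3) by (auto simp: c_def)
  have sQ: "transp Q = Q" "transp T = T" unfolding Q_def T_def by (intro transp_mpow S)+
  have e: "mpow d S (Suc (2 * r)) = mmult d Q T" unfolding Q_def T_def mpow_add[OF S(1), symmetric]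
    by (simp add: mult_2 del: mpow.simps)
  define Q' where "Q' = (\<lambda>i j. c * Q i j)"
  define T' where "T' = (\<lambda>i j. (1/c) * T i j)"
  have "mmult d Q' T' = mmult d Q T"
    using c(1) by (simp add: mmult_def Q'_def T'_def)
  moreover have "mmult d Q' (transp Q') = (\<lambda>i j. \<tau> * mmult d Q (transp Q) i j)"
    unfolding c(2)[symmetric] mmult_def transp_def Q'_def sum_distrib_left by (simp only: ac_simps)
  moreover have "mmult d (transp T') T' = (\<lambda>i j. (1/\<tau>) * mmult d (transp T) T i j)"
    unfolding c(2)[symmetric] mmult_def transp_def T'_def sum_distrib_left
    by (intro ext sum.cong refl) simp
  moreover have "mmult d Q Q = mpow d S (2 * r)" "mmult d T T = mpow d S (2 * Suc r)"
    unfolding Q_def T_def mpow_add[OF S(1), symmetric] by (simp_all only: mult_2)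
  moreover have "tr d (mmult d Q' T') \<le> (tr d (mmult d Q' (transp Q')) + tr d (mmult d (transp T') T')) / 2"
    by (rule tr_mmult_le)
  ultimately show ?thesis unfolding e by (simp only: sQ tr_scale) (simp only: times_divide_eq_left mult_1)
qed

section \<open>Quadratic forms controlled by traces of even powers\<close>

lemma qform_mpow_even:
  assumes S: "in_dim d S" "transp S = S"
  shows "qform d (mpow d S (2 * r)) v = (\<Sum>i<d. (\<Sum>j<d. mpow d S r i j * v j)\<^sup>2)"
proof -
  have sym: "mpow d S r i j = mpow d S r j i" for i j
    using transp_mpow[OF S, of r] by (metis transp_def)
  have "qform d (mpow d S (2 * r)) v = (\<Sum>i<d. \<Sum>j<d. \<Sum>k<d. (mpow d S r k i * v i) * (mpow d S r k j * v j))"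
    unfolding mult_2 mpow_add[OF S(1)] qform_def mmult_def
  proof (rule sum.cong[OF refl], rule sum.cong[OF refl])
    fix i j
    show "v i * (\<Sum>k<d. mpow d S r i k * mpow d S r k j) * v j
      = (\<Sum>k<d. (mpow d S r k i * v i) * (mpow d S r k j * v j))"
      unfolding sum_distrib_left sum_distrib_right
    proof (rule sum.cong[OF refl])
      fix k
      show "v i * (mpow d S r i k * mpow d S r k j) * v j = (mpow d S r k i * v i) * (mpow d S r k j * v j)"
        by (subst sym) (simp only: ac_simps)
    qed
  qed
  also have "\<dots> = (\<Sum>i<d. \<Sum>k<d. \<Sum>j<d. (mpow d S r k i * v i) * (mpow d S r k j * v j))"
    by (rule sum.cong[OF refl], rule sum.swap)
  also have "\<dots> = (\<Sum>k<d. \<Sum>i<d. \<Sum>j<d. (mpow d S r k i * v i) * (mpow d S r k j * v j))"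
    by (rule sum.swap)
  also have "\<dots> = (\<Sum>k<d. (\<Sum>j<d. mpow d S r k j * v j)\<^sup>2)"
    by (simp only: power2_eq_square sum_product)
  finally show ?thesis .
qed

lemma qform_square:
  assumes S: "in_dim d S" "transp S = S"
  shows "qform d (mmult d S S) v = (\<Sum>i<d. (\<Sum>j<d. S i j * v j)\<^sup>2)"
proof -
  have "mmult d S S = mpow d S (2 * 1)"
    unfolding mult_2 mpow_add[OF S(1)] using mpow_1[OF S(1)] by simp
  then show ?thesis using qform_mpow_even[OF S, of 1] mpow_1[OF S(1)] by simp
qed

lemma sqn_nonneg: "0 \<le> sqn d v"
  by (simp add: sqn_def sum_nonneg)

lemma qform_sq_le:
  assumes S: "in_dim d S" "transp S = S"
  shows "(qform d (mpow d S n) v)\<^sup>2 \<le> sqn d v * qform d (mpow d S (2 * n)) v"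
proof -
  have "qform d (mpow d S n) v = (\<Sum>i<d. v i * (\<Sum>j<d. mpow d S n i j * v j))"
    by (simp add: qform_def sum_distrib_left mult.assoc)
  then show ?thesis
    using Cauchy_Schwarz_ineq_sum[of v "\<lambda>i. \<Sum>j<d. mpow d S n i j * v j" "{..<d}"]
    by (simp add: qform_mpow_even[OF S] sqn_def)
qed

lemma qform_even_le_tr:
  assumes S: "in_dim d S" "transp S = S"
  shows "qform d (mpow d S (2 * r)) v \<le> sqn d v * tr d (mpow d S (2 * r))"
proof -
  have "qform d (mpow d S (2 * r)) v \<le> (\<Sum>i<d. (\<Sum>j<d. (mpow d S r i j)\<^sup>2) * sqn d v)"
    unfolding qform_mpow_even[OF S] sqn_def by (intro sum_mono Cauchy_Schwarz_ineq_sum)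
  also have "\<dots> = sqn d v * tr d (mmult d (mpow d S r) (transp (mpow d S r)))"
    unfolding sum_distrib_right[symmetric] tr_mmult_transp by (rule mult.commute)
  finally show ?thesis by (simp add: transp_mpow[OF S] mult_2 mpow_add[OF S(1)])
qed

text \<open>For a unit vector, Cauchy-Schwarz bounds the square of the form of \<open>S^n\<close> by
  the form of \<open>S^(2 n)\<close>; iterating doubles the exponent each time. This replaces
  diagonalisation and is why moment orders have the shape \<open>2 * 2 ^ s\<close>.\<close>

lemma qform_power_le_tr:
  assumes S: "in_dim d S" "transp S = S" and v: "sqn d v = 1"
  shows "qform d S v ^ (2 * 2 ^ s) \<le> tr d (mpow d S (2 * 2 ^ s))"
proof -
  have "qform d S v ^ (2 * 2 ^ s) \<le> qform d (mpow d S (2 * 2 ^ s)) v"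
  proof (induction s)
    case 0
    show ?case using qform_sq_le[OF S, of 1 v] v by (simp add: mpow_1[OF S(1)] del: mpow.simps)
  next
    case (Suc s)
    have "qform d S v ^ (2 * 2 ^ Suc s) = (qform d S v ^ (2 * 2 ^ s))\<^sup>2"
      by (simp add: power_mult[symmetric] mult.commute)
    also have "\<dots> \<le> (qform d (mpow d S (2 * 2 ^ s)) v)\<^sup>2"
      by (intro power_mono Suc) (simp add: power_mult)
    also have "\<dots> \<le> qform d (mpow d S (2 * (2 * 2 ^ s))) v"
      using qform_sq_le[OF S, of "2 * 2 ^ s" v] v by simp
    finally show ?case by simp
  qed
  also have "\<dots> \<le> tr d (mpow d S (2 * 2 ^ s))"
    using qform_even_le_tr[OF S, of "2 ^ s" v] v by simp
  finally show ?thesis .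
qed

lemma qform_scale: "qform d S (\<lambda>i. c * v i) = c\<^sup>2 * qform d S v"
  by (simp add: qform_def sum_distrib_left power2_eq_square ac_simps)

lemma abs_qform_le_of_tr:
  assumes S: "in_dim d S" "transp S = S" and x: "0 \<le> x"
    and tr: "tr d (mpow d S (2 * 2 ^ s)) \<le> x ^ (2 * 2 ^ s)"
  shows "\<bar>qform d S v\<bar> \<le> x * sqn d v"
proof (cases "sqn d v = 0")
  case True
  then have "v i = 0" if "i < d" for i
    using that by (auto simp: sqn_def sum_nonneg_eq_0_iff)
  then have "qform d S v = 0" by (simp add: qform_def)
  then show ?thesis by (simp add: True)
next
  case False
  define c where "c = 1 / sqrt (sqn d v)"
  have pos: "0 < sqn d v" using False sqn_nonneg[of d v] by simp
  have "sqn d (\<lambda>i. c * v i) = c\<^sup>2 * sqn d v" by (simp add: sqn_def power_mult_distrib sum_distrib_left)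
  then have "sqn d (\<lambda>i. c * v i) = 1" using pos by (simp add: c_def power_divide)
  then have "qform d S (\<lambda>i. c * v i) ^ (2 * 2 ^ s) \<le> x ^ (2 * 2 ^ s)"
    using qform_power_le_tr[OF S, of "\<lambda>i. c * v i" s] tr by simp
  then have "\<bar>qform d S (\<lambda>i. c * v i)\<bar> ^ (2 * 2 ^ s) \<le> x ^ (2 * 2 ^ s)"
    by (simp add: power_mult)
  then have "\<bar>qform d S (\<lambda>i. c * v i)\<bar> \<le> x"
    using power_strict_mono[of x "\<bar>qform d S (\<lambda>i. c * v i)\<bar>" "2 * 2 ^ s"] x
    by (cases "\<bar>qform d S (\<lambda>i. c * v i)\<bar> \<le> x") auto
  then have "\<bar>c\<^sup>2 * qform d S v\<bar> \<le> x" by (simp only: qform_scale)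
  moreover have "c\<^sup>2 = 1 / sqn d v" using pos by (simp add: c_def power_divide)
  ultimately show ?thesis using pos by (simp add: abs_mult field_simps)
qed

section \<open>Even moments of sums of bounded rank-one matrices\<close>

text \<open>The bound is asked at every point of the type, which makes the class closed under sums,
  products and composition; every polynomial in the matrix entries is then integrable without
  further argument.\<close>

definition bddm :: "'a measure \<Rightarrow> ('a \<Rightarrow> real) \<Rightarrow> bool" where
  "bddm M f \<longleftrightarrow> f \<in> borel_measurable M \<and> (\<exists>C. \<forall>x. \<bar>f x\<bar> \<le> C)"

lemma bddm_measurable: "bddm M f \<Longrightarrow> f \<in> borel_measurable M"
  by (simp add: bddm_def)

lemma bddm_const: "bddm M (\<lambda>x. c)"
  by (auto simp: bddm_def)

lemma bddm_add:
  assumes "bddm M f" "bddm M g"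
  shows "bddm M (\<lambda>x. f x + g x)"
proof -
  obtain C C' where "\<And>x. \<bar>f x\<bar> \<le> C" "\<And>x. \<bar>g x\<bar> \<le> C'" using assms unfolding bddm_def by metis
  then have "\<bar>f x + g x\<bar> \<le> C + C'" for x by (intro order_trans[OF abs_triangle_ineq] add_mono)
  then show ?thesis using assms unfolding bddm_def by (intro conjI exI[of _ "C + C'"]) auto
qed

lemma bddm_mult:
  assumes "bddm M f" "bddm M g"
  shows "bddm M (\<lambda>x. f x * g x)"
proof -
  obtain C C' where C: "\<And>x. \<bar>f x\<bar> \<le> C" "\<And>x. \<bar>g x\<bar> \<le> C'" using assms unfolding bddm_def by metis
  have "\<bar>f x * g x\<bar> \<le> C * C'" for x
    unfolding abs_mult by (intro mult_mono C) (auto intro: order_trans[OF abs_ge_zero C(1)])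
  then show ?thesis using assms unfolding bddm_def by (intro conjI exI[of _ "C * C'"]) auto
qed

lemma bddm_diff: "bddm M f \<Longrightarrow> bddm M g \<Longrightarrow> bddm M (\<lambda>x. f x - g x)"
  using bddm_add[of M f "\<lambda>x. -1 * g x"] bddm_mult[OF bddm_const[of M "-1"], of g] by simp

lemma bddm_sum: "(\<And>l. l \<in> L \<Longrightarrow> bddm M (f l)) \<Longrightarrow> bddm M (\<lambda>x. \<Sum>l\<in>L. f l x)"
  by (induction L rule: infinite_finite_induct) (auto intro: bddm_const bddm_add)

lemma bddm_comp: "bddm M f \<Longrightarrow> g \<in> measurable N M \<Longrightarrow> bddm N (\<lambda>x. f (g x))"
  unfolding bddm_def by (auto intro: measurable_compose)

lemma (in finite_measure) bddm_integrable: "bddm M f \<Longrightarrow> integrable M f"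
  unfolding bddm_def by (metis integrable_const_bound AE_I2 real_norm_def)

lemma bddm_mmult: "(\<And>i j. bddm M (\<lambda>x. A x i j)) \<Longrightarrow> (\<And>i j. bddm M (\<lambda>x. B x i j)) \<Longrightarrow> bddm M (\<lambda>x. mmult d (A x) (B x) i j)"
  unfolding mmult_def by (intro bddm_sum bddm_mult)

lemma bddm_mpow: "(\<And>i j. bddm M (\<lambda>x. A x i j)) \<Longrightarrow> bddm M (\<lambda>x. mpow d (A x) r i j)"
  by (induction r arbitrary: i j) (auto intro: bddm_const bddm_mmult)

lemma bddm_tr: "(\<And>i j. bddm M (\<lambda>x. A x i j)) \<Longrightarrow> bddm M (\<lambda>x. tr d (A x))"
  unfolding tr_def by (intro bddm_sum)

lemmas bddm_intros = bddm_const bddm_add bddm_mult bddm_diff bddm_sum bddm_mmult bddm_mpow bddm_tr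

text \<open>When coordinate \<open>j\<close> is integrated separately, the integrand with
  \<open>j\<close> overwritten no longer depends on the old value, so the old value integrates to
  1.\<close>

lemma nn_integral_PiM_resample:
  assumes N: "prob_space N" and J: "finite J" "j \<in> J" and f: "f \<in> borel_measurable (PiM J (\<lambda>_. N))"
  shows "(\<integral>\<^sup>+\<omega>. f \<omega> \<partial>PiM J (\<lambda>_. N)) = (\<integral>\<^sup>+\<omega>. (\<integral>\<^sup>+y. f (fun_upd \<omega> j y) \<partial>N) \<partial>PiM J (\<lambda>_. N))"
proof -
  interpret N: prob_space N by fact
  interpret P: product_sigma_finite "\<lambda>_. N" ..
  define I where "I = J - {j}"
  have I: "finite I" "j \<notin> I" "J = insert j I" using J by (auto simp: I_def)
  have [measurable]: "f \<in> borel_measurable (PiM (insert j I) (\<lambda>_. N))" using f I by simp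
  have 1: "(\<lambda>\<omega>. (\<integral>\<^sup>+y. f (fun_upd \<omega> j y) \<partial>N)) \<in> borel_measurable (PiM (insert j I) (\<lambda>_. N))"
  proof (rule N.borel_measurable_nn_integral)
    have [measurable]: "(\<lambda>x. (fst x)(j := snd x)) \<in> measurable (PiM (insert j I) (\<lambda>_. N) \<Otimes>\<^sub>M N) (PiM (insert j I) (\<lambda>_. N))"
      by (rule measurable_fun_upd[where J = "insert j I"]) auto
    show "(\<lambda>(\<omega>, y). f (fun_upd \<omega> j y)) \<in> borel_measurable (PiM (insert j I) (\<lambda>_. N) \<Otimes>\<^sub>M N)"
      unfolding case_prod_beta by measurable
  qed
  have "(\<integral>\<^sup>+\<omega>. (\<integral>\<^sup>+y. f (fun_upd \<omega> j y) \<partial>N) \<partial>PiM J (\<lambda>_. N))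
      = (\<integral>\<^sup>+x. (\<integral>\<^sup>+z. (\<integral>\<^sup>+y. f ((x(j := z))(j := y)) \<partial>N) \<partial>N) \<partial>PiM I (\<lambda>_. N))"
    unfolding I(3) by (rule P.product_nn_integral_insert[OF I(1,2) 1])
  also have "\<dots> = (\<integral>\<^sup>+x. (\<integral>\<^sup>+y. f (x(j := y)) \<partial>N) \<partial>PiM I (\<lambda>_. N))"
    by (simp add: N.emeasure_space_1)
  also have "\<dots> = (\<integral>\<^sup>+\<omega>. f \<omega> \<partial>PiM J (\<lambda>_. N))"
    unfolding I(3) by (rule P.product_nn_integral_insert[OF I(1,2), symmetric]) simp
  finally show ?thesis ..
qed

text \<open>Exchangeability: the value at \<open>j\<close> trades places with the spare copy. The
  proof resamples \<open>j\<close>, exchanges the two independent values by Tonelli, and undoes the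
  resampling.\<close>

lemma distr_PiM_swap:
  assumes N: "prob_space N" and J: "finite J" "j \<in> J"
  defines "M \<equiv> PiM J (\<lambda>_. N)"
  defines "sw \<equiv> \<lambda>q. ((fst q)(j := snd q), fst q j)"
  shows "distr (M \<Otimes>\<^sub>M N) (M \<Otimes>\<^sub>M N) sw = M \<Otimes>\<^sub>M N" "sw \<in> measurable (M \<Otimes>\<^sub>M N) (M \<Otimes>\<^sub>M N)"
proof -
  let ?MN = "M \<Otimes>\<^sub>M N"
  interpret N: prob_space N by fact
  interpret P: product_sigma_finite "\<lambda>_. N" ..
  interpret M: prob_space M unfolding M_def by (intro prob_space_PiM N)
  interpret NN: pair_sigma_finite N N ..
  have upd[measurable]: "(\<lambda>x. (fst x)(j := snd x)) \<in> measurable ?MN M"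
    unfolding M_def by (rule measurable_fun_upd[where J = J]) (use J in auto)
  have pr[measurable]: "(\<lambda>\<omega>. \<omega> j) \<in> measurable M N"
    unfolding M_def using J by measurable
  show sw[measurable]: "sw \<in> measurable ?MN ?MN"
    unfolding sw_def by measurable
  show "distr ?MN ?MN sw = ?MN"
  proof (rule measure_eqI)
    fix B assume "B \<in> sets (distr ?MN ?MN sw)"
    then have B[measurable]: "B \<in> sets ?MN" by simp
    define F where "F q = (indicator B q :: ennreal)" for q
    have F[measurable]: "F \<in> borel_measurable ?MN" unfolding F_def by measurable
    have "emeasure (distr ?MN ?MN sw) B = (\<integral>\<^sup>+q. F q \<partial>distr ?MN ?MN sw)"
      unfolding F_def by simp
    also have "\<dots> = (\<integral>\<^sup>+q. F (sw q) \<partial>?MN)" by (rule nn_integral_distr) (simp_all add: sw F)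
    also have "\<dots> = (\<integral>\<^sup>+\<omega>. (\<integral>\<^sup>+y. F (fun_upd \<omega> j y, \<omega> j) \<partial>N) \<partial>M)"
      by (subst N.nn_integral_fst[symmetric]) (auto simp: sw_def)
    also have "\<dots> = (\<integral>\<^sup>+\<omega>. (\<integral>\<^sup>+z. (\<integral>\<^sup>+y. F (fun_upd (fun_upd \<omega> j z) j y, fun_upd \<omega> j z j) \<partial>N) \<partial>N) \<partial>M)"
      unfolding M_def
    proof (rule nn_integral_PiM_resample[OF N J])
      have "(\<lambda>q. F (sw q)) \<in> borel_measurable ?MN" by measurable
      then have "(\<lambda>\<omega>. (\<integral>\<^sup>+y. F (sw (\<omega>, y)) \<partial>N)) \<in> borel_measurable M"
        by (rule N.borel_measurable_nn_integral_fst)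
      then show "(\<lambda>\<omega>. (\<integral>\<^sup>+y. F (fun_upd \<omega> j y, \<omega> j) \<partial>N)) \<in> borel_measurable (PiM J (\<lambda>_. N))"
        by (simp add: sw_def M_def)
    qed
    also have "\<dots> = (\<integral>\<^sup>+\<omega>. (\<integral>\<^sup>+z. (\<integral>\<^sup>+y. F (fun_upd \<omega> j y, z) \<partial>N) \<partial>N) \<partial>M)" by simp
    also have "\<dots> = (\<integral>\<^sup>+\<omega>. (\<integral>\<^sup>+y. (\<integral>\<^sup>+z. F (fun_upd \<omega> j y, z) \<partial>N) \<partial>N) \<partial>M)"
    proof (rule nn_integral_cong)
      fix \<omega> assume w: "\<omega> \<in> space M"
      have "(\<lambda>p. (fun_upd \<omega> j (snd p), fst p)) \<in> measurable (N \<Otimes>\<^sub>M N) ?MN"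
      proof -
        have [measurable]: "(\<lambda>p. fun_upd \<omega> j (snd p)) \<in> measurable (N \<Otimes>\<^sub>M N) M"
          unfolding M_def by (rule measurable_fun_upd[where J = J]) (use J w in \<open>auto simp: M_def\<close>)
        show ?thesis by measurable
      qed
      then have "(\<lambda>p. F (fun_upd \<omega> j (snd p), fst p)) \<in> borel_measurable (N \<Otimes>\<^sub>M N)" by measurable
      then show "(\<integral>\<^sup>+z. (\<integral>\<^sup>+y. F (fun_upd \<omega> j y, z) \<partial>N) \<partial>N) = (\<integral>\<^sup>+y. (\<integral>\<^sup>+z. F (fun_upd \<omega> j y, z) \<partial>N) \<partial>N)"
        using NN.Fubini[of "\<lambda>p. F (fun_upd \<omega> j (snd p), fst p)"] by simp
    qed
    also have "\<dots> = (\<integral>\<^sup>+\<omega>. (\<integral>\<^sup>+z. F (\<omega>, z) \<partial>N) \<partial>M)"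
      unfolding M_def
      by (rule nn_integral_PiM_resample[OF N J, symmetric])
         (use N.borel_measurable_nn_integral_fst[OF F] in \<open>simp add: M_def\<close>)
    also have "\<dots> = (\<integral>\<^sup>+q. F q \<partial>?MN)" by (rule N.nn_integral_fst[OF F])
    also have "\<dots> = emeasure ?MN B" unfolding F_def by simp
    finally show "emeasure (distr ?MN ?MN sw) B = emeasure ?MN B" .
  qed simp
qed

text \<open>The constant \<open>b\<close> limits a single row, \<open>\<Lambda>\<close> the form of
  the summed second moments. Support and size conditions are imposed at every index, also outside
  \<open>J\<close>.\<close>

locale bounded_rank_one_sum = N: prob_space N
  for N :: "'a measure" +
  fixes J :: "'j set" and \<phi> :: "'j \<Rightarrow> 'a \<Rightarrow> nat \<Rightarrow> real" and d :: nat and b \<Lambda> :: real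
  assumes J: "finite J"
    and \<phi>_meas: "\<And>j i. j \<in> J \<Longrightarrow> (\<lambda>y. \<phi> j y i) \<in> borel_measurable N"
    and \<phi>_dim: "\<And>j y i. d \<le> i \<Longrightarrow> \<phi> j y i = 0"
    and \<phi>_bound: "\<And>j y. sqn d (\<phi> j y) \<le> b"
    and b: "0 < b"
    and second_moment: "\<And>v. (\<Sum>j\<in>J. (\<integral>y. (\<Sum>i<d. \<phi> j y i * v i)\<^sup>2 \<partial>N)) \<le> \<Lambda> * sqn d v"
begin

definition "A j y = (\<lambda>a c. \<phi> j y a * \<phi> j y c)"
definition "EA j = (\<lambda>a c. \<integral>y. A j y a c \<partial>N)"
definition "X j y = (\<lambda>a c. A j y a c - EA j a c)"
definition "M = PiM J (\<lambda>_. N)"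
definition "S \<omega> = (\<lambda>a c. \<Sum>j\<in>J. X j (\<omega> j) a c)"

sublocale M: prob_space M
  unfolding M_def by (intro prob_space_PiM) unfold_locales

abbreviation "MN \<equiv> M \<Otimes>\<^sub>M N"

sublocale Q: pair_prob_space M N ..

lemma \<phi>_abs: "\<bar>\<phi> j y i\<bar> \<le> sqrt b"
proof (cases "i < d")
  case True
  then have "(\<phi> j y i)\<^sup>2 \<le> sqn d (\<phi> j y)" unfolding sqn_def by (intro member_le_sum) auto
  then show ?thesis using \<phi>_bound[of j y] by (intro real_le_rsqrt) simp
qed (use b in \<open>simp add: \<phi>_dim\<close>)

lemma bddm_\<phi>: "j \<in> J \<Longrightarrow> bddm N (\<lambda>y. \<phi> j y i)"
  unfolding bddm_def using \<phi>_abs \<phi>_meas by blast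

lemma bddm_A: "j \<in> J \<Longrightarrow> bddm N (\<lambda>y. A j y a c)"
  unfolding A_def by (intro bddm_intros bddm_\<phi>)

lemma bddm_X: "j \<in> J \<Longrightarrow> bddm N (\<lambda>y. X j y a c)"
  unfolding X_def by (intro bddm_intros bddm_A)

lemma proj_measurable: "j \<in> J \<Longrightarrow> (\<lambda>\<omega>. \<omega> j) \<in> measurable M N"
  unfolding M_def by measurable

lemma bddm_S: "bddm M (\<lambda>\<omega>. S \<omega> a c)"
  unfolding S_def by (intro bddm_sum bddm_comp[OF bddm_X] proj_measurable)

lemma A_dim: "in_dim d (A j y)"
proof -
  have "\<phi> j y i = 0" if "\<not> i < d" for i using that by (intro \<phi>_dim) simp
  then show ?thesis unfolding A_def in_dim_def by (metis mult_eq_0_iff)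
qed

lemma EA_dim: "in_dim d (EA j)"
proof -
  have "A j y a c = 0" if "\<not> (a < d \<and> c < d)" for y a c
    using A_dim[of j y] that by (auto simp: in_dim_def)
  then have "EA j a c = 0" if "\<not> (a < d \<and> c < d)" for a c
    unfolding EA_def using that by simp
  then show ?thesis by (auto simp: in_dim_def)
qed

lemma X_dim: "in_dim d (X j y)"
  unfolding X_def by (intro in_dim_diff A_dim EA_dim)

lemma S_dim: "in_dim d (S \<omega>)"
  using X_dim unfolding S_def in_dim_def by (metis (no_types, lifting) sum.neutral)

lemma X_sym: "transp (X j y) = X j y"
proof -
  have "A j y a c = A j y c a" for y a c unfolding A_def by (rule mult.commute)
  then have "X j y a c = X j y c a" for a c unfolding X_def EA_def by presburger
  then show ?thesis by (simp add: transp_def fun_eq_iff)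
qed

lemma S_sym: "transp (S \<omega>) = S \<omega>"
proof -
  have "X j y a c = X j y c a" for j y a c using X_sym[of j y] by (metis transp_def)
  then have "S \<omega> a c = S \<omega> c a" for a c unfolding S_def by presburger
  then show ?thesis by (simp add: transp_def fun_eq_iff)
qed

lemmas bddm_intros' = bddm_intros bddm_S bddm_X bddm_A bddm_\<phi>

lemma qform_A: "qform d (A j y) v = (\<Sum>i<d. \<phi> j y i * v i)\<^sup>2"
  unfolding qform_def A_def power2_eq_square sum_product
  by (intro sum.cong refl) (simp only: ac_simps)

lemma qform_EA: "j \<in> J \<Longrightarrow> qform d (EA j) v = (\<integral>y. (\<Sum>i<d. \<phi> j y i * v i)\<^sup>2 \<partial>N)"
proof -
  assume j: "j \<in> J"
  have "(\<integral>y. qform d (A j y) v \<partial>N) = qform d (EA j) v"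
    unfolding qform_def EA_def
    by (subst Bochner_Integration.integral_sum, intro N.bddm_integrable bddm_intros bddm_A j)+ simp
  then show ?thesis by (simp add: qform_A)
qed

lemma qform_sum: "qform d (\<lambda>a c. \<Sum>l\<in>L. G l a c) v = (\<Sum>l\<in>L. qform d (G l) v)"
proof -
  have "(\<Sum>i<d. \<Sum>j<d. \<Sum>l\<in>L. v i * G l i j * v j) = (\<Sum>i<d. \<Sum>l\<in>L. \<Sum>j<d. v i * G l i j * v j)"
    by (rule sum.cong[OF refl], rule sum.swap)
  also have "\<dots> = (\<Sum>l\<in>L. \<Sum>i<d. \<Sum>j<d. v i * G l i j * v j)" by (rule sum.swap)
  finally show ?thesis unfolding qform_def sum_distrib_left sum_distrib_right .
qed

text \<open>The exchangeable pair: \<open>S\<close> at \<open>\<omega>\<close> and at \<open>\<omega>\<close> with coordinate \<open>j\<close> replaced by an independent copy.\<close>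
lemma trace_step:
  assumes j: "j \<in> J"
  shows "(\<integral>\<omega>. tr d (mmult d (X j (\<omega> j)) (mpow d (S \<omega>) (Suc (2 * r)))) \<partial>M)
    \<le> 2 * b * (2 * real r + 1) * ((\<integral>\<omega>. tr d (mmult d (A j (\<omega> j)) (mpow d (S \<omega>) (2 * r))) \<partial>M)
         + (\<integral>\<omega>. tr d (mmult d (EA j) (mpow d (S \<omega>) (2 * r))) \<partial>M))"
proof -
  define sw where "sw q = ((fst q)(j := snd q), fst q j)" for q :: "('j \<Rightarrow> 'a) \<times> 'a"
  have sw: "distr MN MN sw = MN" "sw \<in> measurable MN MN"
    using distr_PiM_swap[OF N.prob_space_axioms J j] unfolding sw_def M_def by auto
  have invar: "(\<integral>q. F (sw q) \<partial>MN) = (\<integral>q. F q \<partial>MN)" if "bddm MN F" for F :: "_ \<Rightarrow> real"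
    using integral_distr[OF sw(2) bddm_measurable[OF that]] sw(1) by simp
  have fstM: "(\<integral>q. f (fst q) \<partial>MN) = (\<integral>\<omega>. f \<omega> \<partial>M)" if "bddm M f" for f :: "_ \<Rightarrow> real"
  proof -
    have "bddm MN (\<lambda>q. f (fst q))" by (rule bddm_comp[OF that]) simp
    then have "integrable MN (\<lambda>q. f (fst q))" by (rule Q.bddm_integrable)
    from Q.integral_fst'[OF this] show ?thesis by (simp add: N.prob_space)
  qed
  have indep: "(\<integral>q. tr d (mmult d (G (snd q)) (H (fst q))) \<partial>MN)
      = (\<integral>\<omega>. tr d (mmult d (\<lambda>a c. \<integral>y. G y a c \<partial>N) (H \<omega>)) \<partial>M)"
    if G: "\<And>a c. bddm N (\<lambda>y. G y a c)" and H: "\<And>a c. bddm M (\<lambda>\<omega>. H \<omega> a c)" for G H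
  proof -
    have "bddm MN (\<lambda>q. tr d (mmult d (G (snd q)) (H (fst q))))"
      by (intro bddm_intros bddm_comp[OF G] bddm_comp[OF H]) auto
    then have "integrable MN (\<lambda>q. tr d (mmult d (G (snd q)) (H (fst q))))" by (rule Q.bddm_integrable)
    from Q.integral_fst'[OF this]
    have "(\<integral>q. tr d (mmult d (G (snd q)) (H (fst q))) \<partial>MN) = (\<integral>\<omega>. (\<integral>y. tr d (mmult d (G y) (H \<omega>)) \<partial>N) \<partial>M)"
      by simp
    also have "(\<lambda>\<omega>. \<integral>y. tr d (mmult d (G y) (H \<omega>)) \<partial>N) = (\<lambda>\<omega>. tr d (mmult d (\<lambda>a c. \<integral>y. G y a c \<partial>N) (H \<omega>)))"
      unfolding tr_def mmult_def
      by (intro ext, (subst Bochner_Integration.integral_sum, intro N.bddm_integrable bddm_intros G)+) simp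
    finally show ?thesis .
  qed
  define G where "G \<omega> = mpow d (S \<omega>) (Suc (2 * r))" for \<omega>
  define E where "E \<omega> = mpow d (S \<omega>) (2 * r)" for \<omega>
  define H where "H q = (\<lambda>a c. X j (fst q j) a c - X j (snd q) a c)" for q :: "('j \<Rightarrow> 'a) \<times> 'a"
  have Hsw: "H (sw q) = (\<lambda>a c. - H q a c)" for q
    by (simp add: H_def sw_def)
  have HS: "H q = (\<lambda>a c. S (fst q) a c - S (fst (sw q)) a c)" for q
  proof (intro ext)
    fix a c
    have "S (fst q) a c - S (fst (sw q)) a c = (\<Sum>i\<in>J. X i (fst q i) a c - X i (((fst q)(j := snd q)) i) a c)"
      by (simp add: S_def sw_def sum_subtractf)
    also have "\<dots> = (\<Sum>i\<in>J. if i = j then H q a c else 0)"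
      by (intro sum.cong) (auto simp: H_def)
    finally show "H q a c = S (fst q) a c - S (fst (sw q)) a c" using j J by simp
  qed
  have bG: "bddm M (\<lambda>\<omega>. G \<omega> a c)" "bddm M (\<lambda>\<omega>. E \<omega> a c)" for a c unfolding G_def E_def by (intro bddm_intros')+
  have bGq: "bddm MN (\<lambda>q. G (fst q) a c)" "bddm MN (\<lambda>q. E (fst q) a c)" for a c by (intro bddm_comp[OF bG(1)] bddm_comp[OF bG(2)] measurable_fst)+
  have bGs: "bddm MN (\<lambda>q. G (fst (sw q)) a c)" "bddm MN (\<lambda>q. E (fst (sw q)) a c)" for a c
    using bddm_comp[OF bGq(1) sw(2)] bddm_comp[OF bGq(2) sw(2)] by auto
  have pj: "(\<lambda>q. fst q j) \<in> measurable MN N"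
    using measurable_compose[OF measurable_fst proj_measurable[OF j]] .
  have bX: "bddm MN (\<lambda>q. X j (fst q j) a c)" "bddm MN (\<lambda>q. X j (snd q) a c)"
      "bddm MN (\<lambda>q. A j (fst q j) a c)" "bddm MN (\<lambda>q. A j (snd q) a c)" for a c
    using bddm_comp[OF bddm_X[OF j] pj] bddm_comp[OF bddm_X[OF j] measurable_snd]
      bddm_comp[OF bddm_A[OF j] pj] bddm_comp[OF bddm_A[OF j] measurable_snd] by blast+
  have bH: "bddm MN (\<lambda>q. H q a c)" for a c unfolding H_def by (intro bddm_diff bX)
  define L where "L = (\<integral>\<omega>. tr d (mmult d (X j (\<omega> j)) (G \<omega>)) \<partial>M)"
  have X0: "(\<integral>y. X j y a c \<partial>N) = 0" for a c
    unfolding X_def EA_def using N.bddm_integrable[OF bddm_A[OF j]] by (simp add: N.prob_space)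
  \<comment> \<open>The spare copy is independent of \<open>G (fst q)\<close> and its
    \<open>X\<close> is centred, so only the first half of \<open>H\<close> contributes.\<close>
  have L1: "(\<integral>q. tr d (mmult d (H q) (G (fst q))) \<partial>MN) = L"
  proof -
    have "(\<integral>q. tr d (mmult d (H q) (G (fst q))) \<partial>MN)
       = (\<integral>q. tr d (mmult d (X j (fst q j)) (G (fst q))) \<partial>MN) - (\<integral>q. tr d (mmult d (X j (snd q)) (G (fst q))) \<partial>MN)"
      unfolding H_def mmult_minus tr_minus
      by (rule Bochner_Integration.integral_diff) (intro Q.bddm_integrable bddm_intros bX bGq)+
    also have "(\<integral>q. tr d (mmult d (X j (fst q j)) (G (fst q))) \<partial>MN) = L"
      unfolding L_def by (rule fstM) (intro bddm_intros bG bddm_comp[OF bddm_X[OF j] proj_measurable[OF j]])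
    also have "(\<integral>q. tr d (mmult d (X j (snd q)) (G (fst q))) \<partial>MN) = 0"
      by (subst indep[OF bddm_X[OF j] bG(1)]) (simp add: X0 mmult_def tr_def)
    finally show ?thesis by simp
  qed
  \<comment> \<open>The swap reverses the sign of \<open>H\<close> and preserves the law, so
    evaluating the power at the swapped sample gives the opposite value. Subtracting the two
    identities turns \<open>2 * L\<close> into the mean of a difference of powers.\<close>
  have L2: "(\<integral>q. tr d (mmult d (H q) (G (fst (sw q)))) \<partial>MN) = - L"
  proof -
    have "(\<integral>q. tr d (mmult d (H (sw q)) (G (fst (sw q)))) \<partial>MN) = L"
      unfolding L1[symmetric] by (rule invar[of "\<lambda>q. tr d (mmult d (H q) (G (fst q)))"]) (intro bddm_intros bH bGq)
    moreover have "tr d (mmult d (H (sw q)) (G (fst (sw q)))) = - tr d (mmult d (H q) (G (fst (sw q))))" for q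
      unfolding Hsw using tr_scale[of d "-1"] mmult_scale[of d "-1" "H q"] by simp
    ultimately show ?thesis by simp
  qed
  define K where "K = (\<integral>q. tr d (mmult d (mmult d (H q) (H q)) (E (fst q))) \<partial>MN)"
  have K2: "(\<integral>q. tr d (mmult d (mmult d (H q) (H q)) (E (fst (sw q)))) \<partial>MN) = K"
  proof -
    have "(\<integral>q. tr d (mmult d (mmult d (H (sw q)) (H (sw q))) (E (fst (sw q)))) \<partial>MN) = K"
      unfolding K_def by (rule invar[of "\<lambda>q. tr d (mmult d (mmult d (H q) (H q)) (E (fst q)))"]) (intro bddm_intros bH bGq)
    moreover have "mmult d (H (sw q)) (H (sw q)) = mmult d (H q) (H q)" for q
      unfolding Hsw mmult_def by simp
    ultimately show ?thesis by simp
  qed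
  have "2 * L = (\<integral>q. tr d (mmult d (H q) (G (fst q))) - tr d (mmult d (H q) (G (fst (sw q)))) \<partial>MN)"
    by (subst Bochner_Integration.integral_diff) (auto simp: L1 L2 intro!: Q.bddm_integrable bddm_intros bH bGq bGs)
  also have "\<dots> \<le> (\<integral>q. (2 * real r + 1) * (tr d (mmult d (mmult d (H q) (H q)) (E (fst q))) + tr d (mmult d (mmult d (H q) (H q)) (E (fst (sw q))))) \<partial>MN)"
  proof (rule integral_mono)
    fix q
    have "tr d (mmult d (H q) (\<lambda>a c. G (fst q) a c - G (fst (sw q)) a c)) \<le> (2 * real r + 1) * (tr d (mmult d (mmult d (H q) (H q)) (E (fst q))) + tr d (mmult d (mmult d (H q) (H q)) (E (fst (sw q)))))"
      unfolding HS G_def E_def by (rule tr_mmult_power_diff_le[OF S_dim S_sym S_dim S_sym])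
    then show "tr d (mmult d (H q) (G (fst q))) - tr d (mmult d (H q) (G (fst (sw q)))) \<le> (2 * real r + 1) * (tr d (mmult d (mmult d (H q) (H q)) (E (fst q))) + tr d (mmult d (mmult d (H q) (H q)) (E (fst (sw q)))))"
      unfolding mmult_minus tr_minus .
  qed (intro Q.bddm_integrable bddm_intros bH bGq bGs)+
  also have "\<dots> = (2 * real r + 1) * (K + K)"
    by (simp, subst Bochner_Integration.integral_add) (auto simp: K2 K_def intro!: Q.bddm_integrable bddm_intros bH bGq bGs)
  finally have LK: "L \<le> (2 * real r + 1) * K" by simp
  have "K \<le> (\<integral>q. 2 * b * (tr d (mmult d (A j (fst q j)) (E (fst q))) + tr d (mmult d (A j (snd q)) (E (fst q)))) \<partial>MN)"
    unfolding K_def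
  proof (rule integral_mono)
    fix q
    define x y where "x = \<phi> j (fst q j)" "y = \<phi> j (snd q)"
    \<comment> \<open>The centring cancels in \<open>H = x x^T - y y^T\<close>. Hence
      \<open>H v\<close> is a combination of \<open>x\<close> and \<open>y\<close>, and the form of
      \<open>H^2\<close> is at most \<open>2 b\<close> times the sum of the two rank-one
      forms.\<close>
    have qfH: "qform d (mmult d (H q) (H q)) v \<le> qform d (\<lambda>a c. 2 * b * (A j (fst q j) a c + A j (snd q) a c)) v" for v
    proof -
      define x' y' where "x' = (\<Sum>i<d. x i * v i)" "y' = (\<Sum>i<d. y i * v i)"
      have Hxy: "H q a c = x a * x c - y a * y c" for a c by (simp add: H_def X_def A_def x_y_def)
      have Hv: "(\<Sum>c<d. H q a c * v c) = x a * x' - y a * y'" for a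
        by (simp add: Hxy x'_y'_def left_diff_distrib sum_subtractf sum_distrib_left mult.assoc)
      have "in_dim d (H q)" "transp (H q) = H q"
        unfolding H_def by (rule in_dim_diff[OF X_dim X_dim])
          (use X_sym in \<open>simp add: transp_def fun_eq_iff\<close>)
      then have "qform d (mmult d (H q) (H q)) v = (\<Sum>a<d. (\<Sum>c<d. H q a c * v c)\<^sup>2)"
        by (rule qform_square)
      also have "\<dots> \<le> (\<Sum>a<d. 2 * (x a)\<^sup>2 * x'\<^sup>2 + 2 * (y a)\<^sup>2 * y'\<^sup>2)"
      proof (intro sum_mono)
        fix a
        have "0 \<le> (x a * x' + y a * y')\<^sup>2" by simp
        then show "(\<Sum>c<d. H q a c * v c)\<^sup>2 \<le> 2 * (x a)\<^sup>2 * x'\<^sup>2 + 2 * (y a)\<^sup>2 * y'\<^sup>2"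
          unfolding Hv by (simp add: power2_eq_square algebra_simps)
      qed
      also have "\<dots> = 2 * sqn d x * x'\<^sup>2 + 2 * sqn d y * y'\<^sup>2"
        by (simp add: sqn_def sum.distrib sum_distrib_left sum_distrib_right mult.assoc)
      also have "\<dots> \<le> 2 * b * x'\<^sup>2 + 2 * b * y'\<^sup>2"
        using \<phi>_bound by (intro add_mono mult_right_mono mult_left_mono) (auto simp: x_y_def)
      also have "\<dots> = 2 * b * (qform d (A j (fst q j)) v + qform d (A j (snd q)) v)"
        by (simp add: qform_A x'_y'_def x_y_def algebra_simps)
      also have "\<dots> = qform d (\<lambda>a c. 2 * b * (A j (fst q j) a c + A j (snd q) a c)) v"
        by (simp add: qform_def sum.distrib sum_distrib_left algebra_simps)
      finally show ?thesis .
    qed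
    have "tr d (mmult d (mmult d (H q) (H q)) (E (fst q))) \<le> tr d (mmult d (\<lambda>a c. 2 * b * (A j (fst q j) a c + A j (snd q) a c)) (E (fst q)))"
      unfolding E_def by (rule tr_mmult_even_mono[OF S_dim S_sym qfH])
    then show "tr d (mmult d (mmult d (H q) (H q)) (E (fst q))) \<le> 2 * b * (tr d (mmult d (A j (fst q j)) (E (fst q))) + tr d (mmult d (A j (snd q)) (E (fst q))))"
      unfolding mmult_scale tr_scale mmult_plus tr_plus .
  qed (intro Q.bddm_integrable bddm_intros bH bGq bX)+
  also have "\<dots> = 2 * b * ((\<integral>q. tr d (mmult d (A j (fst q j)) (E (fst q))) \<partial>MN) + (\<integral>q. tr d (mmult d (A j (snd q)) (E (fst q))) \<partial>MN))"
    by (simp, subst Bochner_Integration.integral_add) (auto intro!: Q.bddm_integrable bddm_intros bGq bX)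
  also have "(\<integral>q. tr d (mmult d (A j (fst q j)) (E (fst q))) \<partial>MN) = (\<integral>\<omega>. tr d (mmult d (A j (\<omega> j)) (E \<omega>)) \<partial>M)"
    by (rule fstM) (intro bddm_intros bG bddm_comp[OF bddm_A[OF j] proj_measurable[OF j]])
  also have "(\<integral>q. tr d (mmult d (A j (snd q)) (E (fst q))) \<partial>MN) = (\<integral>\<omega>. tr d (mmult d (EA j) (E \<omega>)) \<partial>M)"
    by (subst indep[OF bddm_A[OF j] bG(2)]) (simp add: EA_def)
  finally have K: "K \<le> 2 * b * ((\<integral>\<omega>. tr d (mmult d (A j (\<omega> j)) (E \<omega>)) \<partial>M) + (\<integral>\<omega>. tr d (mmult d (EA j) (E \<omega>)) \<partial>M))" .
  have "L \<le> (2 * real r + 1) * (2 * b * ((\<integral>\<omega>. tr d (mmult d (A j (\<omega> j)) (E \<omega>)) \<partial>M) + (\<integral>\<omega>. tr d (mmult d (EA j) (E \<omega>)) \<partial>M)))"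
    by (rule order_trans[OF LK mult_left_mono[OF K]]) simp
  then show ?thesis unfolding L_def G_def E_def by (simp only: ac_simps)
qed

section \<open>Moment recursion and the resulting tail bound\<close>

definition "mom r = (\<integral>\<omega>. tr d (mpow d (S \<omega>) (2 * r)) \<partial>M)"

lemma mom_nonneg: "0 \<le> mom r"
  unfolding mom_def by (intro integral_nonneg_AE AE_I2 tr_even_nonneg S_dim S_sym)

text \<open>One factor \<open>S\<close> is expanded into its summands and \<open>trace_step\<close>
  is applied to each. The uncentred matrices add up to \<open>S\<close> plus their means, which
  produces an odd moment and twice \<open>\<Lambda> * mom r\<close>. Splitting the odd moment with
  weight \<open>\<tau>\<close> leaves exactly half of \<open>mom (Suc r)\<close> on the right, and
  this half is moved to the left.\<close>

lemma mom_Suc_le: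
  fixes r :: nat
  assumes \<Lambda>: "0 \<le> \<Lambda>"
  defines "\<tau> \<equiv> 2 * b * (2 * real r + 1)"
  shows "mom (Suc r) \<le> (\<tau>\<^sup>2 + 4 * \<Lambda> * \<tau>) * mom r"
proof -
  have \<tau>: "\<tau> > 0" unfolding \<tau>_def using b by simp
  define E where "E \<omega> = mpow d (S \<omega>) (2 * r)" for \<omega>
  define O' where "O' = (\<integral>\<omega>. tr d (mpow d (S \<omega>) (Suc (2 * r))) \<partial>M)"
  have bA: "bddm M (\<lambda>\<omega>. A j (\<omega> j) a c)" "bddm M (\<lambda>\<omega>. X j (\<omega> j) a c)" if "j \<in> J" for j a c
    using that bddm_comp[OF bddm_A proj_measurable] bddm_comp[OF bddm_X proj_measurable] by auto
  have bE: "bddm M (\<lambda>\<omega>. E \<omega> a c)" for a c unfolding E_def by (intro bddm_intros bddm_S)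
  have "mom (Suc r) = (\<integral>\<omega>. (\<Sum>j\<in>J. tr d (mmult d (X j (\<omega> j)) (mpow d (S \<omega>) (Suc (2 * r))))) \<partial>M)"
  proof -
    have "tr d (mpow d (S \<omega>) (2 * Suc r)) = (\<Sum>j\<in>J. tr d (mmult d (X j (\<omega> j)) (mpow d (S \<omega>) (Suc (2 * r)))))" for \<omega>
    proof -
      have "mpow d (S \<omega>) (2 * Suc r) = mmult d (S \<omega>) (mpow d (S \<omega>) (Suc (2 * r)))" by simp
      then show ?thesis by (simp only: S_def mmult_sum tr_sum)
    qed
    then show ?thesis unfolding mom_def by simp
  qed
  also have "\<dots> = (\<Sum>j\<in>J. \<integral>\<omega>. tr d (mmult d (X j (\<omega> j)) (mpow d (S \<omega>) (Suc (2 * r)))) \<partial>M)"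
    by (intro Bochner_Integration.integral_sum M.bddm_integrable bddm_intros bA bddm_S)
  also have "\<dots> \<le> (\<Sum>j\<in>J. \<tau> * ((\<integral>\<omega>. tr d (mmult d (A j (\<omega> j)) (E \<omega>)) \<partial>M) + (\<integral>\<omega>. tr d (mmult d (EA j) (E \<omega>)) \<partial>M)))"
    unfolding \<tau>_def E_def by (intro sum_mono trace_step)
  also have "\<dots> = \<tau> * ((\<integral>\<omega>. (\<Sum>j\<in>J. tr d (mmult d (A j (\<omega> j)) (E \<omega>))) \<partial>M) + (\<integral>\<omega>. (\<Sum>j\<in>J. tr d (mmult d (EA j) (E \<omega>))) \<partial>M))"
    by (subst (1 2) Bochner_Integration.integral_sum)
       (auto simp: sum.distrib sum_distrib_left[symmetric] intro!: M.bddm_integrable bddm_intros bA bE)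
  also have "(\<integral>\<omega>. (\<Sum>j\<in>J. tr d (mmult d (A j (\<omega> j)) (E \<omega>))) \<partial>M) = O' + (\<integral>\<omega>. (\<Sum>j\<in>J. tr d (mmult d (EA j) (E \<omega>))) \<partial>M)"
  proof -
    have "(\<Sum>j\<in>J. tr d (mmult d (A j (\<omega> j)) (E \<omega>))) = tr d (mpow d (S \<omega>) (Suc (2 * r))) + (\<Sum>j\<in>J. tr d (mmult d (EA j) (E \<omega>)))" for \<omega>
    proof -
      have "tr d (mpow d (S \<omega>) (Suc (2 * r))) = (\<Sum>j\<in>J. tr d (mmult d (X j (\<omega> j)) (E \<omega>)))"
        unfolding mpow.simps E_def[symmetric] by (simp only: S_def mmult_sum tr_sum)
      then show ?thesis unfolding X_def mmult_minus tr_minus by (simp add: sum_subtractf)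
    qed
    then show ?thesis unfolding O'_def
      by (simp del: mpow.simps, subst Bochner_Integration.integral_add) (auto intro!: M.bddm_integrable bddm_intros bddm_S bE simp del: mpow.simps)
  qed
  also have "(\<integral>\<omega>. (\<Sum>j\<in>J. tr d (mmult d (EA j) (E \<omega>))) \<partial>M) \<le> (\<integral>\<omega>. \<Lambda> * tr d (E \<omega>) \<partial>M)"
  proof (rule integral_mono)
    fix \<omega>
    have "(\<Sum>j\<in>J. tr d (mmult d (EA j) (E \<omega>))) = tr d (mmult d (\<lambda>a c. \<Sum>j\<in>J. EA j a c) (E \<omega>))"
      by (simp only: mmult_sum tr_sum)
    also have "\<dots> \<le> tr d (mmult d (\<lambda>a c. \<Lambda> * mpow d (S \<omega>) 0 a c) (E \<omega>))"
      unfolding E_def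
    proof (rule tr_mmult_even_mono[OF S_dim S_sym])
      fix v
      have "qform d (\<lambda>a c. \<Sum>j\<in>J. EA j a c) v \<le> \<Lambda> * sqn d v"
        unfolding qform_sum using second_moment[of v] by (simp add: qform_EA)
      also have "\<dots> = qform d (\<lambda>a c. \<Lambda> * mpow d (S \<omega>) 0 a c) v"
      proof -
        have "qform d (\<lambda>a c. \<Lambda> * mpow d (S \<omega>) 0 a c) v = (\<Sum>a<d. \<Sum>c<d. if c = a then \<Lambda> * (v a)\<^sup>2 else 0)"
          unfolding qform_def by (intro sum.cong refl) (auto simp: power2_eq_square)
        then show ?thesis by (simp add: sqn_def sum_distrib_left)
      qed
      finally show "qform d (\<lambda>a c. \<Sum>j\<in>J. EA j a c) v \<le> qform d (\<lambda>a c. \<Lambda> * mpow d (S \<omega>) 0 a c) v" .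
    qed
    also have "\<dots> = \<Lambda> * tr d (E \<omega>)"
      unfolding mmult_scale tr_scale E_def using mmult_one(1)[OF in_dim_mpow[OF S_dim]] by simp
    finally show "(\<Sum>j\<in>J. tr d (mmult d (EA j) (E \<omega>))) \<le> \<Lambda> * tr d (E \<omega>)" .
  qed (intro M.bddm_integrable bddm_intros bE)+
  also have "(\<integral>\<omega>. \<Lambda> * tr d (E \<omega>) \<partial>M) = \<Lambda> * mom r" unfolding E_def mom_def by simp
  finally have 1: "mom (Suc r) \<le> \<tau> * (O' + \<Lambda> * mom r + \<Lambda> * mom r)" using \<tau> by simp
  have 2: "O' \<le> (\<tau> * mom r + mom (Suc r) / \<tau>) / 2"
  proof -
    have "O' \<le> (\<integral>\<omega>. (\<tau> * tr d (mpow d (S \<omega>) (2 * r)) + tr d (mpow d (S \<omega>) (2 * Suc r)) * (1 / \<tau>)) * (1/2) \<partial>M)"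
      unfolding O'_def
    proof (rule integral_mono)
      fix \<omega>
      show "tr d (mpow d (S \<omega>) (Suc (2 * r))) \<le> (\<tau> * tr d (mpow d (S \<omega>) (2 * r)) + tr d (mpow d (S \<omega>) (2 * Suc r)) * (1 / \<tau>)) * (1/2)"
        using tr_odd_le[OF S_dim S_sym \<tau>] by (simp del: mpow.simps)
    qed (intro M.bddm_integrable bddm_intros bddm_S)+
    also have "\<dots> = (\<tau> * mom r + mom (Suc r) / \<tau>) / 2"
    proof -
      have "integrable M (\<lambda>\<omega>. \<tau> * tr d (mpow d (S \<omega>) (2 * r)))" "integrable M (\<lambda>\<omega>. tr d (mpow d (S \<omega>) (2 * Suc r)) * (1 / \<tau>))"
        by (intro M.bddm_integrable bddm_intros bddm_S)+
      then show ?thesis unfolding mom_def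
        by (simp only: Bochner_Integration.integral_add integral_mult_right_zero integral_mult_left_zero) simp
    qed
    finally show ?thesis .
  qed
  have "mom (Suc r) \<le> \<tau> * ((\<tau> * mom r + mom (Suc r) / \<tau>) / 2 + \<Lambda> * mom r + \<Lambda> * mom r)"
    by (rule order_trans[OF 1]) (use 2 \<tau> in \<open>intro mult_left_mono add_right_mono, auto\<close>)
  also have "\<dots> = (\<tau>\<^sup>2 * mom r + mom (Suc r)) / 2 + 2 * \<Lambda> * \<tau> * mom r"
    using \<tau> by (simp add: field_simps power2_eq_square)
  finally show ?thesis by (simp add: field_simps)
qed

text \<open>Below order \<open>q\<close> the hypothesis gives
  \<open>\<tau> \<le> 4 q b \<le> \<Lambda>\<close>, so the square of \<open>\<tau>\<close> is
  absorbed and a step costs at most \<open>5 * \<Lambda> * \<tau>\<close>. The recursion starts from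
  the trace \<open>d\<close> of the identity.\<close>

lemma mom_le:
  assumes q: "4 * real q * b \<le> \<Lambda>" and "r \<le> q"
  shows "mom r \<le> real d * (20 * \<Lambda> * real q * b) ^ r"
  using \<open>r \<le> q\<close>
proof (induction r)
  case 0
  have "mom 0 = real d" unfolding mom_def by (simp add: tr_def M.prob_space)
  then show ?case by simp
next
  case (Suc r)
  have \<Lambda>: "0 \<le> \<Lambda>" using q b by (meson mult_nonneg_nonneg of_nat_0_le_iff order_trans less_imp_le zero_le_numeral)
  define \<tau> where "\<tau> = 2 * b * (2 * real r + 1)"
  have "2 * real r + 1 \<le> 2 * real q" using Suc.prems by linarith
  then have "2 * b * (2 * real r + 1) \<le> 2 * b * (2 * real q)" using b by (intro mult_left_mono) auto
  then have \<tau>: "\<tau> \<le> 4 * real q * b" "0 \<le> \<tau>" unfolding \<tau>_def using b by auto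
  have "\<tau>\<^sup>2 + 4 * \<Lambda> * \<tau> \<le> \<Lambda> * \<tau> + 4 * \<Lambda> * \<tau>"
    unfolding power2_eq_square using \<tau> q by (intro add_right_mono mult_right_mono) auto
  also have "\<dots> = 5 * \<Lambda> * \<tau>" by simp
  also have "\<dots> \<le> 5 * \<Lambda> * (4 * real q * b)" using \<tau> \<Lambda> by (intro mult_left_mono) auto
  finally have *: "\<tau>\<^sup>2 + 4 * \<Lambda> * \<tau> \<le> 20 * \<Lambda> * real q * b" by simp
  have "mom (Suc r) \<le> (\<tau>\<^sup>2 + 4 * \<Lambda> * \<tau>) * mom r" unfolding \<tau>_def by (rule mom_Suc_le[OF \<Lambda>])
  also have "\<dots> \<le> (20 * \<Lambda> * real q * b) * (real d * (20 * \<Lambda> * real q * b) ^ r)"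
    using Suc * \<Lambda> b by (intro mult_mono mom_nonneg) auto
  finally show ?case by (simp only: power_Suc ac_simps)
qed

text \<open>Markov's inequality for the trace of order \<open>2 * 2 ^ s\<close>. The event concerns
  the trace alone and therefore serves all \<open>v\<close> at once.\<close>

lemma tail_bound:
  assumes q: "4 * real (2 ^ s) * b \<le> \<Lambda>" and x: "0 < x"
  obtains E where "E \<in> sets M"
    "measure M E \<ge> 1 - real d * (20 * \<Lambda> * real (2 ^ s) * b / x\<^sup>2) ^ (2 ^ s)"
    "\<And>\<omega> v. \<omega> \<in> E \<Longrightarrow> (\<Sum>j\<in>J. (\<Sum>i<d. \<phi> j (\<omega> j) i * v i)\<^sup>2)
        \<ge> (\<Sum>j\<in>J. (\<integral>y. (\<Sum>i<d. \<phi> j y i * v i)\<^sup>2 \<partial>N)) - x * sqn d v"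
proof
  define f where "f \<omega> = tr d (mpow d (S \<omega>) (2 * 2 ^ s))" for \<omega>
  have bf: "bddm M f" unfolding f_def by (intro bddm_intros bddm_S)
  have [measurable]: "f \<in> borel_measurable M" by (rule bddm_measurable[OF bf])
  define E where "E = {\<omega>\<in>space M. f \<omega> < x ^ (2 * 2 ^ s)}"
  show "E \<in> sets M" unfolding E_def by measurable
  have "measure M {\<omega>\<in>space M. x ^ (2 * 2 ^ s) \<le> f \<omega>} \<le> mom (2 ^ s) / x ^ (2 * 2 ^ s)"
    unfolding mom_def f_def[symmetric]
    by (rule integral_Markov_inequality_measure[where A = "{}"])
       (use x tr_even_nonneg[OF S_dim S_sym, where n = "2 ^ s"] M.bddm_integrable[OF bf, unfolded f_def] in \<open>auto simp: f_def\<close>)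
  also have "\<dots> \<le> (real d * (20 * \<Lambda> * real (2 ^ s) * b) ^ (2 ^ s)) / x ^ (2 * 2 ^ s)"
    using x by (intro divide_right_mono mom_le q) auto
  also have "\<dots> = real d * (20 * \<Lambda> * real (2 ^ s) * b / x\<^sup>2) ^ (2 ^ s)"
    by (simp add: power_divide power_mult)
  finally have "measure M (space M - E) \<le> real d * (20 * \<Lambda> * real (2 ^ s) * b / x\<^sup>2) ^ (2 ^ s)"
    by (rule order_trans[rotated]) (auto simp: E_def intro!: M.finite_measure_mono)
  then show "measure M E \<ge> 1 - real d * (20 * \<Lambda> * real (2 ^ s) * b / x\<^sup>2) ^ (2 ^ s)"
    using M.prob_compl[OF \<open>E \<in> sets M\<close>] by simp
  fix \<omega> v assume "\<omega> \<in> E"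
  then have "\<bar>qform d (S \<omega>) v\<bar> \<le> x * sqn d v"
    using x by (intro abs_qform_le_of_tr[OF S_dim S_sym, where s = s]) (auto simp: E_def f_def)
  moreover have "qform d (S \<omega>) v = (\<Sum>j\<in>J. (\<Sum>i<d. \<phi> j (\<omega> j) i * v i)\<^sup>2) - (\<Sum>j\<in>J. (\<integral>y. (\<Sum>i<d. \<phi> j y i * v i)\<^sup>2 \<partial>N))"
  proof -
    have "qform d (X j y) v = qform d (A j y) v - qform d (EA j) v" for j y
      by (simp add: qform_def X_def algebra_simps sum_subtractf)
    then show ?thesis unfolding S_def qform_sum by (simp add: qform_A qform_EA sum_subtractf)
  qed
  ultimately show "(\<Sum>j\<in>J. (\<Sum>i<d. \<phi> j (\<omega> j) i * v i)\<^sup>2)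
        \<ge> (\<Sum>j\<in>J. (\<integral>y. (\<Sum>i<d. \<phi> j y i * v i)\<^sup>2 \<partial>N)) - x * sqn d v" by linarith
qed

end

section \<open>Sub-Gaussian concentration\<close>

lemma exp_minus_le:
  fixes y :: real
  assumes y: "0 \<le> y"
  shows "exp (- y) \<le> 1 - y + y\<^sup>2"
proof -
  have "1 + y + y\<^sup>2 / 2 \<le> exp y" using exp_lower_Taylor_quadratic[of y] y by simp
  moreover have "(1 - y + y\<^sup>2) * (1 + y + y\<^sup>2 / 2) = 1 + (y ^ 2 + y ^ 3 + y ^ 4) / 2"
    by (simp add: field_simps power2_eq_square power3_eq_cube power4_eq_xxxx)
  then have "1 \<le> (1 - y + y\<^sup>2) * (1 + y + y\<^sup>2 / 2)" using y by simp
  moreover have "0 \<le> 1 - y + y\<^sup>2" using zero_le_power2[of "y - 1/2"] by (simp add: power2_eq_square algebra_simps)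
  ultimately have "1 \<le> (1 - y + y\<^sup>2) * exp y" by (meson mult_left_mono order_trans)
  then show ?thesis by (simp add: exp_minus field_simps)
qed

lemma exp_le_1_add_x_sq_exp_abs:
  fixes x :: real
  shows "exp x \<le> 1 + x + x\<^sup>2 * exp \<bar>x\<bar>"
proof (cases "0 \<le> x")
  case True
  have "(1 - x) * (1 + x) \<le> exp (- x) * (1 + x)"
    using exp_ge_add_one_self[of "-x"] True by (intro mult_right_mono) auto
  then have "1 \<le> exp (- x) * (1 + x) + x\<^sup>2" by (simp add: power2_eq_square algebra_simps)
  then have "exp x * 1 \<le> exp x * (exp (- x) * (1 + x) + x\<^sup>2)" by (intro mult_left_mono) auto
  also have "\<dots> = 1 + x + x\<^sup>2 * exp x" by (simp add: algebra_simps flip: exp_add)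
  finally show ?thesis using True by simp
next
  case False
  define y where "y = - x"
  have y: "y > 0" using False by (simp add: y_def)
  have "exp (- y) \<le> 1 - y + y\<^sup>2" using y by (intro exp_minus_le) simp
  also have "\<dots> \<le> 1 - y + y\<^sup>2 * exp y" using y by (simp add: mult_le_cancel_left1)
  finally show ?thesis using False by (simp add: y_def)
qed

text \<open>The linear term disappears when a centred variable is integrated; what is left equals 1
  at \<open>x = 0\<close>, so a bound of the form \<open>exp (const * s^2)\<close> remains possible
  for small \<open>s\<close>.\<close>

lemma exp_le_x_add_exp_sq:
  fixes x :: real
  shows "exp x \<le> x + exp (x\<^sup>2)"
proof -
  have sq: "1 + x\<^sup>2 \<le> exp (x\<^sup>2)" by (rule exp_ge_add_one_self)
  consider "x \<le> 0" | "0 \<le> x" "x \<le> 1" | "1 \<le> x" by linarith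
  then show ?thesis
  proof cases
    case 1
    define y where "y = - x"
    have y: "y \<ge> 0" using 1 by (simp add: y_def)
    have "exp (- y) \<le> 1 - y + y\<^sup>2" by (rule exp_minus_le[OF y])
    then show ?thesis using sq unfolding y_def power2_minus minus_minus by linarith
  next
    case 2
    then show ?thesis using exp_bound[of x] sq by linarith
  next
    case 3
    then have "exp x \<le> exp (x\<^sup>2)" using self_le_power[of x 2] by simp
    then show ?thesis using 3 by linarith
  qed
qed

text \<open>A square is linearised by an auxiliary Gaussian \<open>g\<close>: the mean of
  \<open>exp (a g U)\<close> over \<open>g\<close> is \<open>exp (a^2 U^2 / 2)\<close>. After
  exchanging the integrals the hypothesis applies for each fixed \<open>g\<close>.\<close>

lemma gaussian_mixture:
  assumes "prob_space N" and U[measurable]: "U \<in> borel_measurable N" and \<Gamma>: "0 < \<Gamma>"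
    and mgf: "\<And>s. (\<integral>\<^sup>+\<omega>. ennreal (exp (s * U \<omega>)) \<partial>N) \<le> ennreal (exp (\<Gamma> * s\<^sup>2))"
  shows "(\<integral>\<^sup>+\<omega>. ennreal (exp ((U \<omega>)\<^sup>2 / (8 * \<Gamma>))) \<partial>N) \<le> 2"
proof -
  interpret prob_space N by fact
  \<comment> \<open>This makes \<open>\<Gamma> * a^2 = 1 / 4\<close>, below the threshold
    \<open>1 / 2\<close>; the Gaussian mean of \<open>exp (g^2 / 4)\<close> is
    \<open>sqrt 2\<close>.\<close>
  define a where "a = 1 / (2 * sqrt \<Gamma>)"
  have a: "a\<^sup>2 = 1 / (4 * \<Gamma>)" using \<Gamma> by (simp add: a_def power_divide power_mult_distrib)
  have normal1: "(\<integral>\<^sup>+g. ennreal (normal_density \<mu> \<sigma> g) \<partial>lborel) = 1" if "\<sigma> > 0" for \<mu> \<sigma> :: real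
    using that by (simp add: nn_integral_eq_integral integrable_normal_density integral_normal_density normal_density_nonneg)
  have shift: "normal_density 0 1 g * exp (c * g) = exp (c\<^sup>2 / 2) * normal_density c 1 g" for c g :: real
    unfolding normal_density_def by (simp add: power2_eq_square field_simps flip: exp_add)
  have "(\<integral>\<^sup>+\<omega>. ennreal (exp ((U \<omega>)\<^sup>2 / (8 * \<Gamma>))) \<partial>N)
      = (\<integral>\<^sup>+\<omega>. (\<integral>\<^sup>+g. ennreal (normal_density 0 1 g) * ennreal (exp (a * g * U \<omega>)) \<partial>lborel) \<partial>N)"
  proof (rule nn_integral_cong)
    fix \<omega>
    have "(\<integral>\<^sup>+g. ennreal (normal_density 0 1 g) * ennreal (exp (a * g * U \<omega>)) \<partial>lborel)
        = (\<integral>\<^sup>+g. ennreal (exp ((a * U \<omega>)\<^sup>2 / 2)) * ennreal (normal_density (a * U \<omega>) 1 g) \<partial>lborel)"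
      using shift[of _ "a * U \<omega>"]
      by (intro nn_integral_cong) (simp add: normal_density_nonneg ac_simps flip: ennreal_mult)
    also have "\<dots> = ennreal (exp ((a * U \<omega>)\<^sup>2 / 2))" by (subst nn_integral_cmult) (auto simp: normal1)
    also have "(a * U \<omega>)\<^sup>2 / 2 = (U \<omega>)\<^sup>2 / (8 * \<Gamma>)" by (simp add: power_mult_distrib a)
    finally show "ennreal (exp ((U \<omega>)\<^sup>2 / (8 * \<Gamma>))) = (\<integral>\<^sup>+g. ennreal (normal_density 0 1 g) * ennreal (exp (a * g * U \<omega>)) \<partial>lborel)" ..
  qed
  also have "\<dots> = (\<integral>\<^sup>+g. (\<integral>\<^sup>+\<omega>. ennreal (normal_density 0 1 g) * ennreal (exp (a * g * U \<omega>)) \<partial>N) \<partial>lborel)"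
  proof -
    interpret P: pair_sigma_finite N lborel ..
    show ?thesis
      using P.Fubini[of "\<lambda>(\<omega>, g). ennreal (normal_density 0 1 g) * ennreal (exp (a * g * U \<omega>))"] by simp
  qed
  also have "\<dots> \<le> (\<integral>\<^sup>+g. ennreal (sqrt 2) * ennreal (normal_density 0 (sqrt 2) g) \<partial>lborel)"
  proof (rule nn_integral_mono)
    fix g :: real
    have "(\<integral>\<^sup>+\<omega>. ennreal (normal_density 0 1 g) * ennreal (exp (a * g * U \<omega>)) \<partial>N)
        \<le> ennreal (normal_density 0 1 g) * ennreal (exp (\<Gamma> * (a * g)\<^sup>2))"
      by (subst nn_integral_cmult) (auto intro!: mult_left_mono mgf)
    also have "\<Gamma> * (a * g)\<^sup>2 = g\<^sup>2 / 4" using \<Gamma> by (simp add: power_mult_distrib a)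
    also have "ennreal (normal_density 0 1 g) * ennreal (exp (g\<^sup>2 / 4)) = ennreal (sqrt 2) * ennreal (normal_density 0 (sqrt 2) g)"
    proof -
      have "exp (- g\<^sup>2 / 2) * exp (g\<^sup>2 / 4) = exp (- g\<^sup>2 / 4)" by (simp flip: exp_add)
      then have "normal_density 0 1 g * exp (g\<^sup>2 / 4) = sqrt 2 * normal_density 0 (sqrt 2) g"
        unfolding normal_density_def by (simp add: real_sqrt_mult field_simps)
      then show ?thesis by (simp add: normal_density_nonneg flip: ennreal_mult)
    qed
    finally show "(\<integral>\<^sup>+\<omega>. ennreal (normal_density 0 1 g) * ennreal (exp (a * g * U \<omega>)) \<partial>N) \<le> ennreal (sqrt 2) * ennreal (normal_density 0 (sqrt 2) g)" .
  qed
  also have "\<dots> = ennreal (sqrt 2)" by (subst nn_integral_cmult) (auto simp: normal1)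
  also have "\<dots> \<le> 2" using sqrt_le_D[of 2 4] by (simp add: ennreal_le_iff flip: ennreal_numeral) (rule real_le_lsqrt, auto)
  finally show ?thesis .
qed

lemma (in prob_space) integrable_of_nn_integral_exp:
  assumes [measurable]: "f \<in> borel_measurable M" and "(\<integral>\<^sup>+x. ennreal (exp (f x)) \<partial>M) \<le> ennreal C" "0 \<le> C"
  shows "integrable M (\<lambda>x. exp (f x))" "(\<integral>x. exp (f x) \<partial>M) \<le> C"
proof -
  show i: "integrable M (\<lambda>x. exp (f x))"
    using assms(2) by (intro integrableI_nonneg) (auto intro: le_less_trans[OF _ ennreal_less_top])
  show "(\<integral>x. exp (f x) \<partial>M) \<le> C"
    using assms nn_integral_eq_integral[OF i] by (simp add: ennreal_le_iff)
qed

text \<open>The exponential moment is used in two halves: one absorbs the quadratic Taylor factor,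
  the other dominates \<open>exp (l * \<bar>Y x\<bar>)\<close>. Hence the restriction of
  \<open>l\<close> to half of \<open>\<kappa>\<close>.\<close>

lemma (in prob_space) mgf_le_of_exp_moment:
  fixes \<kappa> l C :: real and Y :: "'a \<Rightarrow> real"
  assumes Y[measurable]: "Y \<in> borel_measurable M" and i: "integrable M (\<lambda>x. exp (\<kappa> * \<bar>Y x\<bar>))"
    and C: "(\<integral>x. exp (\<kappa> * \<bar>Y x\<bar>) \<partial>M) \<le> C" and \<kappa>: "0 < \<kappa>"
    and iY: "integrable M Y" and EY: "(\<integral>x. Y x \<partial>M) = 0" and l: "0 \<le> l" "l \<le> \<kappa> / 2"
  shows "integrable M (\<lambda>x. exp (l * Y x))" "(\<integral>x. exp (l * Y x) \<partial>M) \<le> exp (8 * C * l\<^sup>2 / \<kappa>\<^sup>2)"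
proof -
  show i2: "integrable M (\<lambda>x. exp (l * Y x))"
  proof (rule Bochner_Integration.integrable_bound[OF i])
    show "AE x in M. norm (exp (l * Y x)) \<le> norm (exp (\<kappa> * \<bar>Y x\<bar>))"
    proof (rule AE_I2)
      fix x
      have "l * Y x \<le> l * \<bar>Y x\<bar>" using l by (intro mult_left_mono) auto
      also have "\<dots> \<le> \<kappa> * \<bar>Y x\<bar>" using l \<kappa> by (intro mult_right_mono) auto
      finally show "norm (exp (l * Y x)) \<le> norm (exp (\<kappa> * \<bar>Y x\<bar>))" by simp
    qed
  qed auto
  have pt: "exp (l * Y x) \<le> 1 + l * Y x + (8 * l\<^sup>2 / \<kappa>\<^sup>2) * exp (\<kappa> * \<bar>Y x\<bar>)" for x
  proof -
    define u where "u = \<kappa> / 2 * \<bar>Y x\<bar>"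
    have u: "0 \<le> u" using \<kappa> by (simp add: u_def)
    have "u\<^sup>2 / 2 \<le> exp u" using exp_lower_Taylor_quadratic[OF u] u by linarith
    then have Y2: "(Y x)\<^sup>2 \<le> 8 / \<kappa>\<^sup>2 * exp u" using \<kappa> by (simp add: u_def power_mult_distrib field_simps)
    have "\<bar>l * Y x\<bar> \<le> u" unfolding u_def abs_mult using l by (intro mult_right_mono) auto
    then have e: "exp \<bar>l * Y x\<bar> \<le> exp u" by simp
    have "(l * Y x)\<^sup>2 * exp \<bar>l * Y x\<bar> \<le> (l\<^sup>2 * (8 / \<kappa>\<^sup>2 * exp u)) * exp u"
      unfolding power_mult_distrib by (intro mult_mono mult_left_mono Y2 e) auto
    also have "\<dots> = (8 * l\<^sup>2 / \<kappa>\<^sup>2) * exp (\<kappa> * \<bar>Y x\<bar>)" by (simp add: u_def flip: exp_add)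
    finally show ?thesis using exp_le_1_add_x_sq_exp_abs[of "l * Y x"] by linarith
  qed
  have "(\<integral>x. exp (l * Y x) \<partial>M) \<le> (\<integral>x. 1 + l * Y x + (8 * l\<^sup>2 / \<kappa>\<^sup>2) * exp (\<kappa> * \<bar>Y x\<bar>) \<partial>M)"
    by (intro integral_mono i2 pt) (use iY i in auto)
  also have "\<dots> = 1 + (8 * l\<^sup>2 / \<kappa>\<^sup>2) * (\<integral>x. exp (\<kappa> * \<bar>Y x\<bar>) \<partial>M)"
    using iY i by (simp add: EY prob_space)
  also have "\<dots> \<le> 1 + (8 * l\<^sup>2 / \<kappa>\<^sup>2) * C" by (intro add_left_mono mult_left_mono C) auto
  also have "\<dots> \<le> exp ((8 * l\<^sup>2 / \<kappa>\<^sup>2) * C)" by (rule exp_ge_add_one_self)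
  finally show "(\<integral>x. exp (l * Y x) \<partial>M) \<le> exp (8 * C * l\<^sup>2 / \<kappa>\<^sup>2)" by (simp add: ac_simps)
qed

lemma bernstein_PiM:
  fixes \<kappa> \<tau> C :: real and Y :: "'j \<Rightarrow> 'a \<Rightarrow> real"
  assumes N: "prob_space N" and J: "finite J"
    and Y: "\<And>j. j \<in> J \<Longrightarrow> Y j \<in> borel_measurable N"
    and i: "\<And>j. j \<in> J \<Longrightarrow> integrable N (\<lambda>x. exp (\<kappa> * \<bar>Y j x\<bar>))"
    and C: "\<And>j. j \<in> J \<Longrightarrow> (\<integral>x. exp (\<kappa> * \<bar>Y j x\<bar>) \<partial>N) \<le> C" and \<kappa>: "0 < \<kappa>" "\<kappa> \<le> 1" "1 \<le> C"
    and iY: "\<And>j. j \<in> J \<Longrightarrow> integrable N (Y j)" and EY: "\<And>j. j \<in> J \<Longrightarrow> (\<integral>x. Y j x \<partial>N) = 0"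
    and \<tau>: "0 < \<tau>" "\<tau> \<le> 1"
  shows "measure (PiM J (\<lambda>_. N)) {\<omega>\<in>space (PiM J (\<lambda>_. N)). \<tau> * real (card J) \<le> (\<Sum>j\<in>J. Y j (\<omega> j))}
    \<le> exp (- (\<tau>\<^sup>2 * \<kappa>\<^sup>2 / (32 * C)) * real (card J))"
proof -
  interpret N: prob_space N by fact
  interpret P: product_sigma_finite "\<lambda>_. N" ..
  define M where "M = PiM J (\<lambda>_. N)"
  interpret M: prob_space M unfolding M_def by (intro prob_space_PiM N)
  \<comment> \<open>The minimiser of \<open>8 C l^2 / \<kappa>^2 - l \<tau>\<close>. The upper
    bounds on \<open>\<tau>\<close> and \<open>\<kappa>\<close> and the lower bound on
    \<open>C\<close> keep it in the admissible range.\<close>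
  define l where "l = \<tau> * \<kappa>\<^sup>2 / (16 * C)"
  have l: "0 < l" using \<tau> \<kappa> by (simp add: l_def)
  have "\<tau> * \<kappa>\<^sup>2 \<le> 1 * \<kappa>" using \<tau> \<kappa> by (intro mult_mono) (auto simp: power2_eq_square mult_le_cancel_left2)
  also have "\<dots> \<le> 8 * C * \<kappa>" using \<kappa> by (intro mult_right_mono) auto
  finally have l2: "l \<le> \<kappa> / 2" using \<kappa> by (simp add: l_def field_simps)
  have mgf: "integrable N (\<lambda>x. exp (l * Y j x))" "(\<integral>x. exp (l * Y j x) \<partial>N) \<le> exp (8 * C * l\<^sup>2 / \<kappa>\<^sup>2)" if "j \<in> J" for j
    using N.mgf_le_of_exp_moment[OF Y[OF that] i[OF that] C[OF that] \<kappa>(1) iY[OF that] EY[OF that] _ l2] l by auto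
  define F where "F \<omega> = (\<Prod>j\<in>J. exp (l * Y j (\<omega> j)))" for \<omega>
  have F: "F \<omega> = exp (l * (\<Sum>j\<in>J. Y j (\<omega> j)))" for \<omega>
    unfolding F_def by (simp add: exp_sum[OF J] sum_distrib_left)
  have iF: "integrable M F" unfolding M_def F_def
    by (rule P.product_integrable_prod[OF J mgf(1)])
  have EF: "(\<integral>\<omega>. F \<omega> \<partial>M) \<le> exp (8 * C * l\<^sup>2 / \<kappa>\<^sup>2 * real (card J))"
  proof -
    have "(\<integral>\<omega>. F \<omega> \<partial>M) = (\<Prod>j\<in>J. \<integral>x. exp (l * Y j x) \<partial>N)"
      unfolding M_def F_def by (rule P.product_integral_prod[OF J mgf(1)])
    also have "\<dots> \<le> (\<Prod>j\<in>J. exp (8 * C * l\<^sup>2 / \<kappa>\<^sup>2))" by (intro prod_mono conjI mgf(2)) auto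
    also have "\<dots> = exp (8 * C * l\<^sup>2 / \<kappa>\<^sup>2 * real (card J))" by (simp add: exp_of_nat_mult[symmetric] mult.commute)
    finally show ?thesis .
  qed
  have set: "{\<omega>\<in>space M. \<tau> * real (card J) \<le> (\<Sum>j\<in>J. Y j (\<omega> j))} = {\<omega>\<in>space M. exp (l * (\<tau> * real (card J))) \<le> F \<omega>}"
    unfolding F using l by auto
  have "measure M {\<omega>\<in>space M. exp (l * (\<tau> * real (card J))) \<le> F \<omega>} \<le> (\<integral>\<omega>. F \<omega> \<partial>M) / exp (l * (\<tau> * real (card J)))"
    by (rule integral_Markov_inequality_measure[where A = "{}" and u = F]) (use iF in \<open>simp_all add: F_def prod_nonneg\<close>)
  also have "\<dots> \<le> exp (8 * C * l\<^sup>2 / \<kappa>\<^sup>2 * real (card J)) / exp (l * (\<tau> * real (card J)))"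
    by (intro divide_right_mono EF) auto
  also have "\<dots> = exp ((8 * C * l\<^sup>2 / \<kappa>\<^sup>2 - l * \<tau>) * real (card J))"
    by (simp add: algebra_simps flip: exp_diff)
  also have "8 * C * l\<^sup>2 / \<kappa>\<^sup>2 - l * \<tau> = - (\<tau>\<^sup>2 * \<kappa>\<^sup>2 / (32 * C))"
    using \<kappa> unfolding l_def by (simp add: power2_eq_square field_simps)
  finally show ?thesis unfolding M_def[symmetric] set .
qed

locale subgaussian_law = D: prob_space D for D :: "real measure" +
  fixes \<kappa> :: real
  assumes sets_D: "sets D = sets borel" and \<kappa>_pos: "0 < \<kappa>"
    and int_id: "integrable D (\<lambda>x. x)" and mean_D: "(\<integral>x. x \<partial>D) = 0" and var_D: "(\<integral>x. x\<^sup>2 \<partial>D) = 1"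
    and exp_sq: "(\<integral>\<^sup>+x. ennreal (exp (\<kappa> * x\<^sup>2)) \<partial>D) \<le> 2"
begin

lemma measurable_D[measurable_cong]: "sets D = sets borel" by (rule sets_D)

text \<open>The exponent that \<open>gaussian_mixture\<close> yields for
  \<open>\<Gamma> = 3 / (2 * \<kappa>)\<close>, the constant of \<open>mgf_D\<close>.\<close>

definition "\<kappa>' = \<kappa> / 12"

text \<open>Two regimes of \<open>q = s^2 / \<kappa>\<close>. If \<open>q \<le> 1\<close>, centring
  removes the first-order term and convexity of the exponential bounds
  \<open>exp (q \<kappa> x^2)\<close> by interpolation. If \<open>q > 1\<close>, Young's inequality
  is enough, since the constant 2 is swallowed by \<open>exp q\<close>.\<close>

lemma mgf_D: "integrable D (\<lambda>x. exp (s * x))" "(\<integral>x. exp (s * x) \<partial>D) \<le> exp (3 / (2 * \<kappa>) * s\<^sup>2)"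
proof -
  have i: "integrable D (\<lambda>x. exp (\<kappa> * x\<^sup>2))" "(\<integral>x. exp (\<kappa> * x\<^sup>2) \<partial>D) \<le> 2"
    using D.integrable_of_nn_integral_exp[of "\<lambda>x. \<kappa> * x\<^sup>2" 2] exp_sq by auto
  define q where "q = s\<^sup>2 / \<kappa>"
  have q0: "0 \<le> q" using \<kappa>_pos by (simp add: q_def)
  have b1: "s * x \<le> \<kappa> * x\<^sup>2 / 2 + q / 2" for x
  proof -
    have "0 \<le> (\<kappa> * x - s)\<^sup>2 / (2 * \<kappa>)" using \<kappa>_pos by simp
    then show ?thesis using \<kappa>_pos by (simp add: q_def power2_eq_square field_simps)
  qed
  have b2: "exp (s * x) \<le> exp (q / 2) * exp (\<kappa> * x\<^sup>2)" for x
  proof -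
    have "0 \<le> \<kappa> * x\<^sup>2" using \<kappa>_pos by simp
    then have "s * x \<le> q / 2 + \<kappa> * x\<^sup>2" using b1[of x] by linarith
    then show ?thesis unfolding exp_add[symmetric] by (simp only: exp_le_cancel_iff)
  qed
  show ie: "integrable D (\<lambda>x. exp (s * x))"
    by (rule Bochner_Integration.integrable_bound[of _ "\<lambda>x. exp (q / 2) * exp (\<kappa> * x\<^sup>2)"]) (use i b2 in auto)
  have "(\<integral>x. exp (s * x) \<partial>D) \<le> exp (3 / 2 * q)"
  proof (cases "q \<le> 1")
    case True
    have pt: "exp (s * x) \<le> s * x + (1 - q) + q * exp (\<kappa> * x\<^sup>2)" for x
    proof -
      have "exp ((1 - q) *\<^sub>R 0 + q *\<^sub>R (\<kappa> * x\<^sup>2)) \<le> (1 - q) * exp 0 + q * exp (\<kappa> * x\<^sup>2)"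
        using True q0 by (intro convex_onD[OF exp_convex]) auto
      moreover have "q * (\<kappa> * x\<^sup>2) = (s * x)\<^sup>2" using \<kappa>_pos by (simp add: q_def power_mult_distrib)
      ultimately show ?thesis using exp_le_x_add_exp_sq[of "s * x"] by simp
    qed
    have "(\<integral>x. exp (s * x) \<partial>D) \<le> (\<integral>x. s * x + (1 - q) + q * exp (\<kappa> * x\<^sup>2) \<partial>D)"
      by (intro integral_mono ie pt) (use int_id i in auto)
    also have "\<dots> = 1 - q + q * (\<integral>x. exp (\<kappa> * x\<^sup>2) \<partial>D)"
      using int_id i by (simp add: mean_D D.prob_space)
    also have "\<dots> \<le> 1 - q + q * 2" by (intro add_left_mono mult_left_mono i q0)
    also have "\<dots> \<le> exp q" using exp_ge_add_one_self[of q] by linarith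
    also have "\<dots> \<le> exp (3 / 2 * q)" using q0 by simp
    finally show ?thesis .
  next
    case False
    have "(\<integral>x. exp (s * x) \<partial>D) \<le> (\<integral>x. exp (q / 2) * exp (\<kappa> * x\<^sup>2) \<partial>D)"
      by (intro integral_mono ie b2) (use i in auto)
    also have "\<dots> \<le> exp (q / 2) * 2" using i by simp
    also have "\<dots> \<le> exp (q / 2) * exp q"
    proof (intro mult_left_mono)
      show "2 \<le> exp q" using exp_ge_add_one_self[of q] False by linarith
    qed simp
    also have "\<dots> = exp (3 / 2 * q)" by (simp flip: exp_add)
    finally show ?thesis .
  qed
  then show "(\<integral>x. exp (s * x) \<partial>D) \<le> exp (3 / (2 * \<kappa>) * s\<^sup>2)" by (simp add: q_def)
qed

end

section \<open>Linear images of sub-Gaussian rows\<close>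

definition lin :: "nat \<Rightarrow> vect \<Rightarrow> vect \<Rightarrow> real" where
  "lin n y a = (\<Sum>r<n. a r * y r)"

definition ip :: "nat \<Rightarrow> vect \<Rightarrow> vect \<Rightarrow> real" where
  "ip n y y' = (\<Sum>r<n. y r * y' r)"

context subgaussian_law
begin

abbreviation row_law :: "nat \<Rightarrow> (nat \<Rightarrow> real) measure" where
  "row_law n \<equiv> PiM {..<n} (\<lambda>_. D)"

lemma prob_space_row: "prob_space (row_law n)"
  by (intro prob_space_PiM) unfold_locales

lemma lin_measurable[measurable]: "lin n y \<in> borel_measurable (row_law n)"
  unfolding lin_def[abs_def] by measurable

lemma nn_mgf_lin:
  "(\<integral>\<^sup>+a. ennreal (exp (s * lin n y a)) \<partial>row_law n) \<le> ennreal (exp (3 / (2 * \<kappa>) * s\<^sup>2 * sqn n y))"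
proof -
  interpret P: product_sigma_finite "\<lambda>_::nat. D" ..
  have eq: "exp (s * lin n y a) = (\<Prod>r<n. exp ((s * y r) * a r))" for a
    by (simp add: lin_def sum_distrib_left exp_sum ac_simps)
  have i: "integrable (row_law n) (\<lambda>a. exp (s * lin n y a))"
    unfolding eq using P.product_integrable_prod[of "{..<n}" "\<lambda>r x. exp ((s * y r) * x)"] mgf_D(1) by simp
  have "(\<integral>a. exp (s * lin n y a) \<partial>row_law n) = (\<Prod>r<n. \<integral>x. exp ((s * y r) * x) \<partial>D)"
    unfolding eq using P.product_integral_prod[of "{..<n}" "\<lambda>r x. exp ((s * y r) * x)"] mgf_D(1) by simp
  also have "\<dots> \<le> (\<Prod>r<n. exp (3 / (2 * \<kappa>) * (s * y r)\<^sup>2))"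
    by (intro prod_mono conjI mgf_D(2)) auto
  also have "\<dots> = exp (3 / (2 * \<kappa>) * s\<^sup>2 * sqn n y)"
    unfolding exp_sum[OF finite_lessThan, symmetric]
    by (simp add: sqn_def sum_distrib_left power_mult_distrib mult.assoc)
  finally show ?thesis by (subst nn_integral_eq_integral[OF i]) (auto intro: ennreal_leI)
qed

lemma exp_sq_lin:
  assumes "sqn n y \<le> 1"
  shows "integrable (row_law n) (\<lambda>a. exp (\<kappa>' * (lin n y a)\<^sup>2))" "(\<integral>a. exp (\<kappa>' * (lin n y a)\<^sup>2) \<partial>row_law n) \<le> 2"
proof -
  interpret N: prob_space "row_law n" by (rule prob_space_row)
  have "(\<integral>\<^sup>+a. ennreal (exp ((lin n y a)\<^sup>2 / (8 * (3 / (2 * \<kappa>))))) \<partial>row_law n) \<le> 2"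
  proof (rule gaussian_mixture[OF prob_space_row lin_measurable])
    fix s
    have "3 / (2 * \<kappa>) * s\<^sup>2 * sqn n y \<le> 3 / (2 * \<kappa>) * s\<^sup>2 * 1"
      using assms \<kappa>_pos by (intro mult_left_mono) auto
    then show "(\<integral>\<^sup>+a. ennreal (exp (s * lin n y a)) \<partial>row_law n) \<le> ennreal (exp (3 / (2 * \<kappa>) * s\<^sup>2))"
      by (intro order_trans[OF nn_mgf_lin] ennreal_leI) simp
  qed (use \<kappa>_pos in simp)
  moreover have eq: "(lin n y a)\<^sup>2 / (8 * (3 / (2 * \<kappa>))) = \<kappa>' * (lin n y a)\<^sup>2" for a
    using \<kappa>_pos by (simp add: \<kappa>'_def)
  ultimately have "(\<integral>\<^sup>+a. ennreal (exp (\<kappa>' * (lin n y a)\<^sup>2)) \<partial>row_law n) \<le> ennreal 2" unfolding eq by simp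
  from N.integrable_of_nn_integral_exp[OF _ this]
  show "integrable (row_law n) (\<lambda>a. exp (\<kappa>' * (lin n y a)\<^sup>2))" "(\<integral>a. exp (\<kappa>' * (lin n y a)\<^sup>2) \<partial>row_law n) \<le> 2"
    by auto
qed

lemma \<kappa>'_pos: "0 < \<kappa>'"
  using \<kappa>_pos by (simp add: \<kappa>'_def)

text \<open>Fourth-moment constant of a unit linear form: \<open>x^4\<close> is at most
  \<open>2 / \<kappa>'^2\<close> times \<open>exp (\<kappa>' x^2)\<close>, whose mean is at most
  2.\<close>

definition "K4 = 4 / \<kappa>'\<^sup>2"

lemma K4_pos: "0 < K4"
  using \<kappa>'_pos by (simp add: K4_def)

lemma lin_scale: "lin n (\<lambda>r. c * y r) a = c * lin n y a"
  by (simp add: lin_def sum_distrib_left ac_simps)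

lemma sqn_scale: "sqn n (\<lambda>r. c * y r) = c\<^sup>2 * sqn n y"
  by (simp add: sqn_def sum_distrib_left power_mult_distrib)

lemma lin_pow4_unit:
  assumes "sqn n y \<le> 1"
  shows "integrable (row_law n) (\<lambda>a. (lin n y a) ^ 4)" "(\<integral>a. (lin n y a) ^ 4 \<partial>row_law n) \<le> K4"
proof -
  interpret N: prob_space "row_law n" by (rule prob_space_row)
  have pt: "(lin n y a) ^ 4 \<le> 2 / \<kappa>'\<^sup>2 * exp (\<kappa>' * (lin n y a)\<^sup>2)" for a
  proof -
    define u where "u = \<kappa>' * (lin n y a)\<^sup>2"
    have u: "0 \<le> u" using \<kappa>'_pos by (simp add: u_def)
    have "u\<^sup>2 / 2 \<le> exp u" using exp_lower_Taylor_quadratic[OF u] u by linarith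
    then have "2 / \<kappa>'\<^sup>2 * (u\<^sup>2 / 2) \<le> 2 / \<kappa>'\<^sup>2 * exp u" by (intro mult_left_mono) auto
    moreover have "2 / \<kappa>'\<^sup>2 * (u\<^sup>2 / 2) = (lin n y a) ^ 4"
      using \<kappa>'_pos by (simp add: u_def power_mult_distrib)
    ultimately show ?thesis by (simp add: u_def)
  qed
  show i: "integrable (row_law n) (\<lambda>a. (lin n y a) ^ 4)"
    by (rule Bochner_Integration.integrable_bound[of _ "\<lambda>a. 2 / \<kappa>'\<^sup>2 * exp (\<kappa>' * (lin n y a)\<^sup>2)"])
       (use exp_sq_lin(1)[OF assms] pt in auto)
  have "(\<integral>a. (lin n y a) ^ 4 \<partial>row_law n) \<le> (\<integral>a. 2 / \<kappa>'\<^sup>2 * exp (\<kappa>' * (lin n y a)\<^sup>2) \<partial>row_law n)"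
    by (intro integral_mono i pt) (use exp_sq_lin(1)[OF assms] in auto)
  also have "\<dots> \<le> 2 / \<kappa>'\<^sup>2 * 2"
    using exp_sq_lin(2)[OF assms] by (simp, intro divide_right_mono) auto
  finally show "(\<integral>a. (lin n y a) ^ 4 \<partial>row_law n) \<le> K4" by (simp add: K4_def)
qed

lemma lin_zero: "sqn n y = 0 \<Longrightarrow> lin n y a = 0"
  by (auto simp: sqn_def lin_def sum_nonneg_eq_0_iff intro!: sum.neutral)

lemma lin_sq_sq:
  shows "integrable (row_law n) (\<lambda>a. (lin n y a)\<^sup>2 * (lin n y' a)\<^sup>2)"
    "(\<integral>a. (lin n y a)\<^sup>2 * (lin n y' a)\<^sup>2 \<partial>row_law n) \<le> K4 * sqn n y * sqn n y'"
proof -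
  have "integrable (row_law n) (\<lambda>a. (lin n y a)\<^sup>2 * (lin n y' a)\<^sup>2) \<and>
    (\<integral>a. (lin n y a)\<^sup>2 * (lin n y' a)\<^sup>2 \<partial>row_law n) \<le> K4 * sqn n y * sqn n y'"
  proof (cases "sqn n y = 0 \<or> sqn n y' = 0")
    case True
    then have "(lin n y a)\<^sup>2 * (lin n y' a)\<^sup>2 = 0" for a using lin_zero by auto
    then show ?thesis using True by (simp only:) auto
  next
    case False
    define c c' where "c = 1 / sqrt (sqn n y)" "c' = 1 / sqrt (sqn n y')"
    define x x' where "x = (\<lambda>r. c * y r)" "x' = (\<lambda>r. c' * y' r)"
    have pos: "0 < sqn n y" "0 < sqn n y'" using False sqn_nonneg[of n] by (auto simp: order_less_le)
    then have c: "c\<^sup>2 = 1 / sqn n y" "c'\<^sup>2 = 1 / sqn n y'" by (simp_all add: c_c'_def power_divide)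
    have unit: "sqn n x \<le> 1" "sqn n x' \<le> 1" using pos by (simp_all add: x_x'_def sqn_scale c)
    have eq: "(lin n y a)\<^sup>2 * (lin n y' a)\<^sup>2 = sqn n y * sqn n y' * ((lin n x a)\<^sup>2 * (lin n x' a)\<^sup>2)" for a
      using pos by (simp add: x_x'_def lin_scale power_mult_distrib c)
    have pt: "(lin n x a)\<^sup>2 * (lin n x' a)\<^sup>2 \<le> ((lin n x a) ^ 4 + (lin n x' a) ^ 4) / 2" for a
      using sum_squares_bound[of "(lin n x a)\<^sup>2" "(lin n x' a)\<^sup>2"] by (simp add: power_mult[symmetric])
    have i: "integrable (row_law n) (\<lambda>a. (lin n x a)\<^sup>2 * (lin n x' a)\<^sup>2)"
      by (rule Bochner_Integration.integrable_bound[of _ "\<lambda>a. ((lin n x a) ^ 4 + (lin n x' a) ^ 4) / 2"])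
         (use lin_pow4_unit(1) unit pt in auto)
    have "(\<integral>a. (lin n x a)\<^sup>2 * (lin n x' a)\<^sup>2 \<partial>row_law n) \<le> (\<integral>a. ((lin n x a) ^ 4 + (lin n x' a) ^ 4) / 2 \<partial>row_law n)"
      by (intro integral_mono i pt) (use lin_pow4_unit(1) unit in auto)
    also have "\<dots> \<le> K4"
      using lin_pow4_unit[OF unit(1)] lin_pow4_unit[OF unit(2)] by simp
    finally have "(\<integral>a. (lin n x a)\<^sup>2 * (lin n x' a)\<^sup>2 \<partial>row_law n) \<le> K4" .
    then have "sqn n y * sqn n y' * (\<integral>a. (lin n x a)\<^sup>2 * (lin n x' a)\<^sup>2 \<partial>row_law n) \<le> sqn n y * sqn n y' * K4"
      using pos by (intro mult_left_mono) auto
    then show ?thesis unfolding eq using i by (simp add: ac_simps)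
  qed
  then show "integrable (row_law n) (\<lambda>a. (lin n y a)\<^sup>2 * (lin n y' a)\<^sup>2)"
    "(\<integral>a. (lin n y a)\<^sup>2 * (lin n y' a)\<^sup>2 \<partial>row_law n) \<le> K4 * sqn n y * sqn n y'" by auto
qed

text \<open>The Bochner integral of a non-integrable function is 0 by convention, and unit variance
  excludes this value.\<close>

lemma int_sq_D: "integrable D (\<lambda>x. x\<^sup>2)"
  using var_D not_integrable_integral_eq by fastforce

lemma coordinate_moment:
  assumes "r < n" "s < n"
  shows "integrable (row_law n) (\<lambda>a. a r * a s)" "(\<integral>a. a r * a s \<partial>row_law n) = (if r = s then 1 else 0)"
proof -
  interpret P: product_sigma_finite "\<lambda>_::nat. D" ..
  \<comment> \<open>The product of these factors over all coordinates is \<open>a r * a s\<close>,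
    both when \<open>r = s\<close> and when the indices differ, so independence applies in one
    form.\<close>
  define f where "f i x = (if i = r \<and> i = s then x\<^sup>2 else if i = r \<or> i = s then x else (1::real))" for i and x :: real
  have intf: "integrable D (f i)" for i
    unfolding f_def[abs_def] using int_id int_sq_D by (cases "i = r"; cases "i = s") auto
  have If: "integral\<^sup>L D (f i) = (if i = r \<and> i = s then 1 else if i = r \<or> i = s then 0 else 1)" for i
    unfolding f_def[abs_def] using mean_D var_D by (cases "i = r"; cases "i = s") (auto simp: D.prob_space)
  have prod: "(\<Prod>i<n. f i (a i)) = a r * a s" for a
  proof (cases "r = s")
    case True
    have "(\<Prod>i<n. f i (a i)) = (\<Prod>i\<in>{r}. f i (a i))"
      using assms True by (intro prod.mono_neutral_right) (auto simp: f_def)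
    then show ?thesis using True by (simp add: f_def power2_eq_square)
  next
    case False
    have "(\<Prod>i<n. f i (a i)) = (\<Prod>i\<in>{r, s}. f i (a i))"
      using assms by (intro prod.mono_neutral_right) (auto simp: f_def)
    then show ?thesis using False by (simp add: f_def)
  qed
  show "integrable (row_law n) (\<lambda>a. a r * a s)"
    using P.product_integrable_prod[of "{..<n}" f] intf by (simp add: prod)
  have "(\<integral>a. a r * a s \<partial>row_law n) = (\<Prod>i<n. integral\<^sup>L D (f i))"
    using P.product_integral_prod[of "{..<n}" f] intf by (simp add: prod)
  also have "\<dots> = (if r = s then 1 else 0)"
    unfolding If using assms by (auto intro!: prod.neutral prod_zero)
  finally show "(\<integral>a. a r * a s \<partial>row_law n) = (if r = s then 1 else 0)" .
qed

lemma lin_product: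
  shows "integrable (row_law n) (\<lambda>a. lin n y a * lin n y' a)" "(\<integral>a. lin n y a * lin n y' a \<partial>row_law n) = ip n y y'"
proof -
  have eq: "lin n y a * lin n y' a = (\<Sum>r<n. \<Sum>s<n. (y r * y' s) * (a r * a s))" for a
    unfolding lin_def sum_product by (intro sum.cong refl) (simp only: ac_simps)
  have i: "integrable (row_law n) (\<lambda>a. (y r * y' s) * (a r * a s))" if "r < n" "s < n" for r s
    using coordinate_moment(1)[OF that] by (rule integrable_mult_right)
  show "integrable (row_law n) (\<lambda>a. lin n y a * lin n y' a)"
    unfolding eq using i by (intro Bochner_Integration.integrable_sum) auto
  have "(\<integral>a. lin n y a * lin n y' a \<partial>row_law n) = (\<Sum>r<n. \<Sum>s<n. (\<integral>a. (y r * y' s) * (a r * a s) \<partial>row_law n))"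
    unfolding eq using i
    by (subst Bochner_Integration.integral_sum, force intro: Bochner_Integration.integrable_sum,
        intro sum.cong refl Bochner_Integration.integral_sum) auto
  also have "\<dots> = (\<Sum>r<n. \<Sum>s<n. if s = r then y r * y' r else 0)"
    by (intro sum.cong refl) (simp add: coordinate_moment)
  also have "\<dots> = ip n y y'" by (simp add: ip_def)
  finally show "(\<integral>a. lin n y a * lin n y' a \<partial>row_law n) = ip n y y'" .
qed

lemma ip_self: "ip n y y = sqn n y"
  by (simp add: ip_def sqn_def power2_eq_square)

lemma abs_ip_le:
  assumes "sqn n y \<le> 1" "sqn n y' \<le> 1"
  shows "\<bar>ip n y y'\<bar> \<le> 1"
proof -
  have "(ip n y y')\<^sup>2 \<le> sqn n y * sqn n y'"
    unfolding ip_def sqn_def by (rule Cauchy_Schwarz_ineq_sum)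
  also have "\<dots> \<le> 1 * 1" using assms by (intro mult_mono sqn_nonneg) auto
  finally show ?thesis by (simp add: abs_square_le_1)
qed

definition "\<kappa>B = min 1 (\<kappa>' / 2)"

text \<open>The rate of \<open>bernstein_PiM\<close> for \<open>C = 18\<close>, the mean bound of
  the envelope \<open>dom\<close> in \<open>bernstein_lin\<close>.\<close>

definition "cB = \<kappa>B\<^sup>2 / (32 * 18)"

lemma cB_pos: "0 < cB"
  using \<kappa>'_pos by (simp add: cB_def \<kappa>B_def)

lemma bernstein_lin:
  assumes J: "finite J" and y: "sqn n y \<le> 1" "sqn n y' \<le> 1" and g: "\<And>j. j \<in> J \<Longrightarrow> \<bar>g j\<bar> \<le> 2"
    and \<tau>: "0 < \<tau>" "\<tau> \<le> 1"
  shows "measure (PiM J (\<lambda>_. row_law n)) {\<omega>\<in>space (PiM J (\<lambda>_. row_law n)).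
       \<tau> * real (card J) \<le> (\<Sum>j\<in>J. g j * (lin n y (\<omega> j) * lin n y' (\<omega> j) - ip n y y'))}
    \<le> exp (- (cB * \<tau>\<^sup>2) * real (card J))"
proof -
  interpret N: prob_space "row_law n" by (rule prob_space_row)
  have k: "0 < \<kappa>B" "\<kappa>B \<le> 1" "2 * \<kappa>B \<le> \<kappa>'" using \<kappa>'_pos by (auto simp: \<kappa>B_def)
  define Y where "Y j a = g j * (lin n y a * lin n y' a - ip n y y')" for j a
  \<comment> \<open>The 9 bounds \<open>exp 2\<close>, which comes from the subtracted mean, and the
    half comes from the arithmetic-geometric mean inequality. Each of the two exponentials has mean
    at most 2, so the mean of \<open>dom\<close> is at most \<open>9 / 2 * 4 = 18\<close>.\<close>
  define dom where "dom a = 9 / 2 * (exp (\<kappa>' * (lin n y a)\<^sup>2) + exp (\<kappa>' * (lin n y' a)\<^sup>2))" for a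
  have pt: "exp (\<kappa>B * \<bar>Y j a\<bar>) \<le> dom a" if "j \<in> J" for j a
  proof -
    define u v where "u = (lin n y a)\<^sup>2" "v = (lin n y' a)\<^sup>2"
    have uv: "0 \<le> u" "0 \<le> v" by (simp_all add: u_v_def)
    have "2 * \<bar>lin n y a * lin n y' a\<bar> \<le> u + v"
      using sum_squares_bound[of "\<bar>lin n y a\<bar>" "\<bar>lin n y' a\<bar>"] by (simp add: u_v_def abs_mult)
    then have "\<bar>lin n y a * lin n y' a - ip n y y'\<bar> \<le> (u + v) / 2 + 1"
      using abs_ip_le[OF y] abs_triangle_ineq4[of "lin n y a * lin n y' a" "ip n y y'"] by argo
    then have "\<bar>Y j a\<bar> \<le> 2 * ((u + v) / 2 + 1)"
      unfolding Y_def abs_mult by (intro mult_mono g that) auto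
    also have "\<dots> = u + v + 2" by (simp only: distrib_left[of 2 _ 1]) simp
    finally have "\<kappa>B * \<bar>Y j a\<bar> \<le> \<kappa>B * (u + v + 2)" using k(1) by (intro mult_left_mono) auto
    also have "\<dots> \<le> 2 + \<kappa>' / 2 * u + \<kappa>' / 2 * v"
      using mult_right_mono[OF k(3) uv(1)] mult_right_mono[OF k(3) uv(2)] k(2) by (simp add: algebra_simps)
    finally have "exp (\<kappa>B * \<bar>Y j a\<bar>) \<le> exp 2 * (exp (\<kappa>' / 2 * u) * exp (\<kappa>' / 2 * v))"
      by (simp flip: exp_add)
    also have "\<dots> \<le> 9 * ((exp (\<kappa>' * u) + exp (\<kappa>' * v)) / 2)"
    proof (rule mult_mono)
      have "exp (2::real) = exp 1 * exp 1" by (simp flip: exp_add)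
      also have "\<dots> \<le> 3 * 3" using exp_le by (intro mult_mono) auto
      finally show "exp (2::real) \<le> 9" by simp
      show "exp (\<kappa>' / 2 * u) * exp (\<kappa>' / 2 * v) \<le> (exp (\<kappa>' * u) + exp (\<kappa>' * v)) / 2"
      proof -
        have "(exp (\<kappa>' / 2 * u))\<^sup>2 = exp (\<kappa>' * u)" "(exp (\<kappa>' / 2 * v))\<^sup>2 = exp (\<kappa>' * v)"
          by (simp_all add: power2_eq_square flip: exp_add)
        then show ?thesis using sum_squares_bound[of "exp (\<kappa>' / 2 * u)" "exp (\<kappa>' / 2 * v)"] by simp
      qed
    qed auto
    finally show ?thesis by (simp add: dom_def u_v_def)
  qed
  have idom: "integrable (row_law n) dom" "(\<integral>a. dom a \<partial>row_law n) \<le> 18"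
    unfolding dom_def[abs_def] using exp_sq_lin[OF y(1)] exp_sq_lin[OF y(2)] by auto
  have meas: "Y j \<in> borel_measurable (row_law n)" for j unfolding Y_def[abs_def] by measurable
  have iexp: "integrable (row_law n) (\<lambda>a. exp (\<kappa>B * \<bar>Y j a\<bar>))" if "j \<in> J" for j
  proof (rule Bochner_Integration.integrable_bound[OF idom(1)])
    show "AE a in row_law n. norm (exp (\<kappa>B * \<bar>Y j a\<bar>)) \<le> norm (dom a)"
      using pt[OF that] by (auto simp: dom_def)
  qed (use meas in measurable)
  have "measure (PiM J (\<lambda>_. row_law n)) {\<omega>\<in>space (PiM J (\<lambda>_. row_law n)). \<tau> * real (card J) \<le> (\<Sum>j\<in>J. Y j (\<omega> j))}
    \<le> exp (- (\<tau>\<^sup>2 * \<kappa>B\<^sup>2 / (32 * 18)) * real (card J))"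
  proof (rule bernstein_PiM[OF prob_space_row J meas iexp])
    fix j assume j: "j \<in> J"
    show "(\<integral>a. exp (\<kappa>B * \<bar>Y j a\<bar>) \<partial>row_law n) \<le> 18"
      by (rule order_trans[OF integral_mono[OF iexp[OF j] idom(1) pt[OF j]] idom(2)])
    show "integrable (row_law n) (Y j)" "(\<integral>a. Y j a \<partial>row_law n) = 0"
      unfolding Y_def[abs_def] using lin_product[of n y y'] by (simp_all add: N.prob_space)
  qed (use k \<tau> in auto)
  then show ?thesis unfolding Y_def cB_def by (simp add: ac_simps)
qed

text \<open>Truncating at a constant multiple of the mean squared norm loses only a small fraction of each
  second moment, by fourth moments; this suffices for lower bounds.\<close>
lemma lower_isometry:
  fixes Y :: "'j \<Rightarrow> nat \<Rightarrow> vect"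
  assumes J: "finite J" and D0: "0 < D0" and Y: "\<And>j. (\<Sum>s<d. sqn n (Y j s)) \<le> D0"
    and tight: "\<And>v. (\<Sum>j\<in>J. sqn n (\<lambda>r. \<Sum>s<d. v s * Y j s r)) \<le> real (card J) * sqn d v"
    and q: "80 * K4 * D0 * 2 ^ s \<le> real (card J)"
  obtains E where "E \<in> sets (PiM J (\<lambda>_. row_law n))"
    "measure (PiM J (\<lambda>_. row_law n)) E \<ge> 1 - real d * (160000 * K4 * D0 * 2 ^ s / real (card J)) ^ (2 ^ s)"
    "\<And>\<omega> v. \<omega> \<in> E \<Longrightarrow> (\<Sum>j\<in>J. (lin n (\<lambda>r. \<Sum>s<d. v s * Y j s r) (\<omega> j))\<^sup>2)
        \<ge> 19 / 20 * (\<Sum>j\<in>J. sqn n (\<lambda>r. \<Sum>s<d. v s * Y j s r)) - 1 / 20 * real (card J) * sqn d v"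
proof -
  interpret N: prob_space "row_law n" by (rule prob_space_row)
  define V where "V j a s = (if s < d then lin n (Y j s) a else 0)" for j a s
  \<comment> \<open>Then \<open>K4 * D0 / b = 1 / 20\<close>, the fraction of each second moment
    that truncation may remove.\<close>
  define b where "b = 20 * K4 * D0"
  have b: "0 < b" using D0 K4_pos by (simp add: b_def)
  define \<phi> where "\<phi> j a s = (if sqn d (V j a) \<le> b then V j a s else 0)" for j a s
  define W where "W j v = (\<lambda>r. \<Sum>s<d. v s * Y j s r)" for j v
  have Vmeas[measurable]: "(\<lambda>a. V j a s) \<in> borel_measurable (row_law n)" for j s
    unfolding V_def by (cases "s < d") auto
  have nmeas[measurable]: "(\<lambda>a. sqn d (V j a)) \<in> borel_measurable (row_law n)" for j
    unfolding sqn_def by measurable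
  have Vv: "(\<Sum>s<d. V j a s * v s) = lin n (W j v) a" for j a v
  proof -
    have "(\<Sum>s<d. V j a s * v s) = (\<Sum>s<d. \<Sum>r<n. a r * (v s * Y j s r))"
      by (intro sum.cong refl) (simp add: V_def lin_def sum_distrib_right, simp add: ac_simps)
    also have "\<dots> = (\<Sum>r<n. \<Sum>s<d. a r * (v s * Y j s r))" by (rule sum.swap)
    finally show ?thesis by (simp add: lin_def W_def sum_distrib_left)
  qed
  have phiv: "(\<Sum>s<d. \<phi> j a s * v s)\<^sup>2 = (if sqn d (V j a) \<le> b then (lin n (W j v) a)\<^sup>2 else 0)" for j a v
    by (auto simp: \<phi>_def Vv)
  have phi_le: "(\<Sum>s<d. \<phi> j a s * v s)\<^sup>2 \<le> (lin n (W j v) a)\<^sup>2" for j a v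
    unfolding phiv by simp
  have isq: "integrable (row_law n) (\<lambda>a. (lin n w a)\<^sup>2)" "(\<integral>a. (lin n w a)\<^sup>2 \<partial>row_law n) = sqn n w" for w
    using lin_product[of n w w] by (simp_all add: power2_eq_square ip_self sqn_def ip_def)
  have iphi: "integrable (row_law n) (\<lambda>a. (\<Sum>s<d. \<phi> j a s * v s)\<^sup>2)" for j v
  proof (rule Bochner_Integration.integrable_bound[OF isq(1)[of "W j v"]])
    show "(\<lambda>a. (\<Sum>s<d. \<phi> j a s * v s)\<^sup>2) \<in> borel_measurable (row_law n)" unfolding phiv by measurable
  qed (use phi_le in auto)
  have up: "(\<integral>a. (\<Sum>s<d. \<phi> j a s * v s)\<^sup>2 \<partial>row_law n) \<le> sqn n (W j v)" for j v
    using integral_mono[OF iphi isq(1) phi_le] by (simp add: isq)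
  have lo: "19 / 20 * sqn n (W j v) \<le> (\<integral>a. (\<Sum>s<d. \<phi> j a s * v s)\<^sup>2 \<partial>row_law n)" for j v
  proof -
    \<comment> \<open>Where truncation acts, \<open>sqn d (V j a) / b\<close> exceeds 1, so the lost
      mass is bounded by mixed fourth moments.\<close>
    have pt: "(lin n (W j v) a)\<^sup>2 \<le> (\<Sum>s<d. \<phi> j a s * v s)\<^sup>2 + 1 / b * (\<Sum>s<d. (lin n (Y j s) a)\<^sup>2 * (lin n (W j v) a)\<^sup>2)" for a
    proof -
      have e: "(\<Sum>s<d. (lin n (Y j s) a)\<^sup>2 * (lin n (W j v) a)\<^sup>2) = sqn d (V j a) * (lin n (W j v) a)\<^sup>2"
        by (simp add: sqn_def V_def sum_distrib_right)
      show ?thesis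
      proof (cases "sqn d (V j a) \<le> b")
        case True
        then show ?thesis unfolding phiv e using b sqn_nonneg[of d "V j a"] by simp
      next
        case False
        then have "b * (lin n (W j v) a)\<^sup>2 \<le> sqn d (V j a) * (lin n (W j v) a)\<^sup>2" by (intro mult_right_mono) auto
        then show ?thesis unfolding phiv e using False b by (simp add: field_simps)
      qed
    qed
    have i2: "integrable (row_law n) (\<lambda>a. 1 / b * (\<Sum>s<d. (lin n (Y j s) a)\<^sup>2 * (lin n (W j v) a)\<^sup>2))"
      by (intro integrable_mult_right Bochner_Integration.integrable_sum lin_sq_sq)
    have "sqn n (W j v) = (\<integral>a. (lin n (W j v) a)\<^sup>2 \<partial>row_law n)" by (simp add: isq)
    also have "\<dots> \<le> (\<integral>a. (\<Sum>s<d. \<phi> j a s * v s)\<^sup>2 + 1 / b * (\<Sum>s<d. (lin n (Y j s) a)\<^sup>2 * (lin n (W j v) a)\<^sup>2) \<partial>row_law n)"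
      by (intro integral_mono isq Bochner_Integration.integrable_add iphi i2 pt)
    also have "\<dots> = (\<integral>a. (\<Sum>s<d. \<phi> j a s * v s)\<^sup>2 \<partial>row_law n) + 1 / b * (\<Sum>s<d. \<integral>a. (lin n (Y j s) a)\<^sup>2 * (lin n (W j v) a)\<^sup>2 \<partial>row_law n)"
      by (subst Bochner_Integration.integral_add[OF iphi i2], subst integral_mult_right_zero,
          subst Bochner_Integration.integral_sum) (auto intro: lin_sq_sq)
    also have "(\<Sum>s<d. \<integral>a. (lin n (Y j s) a)\<^sup>2 * (lin n (W j v) a)\<^sup>2 \<partial>row_law n) \<le> (\<Sum>s<d. K4 * sqn n (Y j s) * sqn n (W j v))"
      by (intro sum_mono lin_sq_sq)
    also have "\<dots> = K4 * (\<Sum>s<d. sqn n (Y j s)) * sqn n (W j v)"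
      by (simp add: sum_distrib_left sum_distrib_right)
    also have "\<dots> \<le> K4 * D0 * sqn n (W j v)"
      using K4_pos by (intro mult_right_mono mult_left_mono Y sqn_nonneg) auto
    finally have "sqn n (W j v) \<le> (\<integral>a. (\<Sum>s<d. \<phi> j a s * v s)\<^sup>2 \<partial>row_law n) + 1 / b * (K4 * D0 * sqn n (W j v))"
      using b by (simp add: divide_right_mono)
    moreover have "1 / b * (K4 * D0 * sqn n (W j v)) = sqn n (W j v) / 20"
      using D0 K4_pos by (simp add: b_def)
    ultimately have "sqn n (W j v) \<le> (\<integral>a. (\<Sum>s<d. \<phi> j a s * v s)\<^sup>2 \<partial>row_law n) + sqn n (W j v) / 20"
      by (simp only:)
    then show ?thesis by simp
  qed
  interpret B: bounded_rank_one_sum "row_law n" J \<phi> d b "real (card J)"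
  proof
    show "(\<lambda>a. \<phi> j a i) \<in> borel_measurable (row_law n)" for j i unfolding \<phi>_def by measurable
    show "sqn d (\<phi> j a) \<le> b" for j a
      using b unfolding \<phi>_def[abs_def] by (cases "sqn d (V j a) \<le> b") (auto simp: sqn_def)
    \<comment> \<open>Truncation only lowers second moments, so tightness of the untruncated rows
      supplies \<open>\<Lambda> = card J\<close>.\<close>
    show "(\<Sum>j\<in>J. (\<integral>a. (\<Sum>i<d. \<phi> j a i * v i)\<^sup>2 \<partial>row_law n)) \<le> real (card J) * sqn d v" for v
      using up by (intro order_trans[OF sum_mono tight]) (simp add: W_def)
  qed (use J b in \<open>auto simp: \<phi>_def V_def\<close>)
  define c where "c = real (card J)"
  have c: "0 < c" using q K4_pos D0 unfolding c_def
    by (smt (verit) mult_pos_pos zero_less_power)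
  obtain E where E: "E \<in> sets B.M"
    "measure B.M E \<ge> 1 - real d * (20 * real (card J) * real (2 ^ s) * b / (1 / 20 * real (card J))\<^sup>2) ^ (2 ^ s)"
    "\<And>\<omega> v. \<omega> \<in> E \<Longrightarrow> (\<Sum>j\<in>J. (\<Sum>i<d. \<phi> j (\<omega> j) i * v i)\<^sup>2)
        \<ge> (\<Sum>j\<in>J. (\<integral>y. (\<Sum>i<d. \<phi> j y i * v i)\<^sup>2 \<partial>row_law n)) - 1 / 20 * real (card J) * sqn d v"
    using B.tail_bound[of s "1 / 20 * real (card J)"] q c unfolding b_def c_def
    by (auto simp: ac_simps)
  \<comment> \<open>The number is \<open>20 * 20 * 400\<close>: the moment constant, the 20 in
    \<open>b\<close>, and the inverse square of the deviation level \<open>1 / 20\<close>.\<close>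
  have e: "20 * real (card J) * real (2 ^ s) * b / (1 / 20 * real (card J))\<^sup>2 = 160000 * K4 * D0 * 2 ^ s / real (card J)"
    unfolding b_def c_def[symmetric] using c by (simp add: power2_eq_square field_simps)
  show ?thesis
  proof (rule that[of E])
    show "E \<in> sets (PiM J (\<lambda>_. row_law n))" using E(1) unfolding B.M_def .
    show "measure (PiM J (\<lambda>_. row_law n)) E \<ge> 1 - real d * (160000 * K4 * D0 * 2 ^ s / real (card J)) ^ (2 ^ s)"
      using E(2) unfolding B.M_def e .
    fix \<omega> v assume w: "\<omega> \<in> E"
    have "19 / 20 * (\<Sum>j\<in>J. sqn n (W j v)) - 1 / 20 * real (card J) * sqn d v
      \<le> (\<Sum>j\<in>J. (\<integral>y. (\<Sum>i<d. \<phi> j y i * v i)\<^sup>2 \<partial>row_law n)) - 1 / 20 * real (card J) * sqn d v"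
      unfolding sum_distrib_left by (intro diff_right_mono sum_mono lo)
    also have "\<dots> \<le> (\<Sum>j\<in>J. (\<Sum>i<d. \<phi> j (\<omega> j) i * v i)\<^sup>2)" by (rule E(3)[OF w])
    also have "\<dots> \<le> (\<Sum>j\<in>J. (lin n (W j v) (\<omega> j))\<^sup>2)" by (intro sum_mono phi_le)
    finally show "(\<Sum>j\<in>J. (lin n (\<lambda>r. \<Sum>s<d. v s * Y j s r) (\<omega> j))\<^sup>2)
        \<ge> 19 / 20 * (\<Sum>j\<in>J. sqn n (\<lambda>r. \<Sum>s<d. v s * Y j s r)) - 1 / 20 * real (card J) * sqn d v"
      unfolding W_def .
  qed
qed

end

section \<open>Upper isometry by a lattice net\<close>

text \<open>A sum of squares of linear forms is convex in each coordinate, so moving each coordinate in turn to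
  one of the two neighbouring integers need not decrease it.\<close>
lemma sum_squares_le_integer_point:
  fixes L :: "'j \<Rightarrow> nat \<Rightarrow> real" and x :: vect
  obtains c :: "nat \<Rightarrow> int" where "\<And>s. \<bar>real_of_int (c s) - x s\<bar> \<le> 1"
    "(\<Sum>j\<in>J. (\<Sum>s<k. L j s * x s)\<^sup>2) \<le> (\<Sum>j\<in>J. (\<Sum>s<k. L j s * real_of_int (c s))\<^sup>2)"
proof -
  define Q where "Q y = (\<Sum>j\<in>J. (\<Sum>s<k. L j s * y s)\<^sup>2)" for y :: vect
  have step: "Q y \<le> max (Q (y(r := a))) (Q (y(r := a + 1)))" if "a \<le> y r" "y r \<le> a + 1" for y r a
  proof -
    define \<theta> where "\<theta> = y r - a"
    have th: "0 \<le> \<theta>" "\<theta> \<le> 1" using that by (auto simp: \<theta>_def)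
    have sq: "((1 - \<theta>) * u + \<theta> * v)\<^sup>2 \<le> (1 - \<theta>) * u\<^sup>2 + \<theta> * v\<^sup>2" for u v :: real
    proof -
      have "0 \<le> \<theta> * (1 - \<theta>) * (u - v)\<^sup>2" using th by simp
      then show ?thesis by (simp add: power2_eq_square algebra_simps)
    qed
    have lin: "(\<Sum>s<k. L j s * y s) = (1 - \<theta>) * (\<Sum>s<k. L j s * (y(r := a)) s) + \<theta> * (\<Sum>s<k. L j s * (y(r := a + 1)) s)" for j
      unfolding sum_distrib_left sum.distrib[symmetric]
      by (intro sum.cong refl) (auto simp: \<theta>_def algebra_simps)
    have "Q y \<le> (\<Sum>j\<in>J. (1 - \<theta>) * (\<Sum>s<k. L j s * (y(r := a)) s)\<^sup>2 + \<theta> * (\<Sum>s<k. L j s * (y(r := a + 1)) s)\<^sup>2)"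
      unfolding Q_def by (intro sum_mono) (subst lin, rule sq)
    also have "\<dots> = (1 - \<theta>) * Q (y(r := a)) + \<theta> * Q (y(r := a + 1))"
      by (simp add: Q_def sum.distrib sum_distrib_left)
    also have "\<dots> \<le> (1 - \<theta>) * max (Q (y(r := a))) (Q (y(r := a + 1))) + \<theta> * max (Q (y(r := a))) (Q (y(r := a + 1)))"
      using th by (intro add_mono mult_left_mono) auto
    finally show ?thesis by (simp add: algebra_simps)
  qed
  have "\<exists>y. (\<forall>s. \<bar>y s - x s\<bar> \<le> 1) \<and> (\<forall>s<r. y s \<in> \<int>) \<and> (\<forall>s\<ge>r. y s = x s) \<and> Q x \<le> Q y" for r
  proof (induction r)
    case 0
    show ?case by (intro exI[of _ x]) auto
  next
    case (Suc r)
    then obtain y where y: "\<And>s. \<bar>y s - x s\<bar> \<le> 1" "\<And>s. s < r \<Longrightarrow> y s \<in> \<int>" "\<And>s. s \<ge> r \<Longrightarrow> y s = x s" "Q x \<le> Q y"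
      by blast
    define a where "a = real_of_int \<lfloor>y r\<rfloor>"
    have a: "a \<le> y r" "y r \<le> a + 1" unfolding a_def by linarith+
    define t where "t = (if Q (y(r := a)) \<ge> Q (y(r := a + 1)) then a else a + 1)"
    have "Q y \<le> Q (y(r := t))" using step[of a y r] a unfolding t_def by auto
    moreover have "t \<in> \<int>" unfolding t_def a_def by auto
    moreover have "\<bar>t - x r\<bar> \<le> 1" using a y(3)[of r] unfolding t_def by auto
    moreover define y' where "y' = y(r := t)"
    ultimately have "\<forall>s. \<bar>y' s - x s\<bar> \<le> 1" "\<forall>s<Suc r. y' s \<in> \<int>" "\<forall>s\<ge>Suc r. y' s = x s" "Q x \<le> Q y'"
      using y by (auto simp: less_Suc_eq)
    then show ?case by blast
  qed
  from this[of k] obtain y where y: "\<And>s. \<bar>y s - x s\<bar> \<le> 1" "\<And>s. s < k \<Longrightarrow> y s \<in> \<int>" "\<And>s. s \<ge> k \<Longrightarrow> y s = x s" "Q x \<le> Q y"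
    by blast
  define c where "c s = (if s < k then \<lfloor>y s\<rfloor> else \<lfloor>x s\<rfloor>)" for s
  have cy: "real_of_int (c s) = y s" if "s < k" for s using y(2)[OF that] that by (simp add: c_def)
  show ?thesis
  proof (rule that[of c])
    show "\<bar>real_of_int (c s) - x s\<bar> \<le> 1" for s
    proof (cases "s < k")
      case True
      then show ?thesis using cy[OF True] y(1)[of s] by simp
    next
      case False
      then show ?thesis unfolding c_def by (simp, linarith)
    qed
    have "Q y = Q (\<lambda>s. real_of_int (c s))" unfolding Q_def using cy by simp
    then show "(\<Sum>j\<in>J. (\<Sum>s<k. L j s * x s)\<^sup>2) \<le> (\<Sum>j\<in>J. (\<Sum>s<k. L j s * real_of_int (c s))\<^sup>2)"
      using y(4) unfolding Q_def by simp
  qed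
qed

text \<open>Integer points of norm at most \<open>2 sqrt k\<close>, the rounding targets for vectors
  of norm \<open>sqrt k\<close>. The box supplies finiteness and the product structure used in the
  count.\<close>

definition lattice_ball :: "nat \<Rightarrow> (nat \<Rightarrow> int) set" where
  "lattice_ball k = {c \<in> {..<k} \<rightarrow>\<^sub>E {- (2 * int k)..2 * int k}. (\<Sum>s<k. (c s)\<^sup>2) \<le> 4 * int k}"

lemma finite_lattice_ball: "finite (lattice_ball k)"
  unfolding lattice_ball_def
  by (rule finite_subset[of _ "{..<k} \<rightarrow>\<^sub>E {- (2 * int k)..2 * int k}"]) (auto intro!: finite_PiE)

lemma sum_exp_minus_sq_le: "(\<Sum>x = - int b..int b. exp (- (real_of_int x)\<^sup>2)) \<le> 3"
proof -
  have pt: "exp (- (real_of_int x)\<^sup>2) \<le> (1/2) ^ nat \<bar>x\<bar>" for x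
  proof -
    define y where "y = nat \<bar>x\<bar>"
    have "real y \<le> real y ^ 2" by (cases y) (auto simp: power2_eq_square)
    moreover have "(real_of_int x)\<^sup>2 = real y ^ 2" by (simp add: y_def)
    ultimately have "exp (- (real_of_int x)\<^sup>2) \<le> exp (real y * (- 1))" by simp
    also have "\<dots> = exp (- 1) ^ y" by (rule exp_of_nat_mult)
    also have "\<dots> \<le> (1/2) ^ y"
    proof (rule power_mono)
      show "exp (- 1 :: real) \<le> 1/2" using exp_ge_add_one_self[of "1::real"] by (simp add: exp_minus field_simps)
    qed auto
    finally show ?thesis by (simp add: y_def)
  qed
  have "(\<Sum>x = - int b..int b. exp (- (real_of_int x)\<^sup>2)) \<le> (\<Sum>x = - int b..int b. (1/2) ^ nat \<bar>x\<bar>)"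
    by (intro sum_mono pt)
  also have "\<dots> = 3 - 2 * (1/2::real) ^ b"
  proof (induction b)
    case (Suc b)
    have e: "{- int (Suc b)..int (Suc b)} = insert (- int (Suc b)) (insert (int (Suc b)) {- int b..int b})" by auto
    show ?case unfolding e using Suc by (simp add: nat_add_distrib)
  qed simp
  also have "\<dots> \<le> 3" by simp
  finally show ?thesis .
qed

text \<open>Each point of the ball has weight \<open>exp (4 k - \<Sum> c_s^2)\<close> at least 1.
  Summed over the whole box, the weight factorises into \<open>k\<close> one-dimensional theta sums,
  each at most \<open>3 \<le> exp 2\<close>.\<close>

lemma card_lattice_ball: "real (card (lattice_ball k)) \<le> exp (6 * real k)"
proof -
  define box where "box = {..<k} \<rightarrow>\<^sub>E {- (2 * int k)..2 * int k}"
  have fin: "finite box" unfolding box_def by (intro finite_PiE) auto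
  have "real (card (lattice_ball k)) = (\<Sum>c\<in>lattice_ball k. 1)" by simp
  also have "\<dots> \<le> (\<Sum>c\<in>lattice_ball k. exp (4 * real k) * (\<Prod>s<k. exp (- (real_of_int (c s))\<^sup>2)))"
  proof (rule sum_mono)
    fix c assume "c \<in> lattice_ball k"
    then have "(\<Sum>s<k. (c s)\<^sup>2) \<le> 4 * int k" by (simp add: lattice_ball_def)
    then have "real_of_int (\<Sum>s<k. (c s)\<^sup>2) \<le> real_of_int (4 * int k)" by (simp only: of_int_le_iff)
    then have "(1::real) \<le> exp (4 * real k + (\<Sum>s<k. - (real_of_int (c s))\<^sup>2))" by (simp add: sum_negf)
    then show "1 \<le> exp (4 * real k) * (\<Prod>s<k. exp (- (real_of_int (c s))\<^sup>2))" by (simp add: exp_add exp_sum)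
  qed
  also have "\<dots> \<le> (\<Sum>c\<in>box. exp (4 * real k) * (\<Prod>s<k. exp (- (real_of_int (c s))\<^sup>2)))"
  proof (rule sum_mono2[OF fin])
    show "lattice_ball k \<subseteq> box" unfolding lattice_ball_def box_def by (rule Collect_restrict)
    show "0 \<le> exp (4 * real k) * (\<Prod>s<k. exp (- (real_of_int (c s))\<^sup>2))" for c :: "nat \<Rightarrow> int"
      by (intro mult_nonneg_nonneg prod_nonneg ballI) simp_all
  qed
  also have "\<dots> = exp (4 * real k) * (\<Prod>s<k. \<Sum>x = - int (2 * k)..int (2 * k). exp (- (real_of_int x)\<^sup>2))"
    unfolding box_def sum_distrib_left[symmetric] by (subst prod_sum_PiE) auto
  also have "\<dots> \<le> exp (4 * real k) * (\<Prod>s<k. exp 2)"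
  proof (intro mult_left_mono prod_mono conjI)
    have "3 \<le> exp (2::real)" using exp_ge_add_one_self[of "2::real"] by simp
    then show "(\<Sum>x = - int (2 * k)..int (2 * k). exp (- (real_of_int x)\<^sup>2)) \<le> exp 2"
      using sum_exp_minus_sq_le[of "2 * k"] by linarith
  qed (auto intro!: sum_nonneg)
  also have "\<dots> = exp (6 * real k)" by (simp add: exp_of_nat_mult[symmetric] flip: exp_add)
  finally show ?thesis .
qed

section \<open>Combinations of orthonormal columns and the net argument\<close>

definition colcomb :: "nat \<Rightarrow> matr \<Rightarrow> vect \<Rightarrow> vect" where
  "colcomb k Z e = (\<lambda>r. \<Sum>s<k. e s * Z r s)"

lemma sum_colcomb_mult:
  assumes "orthonormal_cols n k Z"
  shows "(\<Sum>r<n. colcomb k Z e r * colcomb k Z f r) = (\<Sum>s<k. e s * f s)"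
proof -
  have "(\<Sum>r<n. colcomb k Z e r * colcomb k Z f r) = (\<Sum>r<n. \<Sum>s<k. \<Sum>s'<k. (e s * f s') * (Z r s * Z r s'))"
    unfolding colcomb_def sum_product by (intro sum.cong refl) (simp only: ac_simps)
  also have "\<dots> = (\<Sum>s<k. \<Sum>r<n. \<Sum>s'<k. (e s * f s') * (Z r s * Z r s'))" by (rule sum.swap)
  also have "\<dots> = (\<Sum>s<k. \<Sum>s'<k. \<Sum>r<n. (e s * f s') * (Z r s * Z r s'))"
    by (rule sum.cong[OF refl], rule sum.swap)
  also have "\<dots> = (\<Sum>s<k. \<Sum>s'<k. if s' = s then e s * f s else 0)"
  proof (rule sum.cong[OF refl], rule sum.cong[OF refl])
    fix s s' assume "s \<in> {..<k}" "s' \<in> {..<k}"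
    then show "(\<Sum>r<n. (e s * f s') * (Z r s * Z r s')) = (if s' = s then e s * f s else 0)"
      using assms unfolding sum_distrib_left[symmetric] orthonormal_cols_def by auto
  qed
  finally show ?thesis by simp
qed

lemma sqn_colcomb: "orthonormal_cols n k Z \<Longrightarrow> sqn n (colcomb k Z e) = sqn k e"
  using sum_colcomb_mult[of n k Z e e] by (simp add: sqn_def power2_eq_square)

context subgaussian_law
begin

lemma lin_colcomb: "lin n (colcomb k Z e) a = (\<Sum>s<k. lin n (\<lambda>r. Z r s) a * e s)"
proof -
  have "lin n (colcomb k Z e) a = (\<Sum>r<n. \<Sum>s<k. a r * (e s * Z r s))"
    by (simp add: lin_def colcomb_def sum_distrib_left)
  also have "\<dots> = (\<Sum>s<k. \<Sum>r<n. a r * (e s * Z r s))" by (rule sum.swap)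
  also have "\<dots> = (\<Sum>s<k. lin n (\<lambda>r. Z r s) a * e s)"
    unfolding lin_def sum_distrib_right by (intro sum.cong refl) (simp only: ac_simps)
  finally show ?thesis .
qed

lemma upper_isometry:
  assumes J: "finite J" and Z: "orthonormal_cols n k Z" and k: "1 \<le> k"
  obtains E where "E \<in> sets (PiM J (\<lambda>_. row_law n))"
    "measure (PiM J (\<lambda>_. row_law n)) E \<ge> 1 - exp (6 * real k - cB * real (card J))"
    "\<And>\<omega> e. \<omega> \<in> E \<Longrightarrow> (\<Sum>j\<in>J. (lin n (colcomb k Z e) (\<omega> j))\<^sup>2) \<le> 8 * real (card J) * sqn k e"
proof -
  define M where "M = PiM J (\<lambda>_. row_law n)"
  interpret M: prob_space M unfolding M_def by (intro prob_space_PiM prob_space_row)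
  define w where "w c = (\<lambda>s. (1 / (2 * sqrt (real k))) * real_of_int (c s))" for c :: "nat \<Rightarrow> int"
  define bad where "bad c = {\<omega>\<in>space M. 1 * real (card J) \<le> (\<Sum>j\<in>J. 1 * (lin n (colcomb k Z (w c)) (\<omega> j) * lin n (colcomb k Z (w c)) (\<omega> j) - ip n (colcomb k Z (w c)) (colcomb k Z (w c))))}" for c
  have sets: "bad c \<in> sets M" for c
  proof -
    have [measurable]: "(\<lambda>\<omega>. lin n y (\<omega> j)) \<in> borel_measurable M" if "j \<in> J" for y j
      unfolding M_def using that by (intro measurable_compose[OF measurable_component_singleton[OF that] lin_measurable])
    show ?thesis unfolding bad_def by measurable
  qed
  have wle: "sqn k (w c) \<le> 1" if "(\<Sum>s<k. (c s)\<^sup>2) \<le> 4 * int k" for c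
  proof -
    have "real_of_int (\<Sum>s<k. (c s)\<^sup>2) \<le> real_of_int (4 * int k)" using that by (simp only: of_int_le_iff)
    then have "sqn k (\<lambda>s. real_of_int (c s)) \<le> 4 * real k" by (simp add: sqn_def)
    then have "(1 / (2 * sqrt (real k)))\<^sup>2 * sqn k (\<lambda>s. real_of_int (c s)) \<le> (1 / (2 * sqrt (real k)))\<^sup>2 * (4 * real k)"
      by (intro mult_left_mono) auto
    also have "\<dots> = 1" using k by (simp add: power_divide power_mult_distrib)
    finally show ?thesis unfolding w_def sqn_scale .
  qed
  have pbad: "measure M (bad c) \<le> exp (- cB * real (card J))" if "c \<in> lattice_ball k" for c
  proof -
    have "sqn n (colcomb k Z (w c)) \<le> 1" using wle that unfolding sqn_colcomb[OF Z] by (simp add: lattice_ball_def)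
    from bernstein_lin[OF J this this, of "\<lambda>_. 1" 1] show ?thesis unfolding bad_def M_def by simp
  qed
  define E where "E = space M - (\<Union>c\<in>lattice_ball k. bad c)"
  have bads: "(\<Union>c\<in>lattice_ball k. bad c) \<in> sets M" using finite_lattice_ball sets by auto
  show ?thesis
  proof (rule that[of E, folded M_def])
    show "E \<in> sets M" unfolding E_def using bads by auto
    have "measure M (\<Union>c\<in>lattice_ball k. bad c) \<le> (\<Sum>c\<in>lattice_ball k. measure M (bad c))"
      by (intro M.finite_measure_subadditive_finite finite_lattice_ball) (use sets in auto)
    also have "\<dots> \<le> (\<Sum>c\<in>lattice_ball k. exp (- cB * real (card J)))" by (intro sum_mono pbad)
    also have "\<dots> = real (card (lattice_ball k)) * exp (- cB * real (card J))" by simp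
    also have "\<dots> \<le> exp (6 * real k) * exp (- cB * real (card J))"
      by (intro mult_right_mono card_lattice_ball) auto
    also have "\<dots> = exp (6 * real k - cB * real (card J))" by (simp flip: exp_add)
    finally show "measure M E \<ge> 1 - exp (6 * real k - cB * real (card J))"
      unfolding E_def M.prob_compl[OF bads] by simp
    fix \<omega> and e :: vect
    assume w: "\<omega> \<in> E"
    define Q where "Q e = (\<Sum>j\<in>J. (lin n (colcomb k Z e) (\<omega> j))\<^sup>2)" for e
    have Qs: "Q (\<lambda>s. c * e s) = c\<^sup>2 * Q e" for c e
      unfolding Q_def lin_colcomb sum_distrib_left
      by (intro sum.cong refl) (simp add: power_mult_distrib[symmetric] sum_distrib_left ac_simps)
    \<comment> \<open>At norm \<open>sqrt k\<close> a rounding error of at most 1 per coordinate is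
      comparable with the vector itself, so the integer point has squared norm at most
      \<open>4 k\<close> and its rescaling \<open>w c\<close> lies in the unit ball.\<close>
    have unit: "Q x \<le> 8 * real (card J) * real k" if x: "sqn k x = real k" for x
    proof -
      obtain c' where c': "\<And>s. \<bar>real_of_int (c' s) - x s\<bar> \<le> 1" "Q x \<le> Q (\<lambda>s. real_of_int (c' s))"
        using sum_squares_le_integer_point[where x = x and J = J and k = k and L = "\<lambda>j s. lin n (\<lambda>r. Z r s) (\<omega> j)"] unfolding Q_def lin_colcomb by blast
      define c where "c = restrict c' {..<k}"
      have Qc: "Q (\<lambda>s. real_of_int (c' s)) = Q (\<lambda>s. real_of_int (c s))"
        unfolding Q_def lin_colcomb c_def by simp
      have "sqn k (\<lambda>s. real_of_int (c s)) \<le> (\<Sum>s<k. 2 * (x s)\<^sup>2 + 2)"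
        unfolding sqn_def
      proof (rule sum_mono)
        fix s assume "s \<in> {..<k}"
        then have cs: "c s = c' s" by (simp add: c_def)
        have "(real_of_int (c' s) - x s)\<^sup>2 \<le> 1" using c'(1)[of s] by (simp add: abs_square_le_1)
        moreover have "(real_of_int (c' s))\<^sup>2 \<le> 2 * (x s)\<^sup>2 + 2 * (real_of_int (c' s) - x s)\<^sup>2"
          using zero_le_power2[of "real_of_int (c' s) - 2 * x s"] by (simp add: power2_eq_square algebra_simps)
        ultimately show "(real_of_int (c s))\<^sup>2 \<le> 2 * (x s)\<^sup>2 + 2" unfolding cs by linarith
      qed
      also have "\<dots> = 4 * real k" using x by (simp add: sqn_def sum.distrib flip: sum_distrib_left)
      finally have "real_of_int (\<Sum>s<k. (c s)\<^sup>2) \<le> real_of_int (4 * int k)" by (simp add: sqn_def)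
      then have cle: "(\<Sum>s<k. (c s)\<^sup>2) \<le> 4 * int k" by (simp only: of_int_le_iff)
      have "c s \<in> {- (2 * int k)..2 * int k}" if "s < k" for s
      proof -
        have "(c s)\<^sup>2 \<le> (\<Sum>s<k. (c s)\<^sup>2)" using that by (intro member_le_sum) auto
        also have "\<dots> \<le> 4 * int k * int k" using cle k by (intro order_trans[OF cle]) simp
        finally have "(c s)\<^sup>2 \<le> (2 * int k)\<^sup>2" by (simp add: power2_eq_square)
        then have "\<bar>c s\<bar> \<le> \<bar>2 * int k\<bar>" by (simp only: abs_le_square_iff)
        then have "\<bar>c s\<bar> \<le> 2 * int k" by simp
        then show ?thesis by auto
      qed
      then have cl: "c \<in> lattice_ball k" using cle unfolding lattice_ball_def c_def by (auto simp: PiE_def)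
      have wu: "sqn n (colcomb k Z (w c)) \<le> 1" using wle[OF cle] unfolding sqn_colcomb[OF Z] .
      have "\<omega> \<notin> bad c" "\<omega> \<in> space M" using w cl unfolding E_def by auto
      then have "(\<Sum>j\<in>J. (lin n (colcomb k Z (w c)) (\<omega> j))\<^sup>2 - sqn n (colcomb k Z (w c))) < real (card J)"
        unfolding bad_def ip_self by (simp add: power2_eq_square)
      then have "Q (w c) < real (card J) + real (card J) * sqn n (colcomb k Z (w c))"
        by (simp add: Q_def sum_subtractf)
      also have "\<dots> \<le> real (card J) + real (card J) * 1" by (intro add_left_mono mult_left_mono wu) auto
      \<comment> \<open>Mean at most 1 plus deviation at most 1 gives 2; undoing the scaling
        \<open>1 / (2 sqrt k)\<close> multiplies by \<open>4 k\<close>, whence the 8.\<close>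
      finally have "Q (w c) \<le> 2 * real (card J)" by simp
      moreover have "Q (w c) = 1 / (4 * real k) * Q (\<lambda>s. real_of_int (c s))"
        unfolding w_def Qs using k by (simp add: power_divide power_mult_distrib)
      ultimately have "Q (\<lambda>s. real_of_int (c s)) \<le> 8 * real (card J) * real k" using k by (simp add: field_simps)
      then show ?thesis using c'(2) Qc by simp
    qed
    show "(\<Sum>j\<in>J. (lin n (colcomb k Z e) (\<omega> j))\<^sup>2) \<le> 8 * real (card J) * sqn k e"
    proof (cases "sqn k e = 0")
      case True
      then have "sqn n (colcomb k Z e) = 0" by (simp add: sqn_colcomb[OF Z])
      then show ?thesis using True by (simp add: lin_zero)
    next
      case False
      then have pos: "0 < sqn k e" using sqn_nonneg[of k e] by simp
      define c where "c = sqrt (real k / sqn k e)"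
      have c: "c\<^sup>2 = real k / sqn k e" using pos by (simp add: c_def)
      have "Q (\<lambda>s. c * e s) \<le> 8 * real (card J) * real k"
        by (rule unit) (use pos in \<open>simp add: sqn_scale c\<close>)
      then show ?thesis unfolding Qs c Q_def[symmetric] using pos k by (simp add: field_simps)
    qed
  qed
qed

end

section \<open>Projection onto the gain set\<close>

lemma in_G_iff: "in_G \<rho> m g \<longleftrightarrow> (\<Sum>i<m. g i - 1) = 0 \<and> (\<forall>i<m. \<bar>g i - 1\<bar> \<le> \<rho>)"
proof
  assume "in_G \<rho> m g"
  then obtain e where e: "\<forall>i<m. g i = 1 + e i" "(\<Sum>i<m. e i) = 0" "\<forall>i<m. \<bar>e i\<bar> \<le> \<rho>"
    unfolding in_G_def by blast
  then show "(\<Sum>i<m. g i - 1) = 0 \<and> (\<forall>i<m. \<bar>g i - 1\<bar> \<le> \<rho>)" by simp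
next
  assume "(\<Sum>i<m. g i - 1) = 0 \<and> (\<forall>i<m. \<bar>g i - 1\<bar> \<le> \<rho>)"
  then show "in_G \<rho> m g" unfolding in_G_def by (intro exI[of _ "\<lambda>i. g i - 1"]) auto
qed

lemma sqn_add: "sqn d (\<lambda>i. x i + c * y i) = sqn d x + 2 * c * ip d x y + c\<^sup>2 * sqn d y"
  by (simp add: sqn_def ip_def power2_eq_square algebra_simps sum.distrib sum_distrib_left)

lemma sqn_eq_0_iff: "sqn d x = 0 \<longleftrightarrow> (\<forall>i<d. x i = 0)"
  by (auto simp: sqn_def sum_nonneg_eq_0_iff)

text \<open>\<open>proj\<close> is a definite description and carries no information before
  existence and uniqueness are known; this relation expresses minimality without presupposing
  them.\<close>

definition nearest :: "nat \<Rightarrow> vect set \<Rightarrow> vect \<Rightarrow> vect \<Rightarrow> bool" where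
  "nearest h S v w \<longleftrightarrow> w \<in> S \<and> (\<forall>u\<in>S. sqn h (\<lambda>i. v i - w i) \<le> sqn h (\<lambda>i. v i - u i))"

text \<open>If the angle at \<open>w\<close> were acute, a short step from \<open>w\<close> towards
  \<open>u\<close> would stay in \<open>S\<close> and come strictly closer to
  \<open>v\<close>.\<close>

lemma nearest_obtuse:
  assumes conv: "\<And>x y t. x \<in> S \<Longrightarrow> y \<in> S \<Longrightarrow> 0 \<le> t \<Longrightarrow> t \<le> 1 \<Longrightarrow> (\<lambda>i. x i + t * (y i - x i)) \<in> S"
    and w: "nearest h S v w" and u: "u \<in> S"
  shows "ip h (\<lambda>i. v i - w i) (\<lambda>i. u i - w i) \<le> 0"
proof (rule ccontr)
  define a where "a = ip h (\<lambda>i. v i - w i) (\<lambda>i. u i - w i)"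
  define c where "c = sqn h (\<lambda>i. u i - w i)"
  assume "\<not> ip h (\<lambda>i. v i - w i) (\<lambda>i. u i - w i) \<le> 0"
  then have a: "0 < a" by (simp add: a_def)
  have c0: "0 \<le> c" unfolding c_def by (rule sqn_nonneg)
  have key: "2 * t * a \<le> t\<^sup>2 * c" if "0 \<le> t" "t \<le> 1" for t
  proof -
    have "(\<lambda>i. w i + t * (u i - w i)) \<in> S" using conv w u that unfolding nearest_def by blast
    then have "sqn h (\<lambda>i. v i - w i) \<le> sqn h (\<lambda>i. v i - (w i + t * (u i - w i)))"
      by (rule bspec[OF conjunct2[OF w[unfolded nearest_def]]])
    also have "(\<lambda>i. v i - (w i + t * (u i - w i))) = (\<lambda>i. (v i - w i) + (- t) * (u i - w i))"
      by (simp add: algebra_simps)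
    finally show ?thesis unfolding sqn_add a_def c_def by simp
  qed
  \<comment> \<open>Short enough that \<open>t^2 * c\<close> is at most \<open>t * a\<close>, half
    of the first-order gain; adding 1 to \<open>c\<close> covers \<open>c = 0\<close>.\<close>
  define t where "t = min 1 (a / (c + 1))"
  have t: "0 < t" "t \<le> 1" using a c0 by (auto simp: t_def)
  have "t * c \<le> a / (c + 1) * c" using c0 by (intro mult_right_mono) (auto simp: t_def)
  also have "\<dots> \<le> a" using a c0 by (simp add: field_simps)
  finally have "t * (t * c) \<le> t * a" using t by (intro mult_left_mono) auto
  moreover have "2 * t * a \<le> t\<^sup>2 * c" using key t by auto
  ultimately have "t * a \<le> 0" by (simp add: power2_eq_square)
  then show False using t a by (simp add: mult_le_0_iff)
qed

lemma nearest_nonexpansive: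
  assumes conv: "\<And>x y t. x \<in> S \<Longrightarrow> y \<in> S \<Longrightarrow> 0 \<le> t \<Longrightarrow> t \<le> 1 \<Longrightarrow> (\<lambda>i. x i + t * (y i - x i)) \<in> S"
    and w: "nearest h S v w" and w': "nearest h S v' w'"
  shows "sqn h (\<lambda>i. w i - w' i) \<le> sqn h (\<lambda>i. v i - v' i)"
proof -
  define D where "D = (\<lambda>i. w i - w' i)"
  have "ip h (\<lambda>i. v i - w i) (\<lambda>i. w' i - w i) \<le> 0" "ip h (\<lambda>i. v' i - w' i) (\<lambda>i. w i - w' i) \<le> 0"
  proof -
    have "w \<in> S" "w' \<in> S" using w w' by (auto simp: nearest_def)
    then show "ip h (\<lambda>i. v i - w i) (\<lambda>i. w' i - w i) \<le> 0" "ip h (\<lambda>i. v' i - w' i) (\<lambda>i. w i - w' i) \<le> 0"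
      by (blast intro: nearest_obtuse[of S] conv w w')+
  qed
  moreover have "ip h (\<lambda>i. v i - w i) (\<lambda>i. w' i - w i) + ip h (\<lambda>i. v' i - w' i) (\<lambda>i. w i - w' i)
      = sqn h D - ip h (\<lambda>i. v i - v' i) D"
    unfolding ip_def sqn_def D_def sum.distrib[symmetric] sum_subtractf[symmetric]
    by (intro sum.cong refl) (simp add: power2_eq_square algebra_simps)
  ultimately have "sqn h D \<le> ip h (\<lambda>i. v i - v' i) D" by linarith
  moreover have "2 * ip h (\<lambda>i. v i - v' i) D \<le> sqn h (\<lambda>i. v i - v' i) + sqn h D"
  proof -
    have "0 \<le> sqn h (\<lambda>i. (v i - v' i) + (-1) * D i)" by (rule sqn_nonneg)
    then show ?thesis unfolding sqn_add by simp
  qed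
  ultimately show ?thesis unfolding D_def by linarith
qed

section \<open>The gain set as a compact convex set\<close>

locale gain_setting =
  fixes m h :: nat and B :: matr and \<rho> :: real and b :: vect
  assumes m: "1 \<le> m" and h: "1 \<le> h" and B: "orthonormal_cols m h B"
    and B0: "\<And>i. i < m \<Longrightarrow> B i 0 = 1 / sqrt (real m)" and Bperp: "\<And>j. 1 \<le> j \<Longrightarrow> j < h \<Longrightarrow> (\<Sum>i<m. B i j) = 0"
    and b0: "b 0 = sqrt (real m)" and bG: "in_G \<rho> m (mv m h B b)"
begin

definition "W v i = (\<Sum>j<h. B i j * v j)" for v :: vect and i :: nat

lemma mv_W: "i < m \<Longrightarrow> mv m h B v i = W v i"
  by (simp add: mv_def W_def)

lemma W_diff: "W (\<lambda>j. v j - v' j) i = W v i - W v' i"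
  by (simp add: W_def algebra_simps sum_subtractf)

lemma W_comb: "W (\<lambda>j. v j + c * v' j) i = W v i + c * W v' i"
  by (simp add: W_def algebra_simps sum.distrib sum_distrib_left)

lemma sqn_W: "(\<Sum>i<m. (W v i)\<^sup>2) = sqn h v"
  using sqn_colcomb[OF B, of v] by (simp add: sqn_def colcomb_def W_def mult.commute)

lemma sum_W: "(\<Sum>i<m. W v i) = sqrt (real m) * v 0"
proof -
  have "(\<Sum>i<m. W v i) = (\<Sum>j<h. (\<Sum>i<m. B i j) * v j)"
    unfolding W_def sum_distrib_right by (rule sum.swap)
  also have "\<dots> = (\<Sum>j<h. if j = 0 then (\<Sum>i<m. B i 0) * v 0 else 0)"
    by (intro sum.cong refl) (auto simp: Bperp)
  also have "\<dots> = (\<Sum>i<m. B i 0) * v 0" using h by simp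
  also have "(\<Sum>i<m. B i 0) = real m / sqrt (real m)" using B0 by simp
  also have "\<dots> = sqrt (real m)" by (simp add: real_div_sqrt)
  finally show ?thesis .
qed

text \<open>Only the first column of \<open>B\<close> has a nonzero sum, so the zero-sum condition
  on the gain deviation fixes the first coefficient and nothing else.\<close>

lemma Bset_iff: "v \<in> Bset \<rho> m h B \<longleftrightarrow> (\<forall>i\<ge>h. v i = 0) \<and> v 0 = sqrt (real m) \<and> (\<forall>i<m. \<bar>W v i - 1\<bar> \<le> \<rho>)"
proof -
  have s: "sqrt (real m) > 0" using m by simp
  have "(\<Sum>i<m. W v i - 1) = sqrt (real m) * v 0 - real m" by (simp add: sum_subtractf sum_W)
  also have "\<dots> = sqrt (real m) * (v 0 - sqrt (real m))" by (simp add: algebra_simps)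
  finally have "(\<Sum>i<m. W v i - 1) = 0 \<longleftrightarrow> v 0 = sqrt (real m)" using s by simp
  moreover have "in_G \<rho> m (mv m h B v) \<longleftrightarrow> (\<Sum>i<m. W v i - 1) = 0 \<and> (\<forall>i<m. \<bar>W v i - 1\<bar> \<le> \<rho>)"
    unfolding in_G_iff by (simp add: mv_W)
  ultimately show ?thesis unfolding Bset_def by auto
qed

text \<open>\<open>Bset\<close> demands zeros from index \<open>h\<close> on, whereas
  \<open>b\<close> is arbitrary there; this representative of \<open>b\<close> belongs to the
  set.\<close>

definition "b' = (\<lambda>i. if i < h then b i else 0)"

lemma W_b': "W b' i = W b i"
  by (simp add: W_def b'_def)

lemma b'_in: "b' \<in> Bset \<rho> m h B"
proof -
  have "in_G \<rho> m (mv m h B b')"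
    using bG unfolding in_G_iff by (simp add: mv_W W_b')
  then show ?thesis by (auto simp: Bset_def b'_def)
qed

lemma W_b: "i < m \<Longrightarrow> \<bar>W b i - 1\<bar> \<le> \<rho>"
  using b'_in unfolding Bset_iff by (simp add: W_b')

lemma \<rho>_nonneg: "0 \<le> \<rho>"
  using W_b[of 0] m by simp

lemma convex_Bset:
  assumes "x \<in> Bset \<rho> m h B" "y \<in> Bset \<rho> m h B" "0 \<le> t" "t \<le> 1"
  shows "(\<lambda>i. x i + t * (y i - x i)) \<in> Bset \<rho> m h B"
proof -
  have "\<bar>W (\<lambda>i. x i + t * (y i - x i)) i - 1\<bar> \<le> \<rho>" if i: "i < m" for i
  proof -
    have "W (\<lambda>i. x i + t * (y i - x i)) i - 1 = (1 - t) * (W x i - 1) + t * (W y i - 1)"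
      unfolding W_comb W_diff by (simp add: algebra_simps)
    also have "\<bar>\<dots>\<bar> \<le> (1 - t) * \<bar>W x i - 1\<bar> + t * \<bar>W y i - 1\<bar>"
      using assms(3,4) by (intro order_trans[OF abs_triangle_ineq]) (simp add: abs_mult)
    also have "\<dots> \<le> (1 - t) * \<rho> + t * \<rho>"
      using assms i unfolding Bset_iff by (intro add_mono mult_left_mono) auto
    finally show ?thesis by (simp add: algebra_simps)
  qed
  then show ?thesis using assms unfolding Bset_iff by auto
qed

text \<open>Compactness in the product topology: \<open>B\<close> is an isometry and every gain has
  modulus at most \<open>1 + \<rho>\<close>, so all coordinates of members are bounded by
  \<open>R\<close>.\<close>

lemma ex_nearest: "\<exists>w. nearest h (Bset \<rho> m h B) v w"
proof -
  define R where "R = sqrt (real m) * (1 + \<rho>)"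
  have cc: "continuous_on UNIV (\<lambda>v::vect. v i)" for i
    by (rule continuous_on_product_coordinates)
  have "Bset \<rho> m h B \<subseteq> PiE UNIV (\<lambda>_. {-R..R})"
  proof
    fix v assume v: "v \<in> Bset \<rho> m h B"
    have "sqn h v \<le> (\<Sum>i<m. (1 + \<rho>)\<^sup>2)" unfolding sqn_W[symmetric]
    proof (rule sum_mono)
      fix i assume "i \<in> {..<m}"
      then have "\<bar>W v i\<bar> \<le> \<bar>1 + \<rho>\<bar>" using v unfolding Bset_iff by force
      then show "(W v i)\<^sup>2 \<le> (1 + \<rho>)\<^sup>2" by (simp only: abs_le_square_iff)
    qed
    also have "\<dots> = R\<^sup>2" by (simp add: R_def power_mult_distrib)
    finally have le: "sqn h v \<le> R\<^sup>2" .
    have R0: "0 \<le> R" using \<rho>_nonneg by (simp add: R_def)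
    have "\<bar>v i\<bar> \<le> R" for i
    proof (cases "i < h")
      case True
      then have "(v i)\<^sup>2 \<le> sqn h v" unfolding sqn_def by (intro member_le_sum) auto
      then have "\<bar>v i\<bar> \<le> \<bar>R\<bar>" using le unfolding abs_le_square_iff by linarith
      then show ?thesis using R0 by simp
    next
      case False
      then show ?thesis using v R0 unfolding Bset_iff by simp
    qed
    then show "v \<in> PiE UNIV (\<lambda>_. {-R..R})" by (auto simp: PiE_def Pi_def abs_le_iff minus_le_iff)
  qed
  moreover have "closed (Bset \<rho> m h B)"
  proof -
    have "Bset \<rho> m h B = (\<Inter>i\<in>{h..}. {v. v i = 0}) \<inter> {v. v 0 = sqrt (real m)} \<inter> (\<Inter>i\<in>{..<m}. {v. \<bar>W v i - 1\<bar> \<le> \<rho>})"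
      using Bset_iff by auto
    moreover have "closed (\<Inter>i\<in>{h..}. {v::vect. v i = 0})"
      by (intro closed_INT ballI closed_Collect_eq cc continuous_on_const)
    moreover have "closed {v::vect. v 0 = sqrt (real m)}"
      by (intro closed_Collect_eq cc continuous_on_const)
    moreover have "closed (\<Inter>i\<in>{..<m}. {v. \<bar>W v i - 1\<bar> \<le> \<rho>})"
      unfolding W_def by (intro closed_INT ballI closed_Collect_le continuous_intros cc)
    ultimately show ?thesis by (simp only: closed_Int)
  qed
  moreover have "compact (PiE UNIV (\<lambda>_::nat. {-R..R}))"
    using compactin_PiE[of "\<lambda>_::nat. euclidean :: real topology" UNIV "\<lambda>_. {-R..R}"]
    by (simp add: euclidean_product_topology)
  ultimately have comp: "compact (Bset \<rho> m h B)"
    by (metis compact_Int_closed inf.absorb_iff2)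
  have "continuous_on (Bset \<rho> m h B) (\<lambda>u. sqn h (\<lambda>i. v i - u i))"
    unfolding sqn_def by (intro continuous_intros continuous_on_subset[OF cc]) auto
  from continuous_attains_inf[OF comp _ this] b'_in show ?thesis unfolding nearest_def by blast
qed

lemma nearest_proj: "nearest h (Bset \<rho> m h B) v (proj h (Bset \<rho> m h B) v)"
proof -
  obtain w where w: "nearest h (Bset \<rho> m h B) v w" using ex_nearest by blast
  have "w' = w" if w': "nearest h (Bset \<rho> m h B) v w'" for w'
  proof
    fix i
    have "sqn h (\<lambda>i. w' i - w i) \<le> sqn h (\<lambda>i. v i - v i)"
      by (rule nearest_nonexpansive[OF convex_Bset w' w])
    then have "sqn h (\<lambda>i. w' i - w i) = 0" using sqn_nonneg[of h "\<lambda>i. w' i - w i"] by (simp add: sqn_def)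
    then have "w' i = w i" if "i < h" using that unfolding sqn_eq_0_iff by simp
    moreover have "w' i = w i" if "\<not> i < h" using that w w' unfolding nearest_def Bset_def by simp
    ultimately show "w' i = w i" by blast
  qed
  then have "proj h (Bset \<rho> m h B) v = w"
    unfolding proj_def nearest_def[symmetric] using w by (intro the_equality)
  then show ?thesis using w by simp
qed

lemma proj_in: "proj h (Bset \<rho> m h B) v \<in> Bset \<rho> m h B"
  using nearest_proj unfolding nearest_def by blast

lemma proj_nonexpansive:
  "sqn h (\<lambda>i. proj h (Bset \<rho> m h B) v i - proj h (Bset \<rho> m h B) v' i) \<le> sqn h (\<lambda>i. v i - v' i)"
  by (rule nearest_nonexpansive[OF convex_Bset nearest_proj nearest_proj])

lemma proj_dist_b: "sqn h (\<lambda>i. proj h (Bset \<rho> m h B) v i - b i) \<le> sqn h (\<lambda>i. v i - b i)"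
proof -
  have *: "nearest h (Bset \<rho> m h B) b' b'"
  proof -
    have "sqn h (\<lambda>i. b' i - b' i) = 0" by (simp add: sqn_def)
    then show ?thesis unfolding nearest_def by (simp only: b'_in sqn_nonneg) blast
  qed
  have "sqn h (\<lambda>i. proj h (Bset \<rho> m h B) v i - b' i) \<le> sqn h (\<lambda>i. v i - b' i)"
    by (rule nearest_nonexpansive[OF convex_Bset nearest_proj *])
  moreover have "sqn h (\<lambda>i. x i - b' i) = sqn h (\<lambda>i. x i - b i)" for x
    unfolding sqn_def by (intro sum.cong refl) (simp add: b'_def)
  ultimately show ?thesis by (simp only:)
qed

text \<open>Continuity serves the measurability of the iterates; it follows from nonexpansiveness
  coordinate by coordinate.\<close>

lemma continuous_proj: "continuous_on UNIV (\<lambda>v. proj h (Bset \<rho> m h B) v)"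
proof (rule continuous_on_coordinatewise_then_product)
  fix i
  let ?P = "proj h (Bset \<rho> m h B)"
  have cc: "continuous_on UNIV (\<lambda>v::vect. v i)" for i
    by (rule continuous_on_product_coordinates)
  have bound: "\<bar>?P v i - ?P v' i\<bar> \<le> sqrt (sqn h (\<lambda>i. v i - v' i))" for v v'
  proof (cases "i < h")
    case True
    then have "(?P v i - ?P v' i)\<^sup>2 \<le> sqn h (\<lambda>i. ?P v i - ?P v' i)"
      unfolding sqn_def by (intro member_le_sum) auto
    also have "\<dots> \<le> sqn h (\<lambda>i. v i - v' i)" by (rule proj_nonexpansive)
    finally show ?thesis by (intro real_le_rsqrt) simp
  next
    case False
    then have "?P v i = 0" "?P v' i = 0" using proj_in unfolding Bset_iff by auto
    then show ?thesis by (simp add: sqn_nonneg)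
  qed
  show "continuous_on UNIV (\<lambda>v. ?P v i)"
    unfolding continuous_on_def
  proof
    fix v' :: vect
    have "continuous_on UNIV (\<lambda>v. sqrt (sqn h (\<lambda>i. v i - v' i)))"
      unfolding sqn_def by (intro continuous_intros cc)
    then have "((\<lambda>v. sqrt (sqn h (\<lambda>i. v i - v' i))) \<longlongrightarrow> sqrt (sqn h (\<lambda>i. v' i - v' i))) (at v' within UNIV)"
      unfolding continuous_on_def by blast
    then have lim: "((\<lambda>v. sqrt (sqn h (\<lambda>i. v i - v' i))) \<longlongrightarrow> 0) (at v' within UNIV)"
      by (simp add: sqn_def)
    show "((\<lambda>v. ?P v i) \<longlongrightarrow> ?P v' i) (at v' within UNIV)"
      by (subst Lim_null, rule Lim_null_comparison[OF _ lim]) (use bound in auto)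
  qed
qed

end

section \<open>Contraction of the projected gradient step\<close>

locale descent = gain_setting +
  fixes n k p :: nat and Z :: matr and \<omega> :: "nat \<times> nat \<times> nat \<Rightarrow> real" and z :: vect
  assumes p: "1 \<le> p" and z: "0 < sqn k z"
begin

section \<open>Residuals, averages over rows and partial gradients\<close>

definition "La l i s = (\<Sum>r<n. \<omega> (l, i, r) * Z r s)"
definition "U e l i = (\<Sum>s<k. La l i s * e s)" for e :: vect
definition "avg f = 1 / (real m * real p) * (\<Sum>l<p. \<Sum>i<m. f l i)" for f :: "nat \<Rightarrow> nat \<Rightarrow> real"

abbreviation "y \<equiv> meas m n k h Z B \<omega> z b"

lemma AZ_U: "i < m \<Longrightarrow> AZ m n k Z \<omega> l e i = U e l i"
proof -
  assume i: "i < m"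
  have "AZ m n k Z \<omega> l e i = (\<Sum>r<n. \<Sum>s<k. \<omega> (l, i, r) * (Z r s * e s))"
    using i by (simp add: AZ_def mv_def sum_distrib_left)
  also have "\<dots> = (\<Sum>s<k. \<Sum>r<n. \<omega> (l, i, r) * (Z r s * e s))" by (rule sum.swap)
  also have "\<dots> = U e l i" by (simp add: U_def La_def sum_distrib_right mult.assoc)
  finally show ?thesis .
qed

lemma y_eq: "i < m \<Longrightarrow> y l i = W b i * U z l i"
  by (simp add: meas_def mv_W AZ_U)

lemma avg_cong: "(\<And>l i. l < p \<Longrightarrow> i < m \<Longrightarrow> f l i = g l i) \<Longrightarrow> avg f = avg g"
  unfolding avg_def by simp

lemma avg_mono: "(\<And>l i. l < p \<Longrightarrow> i < m \<Longrightarrow> f l i \<le> g l i) \<Longrightarrow> avg f \<le> avg g"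
  unfolding avg_def by (intro mult_left_mono sum_mono) auto

lemma avg_nonneg: "(\<And>l i. l < p \<Longrightarrow> i < m \<Longrightarrow> 0 \<le> f l i) \<Longrightarrow> 0 \<le> avg f"
  unfolding avg_def by (intro mult_nonneg_nonneg sum_nonneg) auto

lemma avg_add: "avg (\<lambda>l i. f l i + g l i) = avg f + avg g"
  by (simp add: avg_def sum.distrib distrib_left)

lemma avg_diff: "avg (\<lambda>l i. f l i - g l i) = avg f - avg g"
  by (simp add: avg_def sum_subtractf right_diff_distrib)

lemma avg_cmult: "avg (\<lambda>l i. c * f l i) = c * avg f"
  by (simp add: avg_def sum_distrib_left[symmetric])

lemma avg_sum: "(\<Sum>s\<in>A. avg (f s)) = avg (\<lambda>l i. \<Sum>s\<in>A. f s l i)"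
proof -
  have "(\<Sum>s\<in>A. \<Sum>l<p. \<Sum>i<m. f s l i) = (\<Sum>l<p. \<Sum>i<m. \<Sum>s\<in>A. f s l i)"
    by (subst sum.swap, rule sum.cong[OF refl], rule sum.swap)
  then show ?thesis unfolding avg_def sum_distrib_left[symmetric] by (simp only:)
qed

lemma U_comb: "U (\<lambda>s. e s + c * f s) l i = U e l i + c * U f l i"
  by (simp add: U_def algebra_simps sum.distrib sum_distrib_left)

lemma U_diff: "U (\<lambda>s. e s - f s) l i = U e l i - U f l i"
  by (simp add: U_def algebra_simps sum_subtractf)

definition "res \<zeta> \<beta> l i = W \<beta> i * U \<zeta> l i - y l i"

lemma fs_eq: "fs m p n k h Z B \<omega> y \<zeta> \<beta> = 1 / 2 * avg (\<lambda>l i. (res \<zeta> \<beta> l i)\<^sup>2)"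
proof -
  have "(\<Sum>l<p. \<Sum>i<m. (mv m h B \<beta> i * AZ m n k Z \<omega> l \<zeta> i - y l i)\<^sup>2) = (\<Sum>l<p. \<Sum>i<m. (res \<zeta> \<beta> l i)\<^sup>2)"
    by (intro sum.cong refl) (simp add: res_def mv_W AZ_U)
  then show ?thesis by (simp add: fs_def avg_def)
qed

text \<open>Along any coordinate line, of the signal or of the gain, each residual is affine, so
  both partial gradients are instances of this derivative.\<close>

lemma deriv_avg_square:
  "deriv (\<lambda>\<tau>. 1 / 2 * avg (\<lambda>l i. (f l i + \<tau> * g l i)\<^sup>2)) 0 = avg (\<lambda>l i. f l i * g l i)"
proof (rule DERIV_imp_deriv)
  have "((\<lambda>\<tau>. \<Sum>l<p. \<Sum>i<m. (f l i + \<tau> * g l i)\<^sup>2) has_field_derivative (\<Sum>l<p. \<Sum>i<m. 2 * (f l i * g l i))) (at 0)"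
    by (intro DERIV_sum) (auto intro!: derivative_eq_intros)
  then have "((\<lambda>\<tau>. 1 / 2 * avg (\<lambda>l i. (f l i + \<tau> * g l i)\<^sup>2)) has_field_derivative
      1 / 2 * (1 / (real m * real p) * (\<Sum>l<p. \<Sum>i<m. 2 * (f l i * g l i)))) (at 0)"
    unfolding avg_def by (intro DERIV_cmult)
  then show "((\<lambda>\<tau>. 1 / 2 * avg (\<lambda>l i. (f l i + \<tau> * g l i)\<^sup>2)) has_field_derivative avg (\<lambda>l i. f l i * g l i)) (at 0)"
    by (simp add: avg_def sum_distrib_left[symmetric])
qed

lemma grad_zeta_eq:
  assumes "s < k"
  shows "grad_zeta m p n k h Z B \<omega> y \<zeta> \<beta> s = avg (\<lambda>l i. res \<zeta> \<beta> l i * (W \<beta> i * La l i s))"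
proof -
  have U: "U (\<zeta>(s := \<zeta> s + \<tau>)) l i = U \<zeta> l i + \<tau> * La l i s" for \<tau> l i
  proof -
    have "U (\<zeta>(s := \<zeta> s + \<tau>)) l i = (\<Sum>s'<k. La l i s' * \<zeta> s' + (if s' = s then \<tau> * La l i s else 0))"
      unfolding U_def by (intro sum.cong refl) (simp add: algebra_simps)
    then show ?thesis using assms by (simp add: U_def sum.distrib)
  qed
  have "res (\<zeta>(s := \<zeta> s + \<tau>)) \<beta> l i = res \<zeta> \<beta> l i + \<tau> * (W \<beta> i * La l i s)" for \<tau> l i
    unfolding res_def U by (simp add: algebra_simps)
  then show ?thesis using assms unfolding grad_zeta_def fs_eq by (simp only: if_True deriv_avg_square)
qed

lemma grad_beta_eq:
  assumes "s < h"
  shows "grad_beta m p n k h Z B \<omega> y \<zeta> \<beta> s = avg (\<lambda>l i. res \<zeta> \<beta> l i * (B i s * U \<zeta> l i))"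
proof -
  have W: "W (\<beta>(s := \<beta> s + \<tau>)) i = W \<beta> i + \<tau> * B i s" for \<tau> i
  proof -
    have "W (\<beta>(s := \<beta> s + \<tau>)) i = (\<Sum>s'<h. B i s' * \<beta> s' + (if s' = s then \<tau> * B i s else 0))"
      unfolding W_def by (intro sum.cong refl) (simp add: algebra_simps)
    then show ?thesis using assms by (simp add: W_def sum.distrib)
  qed
  have "res \<zeta> (\<beta>(s := \<beta> s + \<tau>)) l i = res \<zeta> \<beta> l i + \<tau> * (B i s * U \<zeta> l i)" for \<tau> l i
    unfolding res_def W by (simp add: algebra_simps)
  then show ?thesis using assms unfolding grad_beta_def fs_eq by (simp only: if_True deriv_avg_square)
qed

abbreviation "gz \<equiv> grad_zeta m p n k h Z B \<omega> y"
abbreviation "gb \<equiv> grad_beta_perp m p n k h Z B \<omega> y"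

lemma ip_gz: "ip k (gz \<zeta> \<beta>) q = avg (\<lambda>l i. res \<zeta> \<beta> l i * (W \<beta> i * U q l i))"
proof -
  have "ip k (gz \<zeta> \<beta>) q = (\<Sum>s<k. avg (\<lambda>l i. q s * (res \<zeta> \<beta> l i * (W \<beta> i * La l i s))))"
    unfolding ip_def by (intro sum.cong refl) (simp add: grad_zeta_eq avg_cmult)
  also have "\<dots> = avg (\<lambda>l i. \<Sum>s<k. q s * (res \<zeta> \<beta> l i * (W \<beta> i * La l i s)))" by (rule avg_sum)
  also have "\<dots> = avg (\<lambda>l i. res \<zeta> \<beta> l i * (W \<beta> i * U q l i))"
    unfolding U_def sum_distrib_left by (intro avg_cong sum.cong refl) (simp only: ac_simps)
  finally show ?thesis .
qed

text \<open>A test vector with \<open>q 0 = 0\<close> does not see the component that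
  \<open>grad_beta_perp\<close> deletes, so the formula for the full gradient applies.\<close>

lemma ip_gb:
  assumes "q 0 = 0"
  shows "ip h (gb \<zeta> \<beta>) q = avg (\<lambda>l i. res \<zeta> \<beta> l i * (W q i * U \<zeta> l i))"
proof -
  have "ip h (gb \<zeta> \<beta>) q = (\<Sum>s<h. avg (\<lambda>l i. q s * (res \<zeta> \<beta> l i * (B i s * U \<zeta> l i))))"
    unfolding ip_def by (intro sum.cong refl) (simp add: grad_beta_perp_def grad_beta_eq avg_cmult assms)
  also have "\<dots> = avg (\<lambda>l i. \<Sum>s<h. q s * (res \<zeta> \<beta> l i * (B i s * U \<zeta> l i)))" by (rule avg_sum)
  also have "\<dots> = avg (\<lambda>l i. res \<zeta> \<beta> l i * (W q i * U \<zeta> l i))"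
    unfolding W_def sum_distrib_left sum_distrib_right by (intro avg_cong sum.cong refl) (simp only: ac_simps)
  finally show ?thesis .
qed

end

text \<open>Deterministic conditions sufficient for contraction. The restriction
  \<open>v 0 = 0\<close> fits every gain error, since all coefficient vectors in the gain set share
  the first entry with \<open>b\<close>.\<close>

locale isometric_descent = descent +
  assumes upper: "\<And>e. avg (\<lambda>l i. (U e l i)\<^sup>2) \<le> 8 * sqn k e"
    and lower: "\<And>e v. v 0 = 0 \<Longrightarrow>
      9 / 10 * (sqn k e + sqn k z / real m * sqn h v) \<le> avg (\<lambda>l i. (U e l i + W v i * U z l i)\<^sup>2)"
    and \<rho>_le: "\<rho> \<le> 1 / 31"
begin

definition "MR \<zeta> \<beta> = avg (\<lambda>l i. (res \<zeta> \<beta> l i)\<^sup>2)"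

lemma W_range: "\<beta> \<in> Bset \<rho> m h B \<Longrightarrow> i < m \<Longrightarrow> \<bar>W \<beta> i - 1\<bar> \<le> \<rho>"
  by (simp add: Bset_iff)

text \<open>The gradient is tested against itself. The Young weights 4 and 1/16 are chosen so that
  the upper bound 8 turns the second term into half of \<open>sqn k q\<close>, which moves to the
  left; 9/8 bounds the squared gain.\<close>

lemma gz_le:
  assumes "\<beta> \<in> Bset \<rho> m h B"
  shows "sqn k (gz \<zeta> \<beta>) \<le> 9 * MR \<zeta> \<beta>"
proof -
  define q where "q = gz \<zeta> \<beta>"
  have "sqn k q = avg (\<lambda>l i. res \<zeta> \<beta> l i * (W \<beta> i * U q l i))"
    using ip_gz[of \<zeta> \<beta> q] by (simp add: q_def ip_def sqn_def power2_eq_square)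
  also have "\<dots> \<le> avg (\<lambda>l i. 9 / 2 * (res \<zeta> \<beta> l i)\<^sup>2 + 1 / 16 * (U q l i)\<^sup>2)"
  proof (rule avg_mono)
    fix l i assume "i < m"
    define x d u where "x = res \<zeta> \<beta> l i" "d = W \<beta> i" "u = U q l i"
    have "\<bar>d - 1\<bar> \<le> 1 / 31" using W_range[OF assms \<open>i < m\<close>] \<rho>_le by (simp add: x_d_u_def)
    then have "\<bar>d\<bar> \<le> \<bar>32 / 31\<bar>" by linarith
    then have "d\<^sup>2 \<le> (32 / 31)\<^sup>2" by (simp only: abs_le_square_iff)
    then have "4 * (x\<^sup>2 * d\<^sup>2) \<le> 4 * (x\<^sup>2 * (9/8))" by (intro mult_left_mono) (auto simp: power2_eq_square)
    moreover have "0 \<le> (2 * x * d - u / 4)\<^sup>2" by simp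
    then have "x * (d * u) \<le> 4 * (x\<^sup>2 * d\<^sup>2) + 1 / 16 * u\<^sup>2" by (simp add: power2_eq_square algebra_simps)
    ultimately show "res \<zeta> \<beta> l i * (W \<beta> i * U q l i) \<le> 9 / 2 * (res \<zeta> \<beta> l i)\<^sup>2 + 1 / 16 * (U q l i)\<^sup>2"
      unfolding x_d_u_def[symmetric] by simp
  qed
  also have "\<dots> = 9 / 2 * MR \<zeta> \<beta> + 1 / 16 * avg (\<lambda>l i. (U q l i)\<^sup>2)"
    unfolding avg_add avg_cmult MR_def ..
  also have "\<dots> \<le> 9 / 2 * MR \<zeta> \<beta> + 1 / 2 * sqn k q" using upper[of q] by simp
  finally show ?thesis by (simp add: q_def)
qed

lemma abs_W_le: "i < m \<Longrightarrow> (W q i)\<^sup>2 \<le> sqn h q"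
  unfolding sqn_W[symmetric] by (intro member_le_sum) auto

text \<open>Again the gradient is tested against itself, but here each squared value of
  \<open>W q\<close> is replaced by the sum of all of them, which can exceed the average by a factor
  \<open>m\<close>. The constant \<open>c\<close> is \<open>8 * 11 / 5 * sqn k z\<close>, a bound
  for the mean of the squared \<open>U \<zeta>\<close>.\<close>

lemma gb_le:
  assumes "sqn k \<zeta> \<le> 11 / 5 * sqn k z"
  shows "sqn h (gb \<zeta> \<beta>) \<le> 88 / 5 * sqn k z * MR \<zeta> \<beta>"
proof -
  define q where "q = gb \<zeta> \<beta>"
  define c where "c = 88 / 5 * sqn k z"
  have c: "c > 0" using z by (simp add: c_def)
  have q0: "q 0 = 0" by (simp add: q_def grad_beta_perp_def)
  have "sqn h q = avg (\<lambda>l i. res \<zeta> \<beta> l i * (W q i * U \<zeta> l i))"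
    using ip_gb[of q \<zeta> \<beta>, OF q0] by (simp add: q_def ip_def sqn_def power2_eq_square)
  also have "\<dots> \<le> avg (\<lambda>l i. c / 2 * (res \<zeta> \<beta> l i)\<^sup>2 + sqn h q / (2 * c) * (U \<zeta> l i)\<^sup>2)"
  proof (rule avg_mono)
    fix l i assume "i < m"
    define x w u where "x = res \<zeta> \<beta> l i" "w = W q i" "u = U \<zeta> l i"
    have "0 \<le> (c * x - w * u)\<^sup>2 / (2 * c)" using c by simp
    also have "\<dots> = c / 2 * x\<^sup>2 - x * (w * u) + w\<^sup>2 / (2 * c) * u\<^sup>2"
      using c by (simp add: power2_eq_square field_simps)
    finally have "x * (w * u) \<le> c / 2 * x\<^sup>2 + w\<^sup>2 / (2 * c) * u\<^sup>2" by simp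
    also have "\<dots> \<le> c / 2 * x\<^sup>2 + sqn h q / (2 * c) * u\<^sup>2"
      using abs_W_le[OF \<open>i < m\<close>, of q] c unfolding x_w_u_def
      by (intro add_left_mono mult_right_mono divide_right_mono) auto
    finally show "res \<zeta> \<beta> l i * (W q i * U \<zeta> l i) \<le> c / 2 * (res \<zeta> \<beta> l i)\<^sup>2 + sqn h q / (2 * c) * (U \<zeta> l i)\<^sup>2"
      unfolding x_w_u_def .
  qed
  also have "\<dots> = c / 2 * MR \<zeta> \<beta> + sqn h q / (2 * c) * avg (\<lambda>l i. (U \<zeta> l i)\<^sup>2)"
    unfolding avg_add avg_cmult MR_def ..
  also have "\<dots> \<le> c / 2 * MR \<zeta> \<beta> + sqn h q / (2 * c) * c"
    using upper[of \<zeta>] assms c sqn_nonneg[of h q]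
    by (intro add_left_mono mult_left_mono) (auto simp: c_def)
  also have "\<dots> = c / 2 * MR \<zeta> \<beta> + sqn h q / 2" using c by simp
  finally show ?thesis by (simp add: q_def c_def)
qed

abbreviation "\<Delta> \<equiv> Delta m k h z b"

lemma Delta_nonneg: "0 \<le> \<Delta> \<zeta> \<beta>"
  unfolding Delta_def using z by (intro add_nonneg_nonneg mult_nonneg_nonneg divide_nonneg_nonneg sqn_nonneg) auto

lemma step:
  assumes \<beta>: "\<beta> \<in> Bset \<rho> m h B" and near: "\<Delta> \<zeta> \<beta> \<le> sqn k z / 10"
    and \<mu>: "0 < \<mu>" "\<mu> * real m \<le> 1 / 1000"
  defines "\<zeta>1 \<equiv> \<lambda>s. \<zeta> s - \<mu> * gz \<zeta> \<beta> s"
    and "\<beta>1 \<equiv> proj h (Bset \<rho> m h B) (\<lambda>s. \<beta> s - \<mu> * (real m / sqn k z) * gb \<zeta> \<beta> s)"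
  shows "\<Delta> \<zeta>1 \<beta>1 \<le> (1 - (1 - 31 * \<rho>) * \<mu>) * \<Delta> \<zeta> \<beta>"
proof -
  define e where "e = (\<lambda>s. \<zeta> s - z s)"
  define v where "v = (\<lambda>s. \<beta> s - b s)"
  define R where "R = MR \<zeta> \<beta>"
  define a where "a = real m / sqn k z"
  define D where "D = \<Delta> \<zeta> \<beta>"
  have mpos: "0 < real m" "1 \<le> real m" using m by simp_all
  have a: "0 < a" using z mpos by (simp add: a_def)
  have D: "D = sqn k e + sqn h v / a" unfolding D_def Delta_def e_def v_def a_def by simp
  have D0: "0 \<le> D" unfolding D_def by (rule Delta_nonneg)
  have eD: "sqn k e \<le> D" unfolding D using a sqn_nonneg[of h v] by simp
  have R0: "0 \<le> R" unfolding R_def MR_def by (intro avg_nonneg) simp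
  have v0: "v 0 = 0" using \<beta> b0 unfolding v_def Bset_iff by simp
  have res: "res \<zeta> \<beta> l i = W \<beta> i * U e l i + W v i * U z l i" if "i < m" for l i
    using that unfolding res_def e_def v_def U_diff W_diff by (simp add: y_eq algebra_simps)
  have Wv: "\<bar>W v i\<bar> \<le> 2 * \<rho>" if "i < m" for i
    using W_range[OF \<beta> that] W_b[OF that] unfolding v_def W_diff by linarith
  have Ue: "U \<zeta> l i = U e l i + U z l i" for l i unfolding e_def U_diff by simp
  have \<rho>: "0 \<le> \<rho>" "\<rho> \<le> 1 / 31" using \<rho>_nonneg \<rho>_le by auto
  \<comment> \<open>Splitting \<open>2 \<rho> \<bar>x u\<bar>\<close> with weights 4 and 1/4 costs
    \<open>4 \<rho> R\<close> and, by the upper bound 8, \<open>2 \<rho> D\<close>.\<close>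
  have inner: "ip k (gz \<zeta> \<beta>) e + ip h (gb \<zeta> \<beta>) v \<ge> R - 4 * \<rho> * R - 2 * \<rho> * D"
  proof -
    have "ip k (gz \<zeta> \<beta>) e + ip h (gb \<zeta> \<beta>) v
        = avg (\<lambda>l i. res \<zeta> \<beta> l i * (W \<beta> i * U e l i) + res \<zeta> \<beta> l i * (W v i * U \<zeta> l i))"
      unfolding ip_gz ip_gb[of v, OF v0] avg_add ..
    also have "\<dots> \<ge> avg (\<lambda>l i. (1 - 4 * \<rho>) * (res \<zeta> \<beta> l i)\<^sup>2 - \<rho> / 4 * (U e l i)\<^sup>2)"
    proof (rule avg_mono)
      fix l i assume i: "i < m"
      define x u w where "x = res \<zeta> \<beta> l i" "u = U e l i" "w = W v i"
      have "\<bar>x * (w * u)\<bar> = \<bar>w\<bar> * \<bar>x * u\<bar>" by (simp add: abs_mult)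
      also have "\<dots> \<le> 2 * \<rho> * \<bar>x * u\<bar>" using Wv[OF i] unfolding x_u_w_def by (intro mult_right_mono) auto
      also have "\<dots> = \<rho> * (2 * \<bar>x * u\<bar>)" by simp
      also have "\<dots> \<le> \<rho> * (4 * x\<^sup>2 + 1 / 4 * u\<^sup>2)"
      proof (rule mult_left_mono[OF _ \<rho>(1)])
        have "0 \<le> (2 * \<bar>x\<bar> - \<bar>u\<bar> / 2)\<^sup>2" by simp
        then show "2 * \<bar>x * u\<bar> \<le> 4 * x\<^sup>2 + 1 / 4 * u\<^sup>2" by (simp add: power2_eq_square abs_mult algebra_simps)
      qed
      finally have "- (\<rho> * (4 * x\<^sup>2 + 1 / 4 * u\<^sup>2)) \<le> x * (w * u)" by linarith
      moreover have "res \<zeta> \<beta> l i * (W \<beta> i * U e l i) + res \<zeta> \<beta> l i * (W v i * U \<zeta> l i) = x\<^sup>2 + x * (w * u)"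
        unfolding Ue x_u_w_def using res[OF i, of l] by (simp add: power2_eq_square algebra_simps)
      ultimately show "(1 - 4 * \<rho>) * (res \<zeta> \<beta> l i)\<^sup>2 - \<rho> / 4 * (U e l i)\<^sup>2
          \<le> res \<zeta> \<beta> l i * (W \<beta> i * U e l i) + res \<zeta> \<beta> l i * (W v i * U \<zeta> l i)"
        unfolding x_u_w_def[symmetric] by (simp add: algebra_simps)
    qed
    moreover have "avg (\<lambda>l i. (1 - 4 * \<rho>) * (res \<zeta> \<beta> l i)\<^sup>2 - \<rho> / 4 * (U e l i)\<^sup>2)
        = (1 - 4 * \<rho>) * R - \<rho> / 4 * avg (\<lambda>l i. (U e l i)\<^sup>2)"
      unfolding avg_diff avg_cmult R_def MR_def ..
    moreover have "\<rho> / 4 * avg (\<lambda>l i. (U e l i)\<^sup>2) \<le> \<rho> / 4 * (8 * D)"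
      using upper[of e] eD \<rho> by (intro mult_left_mono) auto
    ultimately show ?thesis by (simp add: algebra_simps)
  qed
  \<comment> \<open>The lower isometry controls the residual with the gain replaced by 1. The two
    differ by the gain deviation times \<open>u\<close>; the split with ratio 1/10 gives
    \<open>11 / 10 * R\<close> and \<open>88 \<rho>^2 D\<close>, at most \<open>3 \<rho> D\<close>
    because \<open>\<rho> \<le> 1 / 31\<close>.\<close>
  have lowR: "9 / 10 * D - 3 * \<rho> * D \<le> 11 / 10 * R"
  proof -
    have "9 / 10 * D \<le> avg (\<lambda>l i. (U e l i + W v i * U z l i)\<^sup>2)"
      using lower[where v = v and e = e, OF v0] a unfolding D a_def by (simp add: mult.commute)
    also have "\<dots> \<le> avg (\<lambda>l i. 11 / 10 * (res \<zeta> \<beta> l i)\<^sup>2 + 11 * \<rho>\<^sup>2 * (U e l i)\<^sup>2)"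
    proof (rule avg_mono)
      fix l i assume i: "i < m"
      define x u d where "x = res \<zeta> \<beta> l i" "u = U e l i" "d = W \<beta> i - 1"
      have "\<bar>d\<bar> \<le> \<bar>\<rho>\<bar>" using W_range[OF \<beta> i] \<rho> by (simp add: x_u_d_def)
      then have "d\<^sup>2 \<le> \<rho>\<^sup>2" by (simp only: abs_le_square_iff)
      then have "11 * (d\<^sup>2 * u\<^sup>2) \<le> 11 * (\<rho>\<^sup>2 * u\<^sup>2)" by (intro mult_left_mono mult_right_mono) auto
      moreover have "U e l i + W v i * U z l i = x - d * u"
        using res[OF i, of l] by (simp add: x_u_d_def algebra_simps)
      moreover have "(x - d * u)\<^sup>2 \<le> 11 / 10 * x\<^sup>2 + 11 * (d\<^sup>2 * u\<^sup>2)"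
        using zero_le_power2[of "x + 10 * d * u"] by (simp add: power2_eq_square algebra_simps)
      ultimately show "(U e l i + W v i * U z l i)\<^sup>2 \<le> 11 / 10 * (res \<zeta> \<beta> l i)\<^sup>2 + 11 * \<rho>\<^sup>2 * (U e l i)\<^sup>2"
        unfolding x_u_d_def[symmetric] by simp
    qed
    also have "\<dots> = 11 / 10 * R + 11 * \<rho>\<^sup>2 * avg (\<lambda>l i. (U e l i)\<^sup>2)"
      unfolding avg_add avg_cmult R_def MR_def ..
    also have "\<dots> \<le> 11 / 10 * R + 11 * \<rho>\<^sup>2 * (8 * D)"
      using upper[of e] eD by (intro add_left_mono mult_left_mono) auto
    also have "11 * \<rho>\<^sup>2 * (8 * D) = 88 * \<rho> * (\<rho> * D)" by (simp add: power2_eq_square)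
    also have "\<dots> \<le> 88 * (1 / 31) * (\<rho> * D)" using \<rho> D0 by (intro mult_right_mono mult_left_mono) auto
    also have "\<dots> \<le> 3 * (\<rho> * D)" using \<rho> D0 by (intro mult_right_mono) auto
    finally show ?thesis by simp
  qed
  have zeta_le: "sqn k \<zeta> \<le> 11 / 5 * sqn k z"
  proof -
    have "sqn k \<zeta> \<le> (\<Sum>s<k. 2 * (z s)\<^sup>2 + 2 * (e s)\<^sup>2)"
      unfolding sqn_def
    proof (rule sum_mono)
      fix s
      have "0 \<le> (z s - e s)\<^sup>2" by simp
      moreover have "\<zeta> s = z s + e s" by (simp add: e_def)
      ultimately show "(\<zeta> s)\<^sup>2 \<le> 2 * (z s)\<^sup>2 + 2 * (e s)\<^sup>2" by (simp add: power2_eq_square algebra_simps)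
    qed
    also have "\<dots> = 2 * sqn k z + 2 * sqn k e" by (simp add: sqn_def sum.distrib sum_distrib_left)
    finally show ?thesis using eD near unfolding D_def by linarith
  qed
  \<comment> \<open>The signal part contributes 9 and the gain part, after multiplication by
    \<open>a\<close>, \<open>88 / 5 * m\<close>; together they stay below
    \<open>27 m\<close>.\<close>
  have G: "sqn k (gz \<zeta> \<beta>) + a * sqn h (gb \<zeta> \<beta>) \<le> 27 * real m * R"
  proof -
    have "a * sqn h (gb \<zeta> \<beta>) \<le> a * (88 / 5 * sqn k z * R)"
      using gb_le[OF zeta_le, of \<beta>] a unfolding R_def by (intro mult_left_mono) auto
    also have "\<dots> = 88 / 5 * real m * R" using z by (simp add: a_def)
    finally have "a * sqn h (gb \<zeta> \<beta>) \<le> 88 / 5 * real m * R" .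
    moreover have "9 * R \<le> 9 * real m * R" using mult_right_mono[OF mpos(2) R0] by simp
    moreover have "0 \<le> real m * R" using R0 by simp
    ultimately show ?thesis using gz_le[OF \<beta>, of \<zeta>] unfolding R_def[symmetric] by linarith
  qed
  have d1: "sqn k (\<lambda>i. \<zeta>1 i - z i) = sqn k e - 2 * \<mu> * ip k (gz \<zeta> \<beta>) e + \<mu>\<^sup>2 * sqn k (gz \<zeta> \<beta>)"
  proof -
    have "(\<lambda>i. \<zeta>1 i - z i) = (\<lambda>i. e i + (- \<mu>) * gz \<zeta> \<beta> i)" by (simp add: \<zeta>1_def e_def algebra_simps)
    then show ?thesis by (simp only: sqn_add) (simp add: ip_def mult.commute)
  qed
  have d2: "sqn h (\<lambda>i. \<beta>1 i - b i) \<le> sqn h v - 2 * (\<mu> * a) * ip h (gb \<zeta> \<beta>) v + (\<mu> * a)\<^sup>2 * sqn h (gb \<zeta> \<beta>)"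
  proof -
    have "sqn h (\<lambda>i. \<beta>1 i - b i) \<le> sqn h (\<lambda>i. (\<beta> i - \<mu> * (real m / sqn k z) * gb \<zeta> \<beta> i) - b i)"
      unfolding \<beta>1_def by (rule proj_dist_b)
    also have "(\<lambda>i. (\<beta> i - \<mu> * (real m / sqn k z) * gb \<zeta> \<beta> i) - b i) = (\<lambda>i. v i + (- (\<mu> * a)) * gb \<zeta> \<beta> i)"
      by (simp add: v_def a_def algebra_simps)
    finally show ?thesis by (simp only: sqn_add) (simp add: ip_def mult.commute)
  qed
  have "\<Delta> \<zeta>1 \<beta>1 = sqn k (\<lambda>i. \<zeta>1 i - z i) + sqn h (\<lambda>i. \<beta>1 i - b i) / a"
    unfolding Delta_def a_def by simp
  also have "\<dots> \<le> (sqn k e - 2 * \<mu> * ip k (gz \<zeta> \<beta>) e + \<mu>\<^sup>2 * sqn k (gz \<zeta> \<beta>))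
      + (sqn h v - 2 * (\<mu> * a) * ip h (gb \<zeta> \<beta>) v + (\<mu> * a)\<^sup>2 * sqn h (gb \<zeta> \<beta>)) / a"
    unfolding d1 using d2 a by (intro add_left_mono divide_right_mono) auto
  also have "\<dots> = D - 2 * \<mu> * (ip k (gz \<zeta> \<beta>) e + ip h (gb \<zeta> \<beta>) v) + \<mu>\<^sup>2 * (sqn k (gz \<zeta> \<beta>) + a * sqn h (gb \<zeta> \<beta>))"
    unfolding D using a by (simp add: power2_eq_square field_simps)
  also have "\<dots> \<le> D - 2 * \<mu> * (R - 4 * \<rho> * R - 2 * \<rho> * D) + \<mu>\<^sup>2 * (27 * real m * R)"
    using inner G \<mu> by (intro add_mono diff_left_mono mult_left_mono) auto
  also have "\<mu>\<^sup>2 * (27 * real m * R) \<le> \<mu> * (27 / 1000 * R)"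
  proof -
    have "\<mu> * real m * (27 * R) \<le> 1 / 1000 * (27 * R)" using \<mu> R0 by (intro mult_right_mono) auto
    then have "\<mu> * (\<mu> * real m * (27 * R)) \<le> \<mu> * (1 / 1000 * (27 * R))" using \<mu> by (intro mult_left_mono) auto
    then show ?thesis by (simp add: power2_eq_square ac_simps)
  qed
  finally have "\<Delta> \<zeta>1 \<beta>1 \<le> D - \<mu> * (2 * (R - 4 * \<rho> * R - 2 * \<rho> * D) - 27 / 1000 * R)"
    by (simp add: algebra_simps)
  also have "\<dots> \<le> D - \<mu> * ((1 - 31 * \<rho>) * D)"
  proof (intro diff_left_mono mult_left_mono)
    have rR: "\<rho> * R \<le> 1 / 31 * R" using \<rho> R0 by (intro mult_right_mono)
    have rD: "0 \<le> \<rho> * D" using \<rho> D0 by simp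
    \<comment> \<open>The factor of \<open>R\<close> is at least 1.7, and \<open>lowR\<close>
      converts it into about \<open>1.4 D\<close> minus less than \<open>9 \<rho> D\<close>, which
      leaves room below \<open>31 \<rho> D\<close>.\<close>
    show "(1 - 31 * \<rho>) * D \<le> 2 * (R - 4 * \<rho> * R - 2 * \<rho> * D) - 27 / 1000 * R"
      using rR rD lowR R0 D0 by (simp add: algebra_simps)
  qed (use \<mu> in simp)
  finally show ?thesis unfolding D_def by (simp add: algebra_simps)
qed

lemma W_beta0: "i < m \<Longrightarrow> W (beta0 m) i = 1"
proof -
  assume i: "i < m"
  have "W (beta0 m) i = (\<Sum>j<h. if j = 0 then B i 0 * sqrt (real m) else 0)"
    unfolding W_def beta0_def by (intro sum.cong refl) auto
  also have "\<dots> = 1" using h B0[OF i] m by simp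
  finally show ?thesis .
qed

lemma beta0_in: "beta0 m \<in> Bset \<rho> m h B"
  using h \<rho>_nonneg unfolding Bset_iff by (auto simp: W_beta0) (auto simp: beta0_def)

lemma Delta_beta0: "sqn k z / real m * sqn h (\<lambda>i. beta0 m i - b i) \<le> \<rho>\<^sup>2 * sqn k z"
proof -
  have "sqn h (\<lambda>i. beta0 m i - b i) \<le> (\<Sum>i<m. \<rho>\<^sup>2)"
    unfolding sqn_W[symmetric]
  proof (rule sum_mono)
    fix i assume "i \<in> {..<m}"
    then have i: "i < m" by simp
    have "\<bar>W (\<lambda>i. beta0 m i - b i) i\<bar> \<le> \<bar>\<rho>\<bar>"
      using W_b[OF i] W_beta0[OF i] unfolding W_diff by linarith
    then show "(W (\<lambda>i. beta0 m i - b i) i)\<^sup>2 \<le> \<rho>\<^sup>2" by (simp only: abs_le_square_iff)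
  qed
  also have "\<dots> = real m * \<rho>\<^sup>2" by simp
  finally have "sqn k z / real m * sqn h (\<lambda>i. beta0 m i - b i) \<le> sqn k z / real m * (real m * \<rho>\<^sup>2)"
    using z by (intro mult_left_mono) auto
  then show ?thesis using m by (simp add: mult.commute)
qed

abbreviation "it \<equiv> iterates m p n k h Z B \<omega> z b \<rho>"

lemma iterates_bound:
  assumes init: "sqn k (\<lambda>s. zeta0 m p n k Z \<omega> y s - z s) \<le> \<delta>\<^sup>2 * sqn k z"
    and \<delta>: "0 < \<delta>" and \<eta>: "\<eta> = 1 - 31 * \<rho> - 4 * \<delta>" "0 < \<eta>"
    and \<mu>: "0 < \<mu>" "\<mu> * real m \<le> 1 / 1000"
  shows "snd (it \<mu> j) \<in> Bset \<rho> m h B \<and>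
    \<Delta> (fst (it \<mu> j)) (snd (it \<mu> j)) \<le> (1 - \<eta> * \<mu>) ^ j * (\<delta>\<^sup>2 + \<rho>\<^sup>2) * sqn k z"
proof (induction j)
  case 0
  show ?case using beta0_in Delta_beta0 init by (simp add: Delta_def algebra_simps)
next
  case (Suc j)
  obtain \<zeta> \<beta> where it: "it \<mu> j = (\<zeta>, \<beta>)" by fastforce
  have IH: "\<beta> \<in> Bset \<rho> m h B" "\<Delta> \<zeta> \<beta> \<le> (1 - \<eta> * \<mu>) ^ j * (\<delta>\<^sup>2 + \<rho>\<^sup>2) * sqn k z"
    using Suc it by auto
  have \<rho>0: "0 \<le> \<rho>" by (rule \<rho>_nonneg)
  have \<delta>4: "\<delta> \<le> 1 / 4" "\<eta> \<le> 1" using \<eta> \<rho>0 \<delta> by auto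
  have "\<mu> \<le> \<mu> * real m" using m \<mu> mult_left_mono[of 1 "real m" \<mu>] by simp
  then have \<mu>1: "\<mu> \<le> 1" using \<mu> by linarith
  have "\<eta> * \<mu> \<le> 1 * 1" using \<delta>4 \<mu>1 \<mu> \<eta> by (intro mult_mono) auto
  then have q: "0 \<le> 1 - \<eta> * \<mu>" "1 - \<eta> * \<mu> \<le> 1" using \<eta> \<mu> by auto
  \<comment> \<open>Proximity to the solution needs no separate invariant: with these bounds on
    \<open>\<delta>\<close> and \<open>\<rho>\<close> the claimed estimate itself implies what
    \<open>step\<close> requires.\<close>
  have "\<delta>\<^sup>2 \<le> (1/4)\<^sup>2" "\<rho>\<^sup>2 \<le> (1/31)\<^sup>2" using \<delta> \<delta>4 \<rho>0 \<rho>_le by (intro power_mono; simp)+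
  then have "\<delta>\<^sup>2 + \<rho>\<^sup>2 \<le> 1 / 10" by (simp add: power2_eq_square)
  then have "(1 - \<eta> * \<mu>) ^ j * (\<delta>\<^sup>2 + \<rho>\<^sup>2) * sqn k z \<le> 1 * (1 / 10) * sqn k z"
    using q z by (intro mult_mono power_le_one) auto
  then have near: "\<Delta> \<zeta> \<beta> \<le> sqn k z / 10" using IH(2) by simp
  define \<zeta>1 where "\<zeta>1 = (\<lambda>s. \<zeta> s - \<mu> * gz \<zeta> \<beta> s)"
  define \<beta>1 where "\<beta>1 = proj h (Bset \<rho> m h B) (\<lambda>s. \<beta> s - \<mu> * (real m / sqn k z) * gb \<zeta> \<beta> s)"
  have it1: "it \<mu> (Suc j) = (\<zeta>1, \<beta>1)" by (simp add: it Let_def \<zeta>1_def \<beta>1_def)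
  have "\<Delta> \<zeta>1 \<beta>1 \<le> (1 - (1 - 31 * \<rho>) * \<mu>) * \<Delta> \<zeta> \<beta>"
    unfolding \<zeta>1_def \<beta>1_def by (rule step[OF IH(1) near \<mu>])
  also have "\<dots> \<le> (1 - \<eta> * \<mu>) * \<Delta> \<zeta> \<beta>"
  proof (intro mult_right_mono Delta_nonneg diff_left_mono)
    show "\<eta> \<le> 1 - 31 * \<rho>" using \<eta> \<delta> by simp
  qed (use \<mu> in simp)
  also have "\<dots> \<le> (1 - \<eta> * \<mu>) * ((1 - \<eta> * \<mu>) ^ j * (\<delta>\<^sup>2 + \<rho>\<^sup>2) * sqn k z)"
    using q IH(2) by (intro mult_left_mono)
  finally show ?case unfolding it1 using proj_in by (simp add: \<beta>1_def mult.assoc)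
qed

end

section \<open>Measurability and the rows of the lifted design\<close>

lemma sum_lessThan_plus: "(\<Sum>s<k + h. f s) = (\<Sum>s<k. f s) + (\<Sum>s<h. f (k + s))"
  for f :: "nat \<Rightarrow> real"
  by (induction h) simp_all

locale sampled_problem = subgaussian_law D \<kappa> + gain_setting m h B \<rho> b
  for D \<kappa> m h B \<rho> b +
  fixes n k p :: nat and Z :: matr and z :: vect
  assumes p: "1 \<le> p" and k: "1 \<le> k" and Z: "orthonormal_cols n k Z" and z: "0 < sqn k z"
begin

lemma descent: "descent m h B \<rho> b k p z"
  by unfold_locales (use p z in auto)

abbreviation "I \<equiv> {..<p} \<times> {..<m} \<times> {..<n}"
abbreviation "M0 \<equiv> PiM I (\<lambda>_. D)"

text \<open>Points of the product space take the value \<open>undefined\<close> outside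
  \<open>I\<close>, so these coordinates are constant and no index condition is needed
  later.\<close>

lemma coordinate_measurable[measurable]: "(\<lambda>\<omega>. \<omega> x) \<in> borel_measurable M0"
proof (cases "x \<in> I")
  case True
  then have "(\<lambda>\<omega>. \<omega> x) \<in> measurable M0 D" by (rule measurable_component_singleton)
  then show ?thesis using sets_D by (simp cong: measurable_cong_sets)
next
  case False
  then have "\<omega> x = undefined" if "\<omega> \<in> space M0" for \<omega>
    using PiE_arb[of \<omega> I "\<lambda>_. space D" x] that False unfolding space_PiM by blast
  then show ?thesis using measurable_cong[of M0 "\<lambda>\<omega>. \<omega> x" "\<lambda>_. undefined" borel] by simp
qed

lemmas descent_defs = descent.avg_def[OF descent] descent.res_def[OF descent] descent.U_def[OF descent]
  descent.La_def[OF descent] W_def meas_def AZ_def mv_def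

section \<open>Measurability of the iteration\<close>

lemma gradient_measurable:
  assumes [measurable]: "\<And>s. (\<lambda>\<omega>. \<zeta> \<omega> s) \<in> borel_measurable M0" "\<And>s. (\<lambda>\<omega>. \<beta> \<omega> s) \<in> borel_measurable M0"
  shows "(\<lambda>\<omega>. grad_zeta m p n k h Z B \<omega> (meas m n k h Z B \<omega> z b) (\<zeta> \<omega>) (\<beta> \<omega>) s) \<in> borel_measurable M0"
    and "(\<lambda>\<omega>. grad_beta_perp m p n k h Z B \<omega> (meas m n k h Z B \<omega> z b) (\<zeta> \<omega>) (\<beta> \<omega>) s) \<in> borel_measurable M0"
proof -
  show "(\<lambda>\<omega>. grad_zeta m p n k h Z B \<omega> (meas m n k h Z B \<omega> z b) (\<zeta> \<omega>) (\<beta> \<omega>) s) \<in> borel_measurable M0"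
  proof (cases "s < k")
    case True
    show ?thesis unfolding descent.grad_zeta_eq[OF descent True] descent_defs by measurable
  qed (simp add: grad_zeta_def)
  show "(\<lambda>\<omega>. grad_beta_perp m p n k h Z B \<omega> (meas m n k h Z B \<omega> z b) (\<zeta> \<omega>) (\<beta> \<omega>) s) \<in> borel_measurable M0"
  proof (cases "s < h")
    case True
    show ?thesis unfolding grad_beta_perp_def descent.grad_beta_eq[OF descent True] descent_defs by measurable
  qed (cases "s = 0"; simp add: grad_beta_perp_def grad_beta_def)
qed

text \<open>\<open>measure\<close> returns 0 on non-measurable sets, so a lower bound on the
  probability of the convergence event presupposes its measurability.\<close>

lemma iterates_measurable:
  "(\<lambda>\<omega>. fst (iterates m p n k h Z B \<omega> z b \<rho> \<mu> j) s) \<in> borel_measurable M0"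
  "(\<lambda>\<omega>. snd (iterates m p n k h Z B \<omega> z b \<rho> \<mu> j) s) \<in> borel_measurable M0"
proof (induction j arbitrary: s)
  case 0
  {
    case 1
    show ?case unfolding iterates.simps fst_conv zeta0_def descent_defs by measurable
  next
    case 2
    show ?case by simp
  }
next
  case (Suc j)
  define \<zeta> where "\<zeta> \<omega> = fst (iterates m p n k h Z B \<omega> z b \<rho> \<mu> j)" for \<omega>
  define \<beta> where "\<beta> \<omega> = snd (iterates m p n k h Z B \<omega> z b \<rho> \<mu> j)" for \<omega>
  have [measurable]: "(\<lambda>\<omega>. \<zeta> \<omega> s) \<in> borel_measurable M0" "(\<lambda>\<omega>. \<beta> \<omega> s) \<in> borel_measurable M0" for s
    using Suc unfolding \<zeta>_def \<beta>_def by auto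
  {
    case 1
    have "fst (iterates m p n k h Z B \<omega> z b \<rho> \<mu> (Suc j)) s
      = \<zeta> \<omega> s - \<mu> * grad_zeta m p n k h Z B \<omega> (meas m n k h Z B \<omega> z b) (\<zeta> \<omega>) (\<beta> \<omega>) s" for \<omega>
      by (simp add: \<zeta>_def \<beta>_def case_prod_beta Let_def)
    then show ?case using gradient_measurable(1)[of \<zeta> \<beta> s] by simp
  next
    case 2
    define v where "v \<omega> = (\<lambda>s. \<beta> \<omega> s - \<mu> * (real m / sqn k z) * grad_beta_perp m p n k h Z B \<omega> (meas m n k h Z B \<omega> z b) (\<zeta> \<omega>) (\<beta> \<omega>) s)" for \<omega>
    have e: "snd (iterates m p n k h Z B \<omega> z b \<rho> \<mu> (Suc j)) = proj h (Bset \<rho> m h B) (v \<omega>)" for \<omega>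
      by (simp add: \<zeta>_def \<beta>_def v_def case_prod_beta Let_def)
    have "v \<in> borel_measurable M0"
      unfolding v_def[abs_def] using gradient_measurable(2)[of \<zeta> \<beta>]
      by (intro measurable_coordinatewise_then_product) simp
    then have "(\<lambda>\<omega>. proj h (Bset \<rho> m h B) (v \<omega>)) \<in> borel_measurable M0"
      by (rule borel_measurable_continuous_on[OF continuous_proj])
    then show ?case unfolding e
      by (rule borel_measurable_continuous_on[OF continuous_on_product_coordinates])
  }
qed

abbreviation "J \<equiv> {..<p} \<times> {..<m}"
abbreviation "M1 \<equiv> PiM J (\<lambda>_. row_law n)"

text \<open>The model is a product over single entries, the concentration results use a product over
  rows; this map regroups the entries and preserves the law.\<close>

definition "unrow f = (\<lambda>(l, i, r)\<in>I. f (l, i) r)" for f :: "nat \<times> nat \<Rightarrow> vect"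

lemma distr_unrow: "distr M1 M0 unrow = M0" "unrow \<in> measurable M1 M0"
proof -
  interpret P: product_sigma_finite "\<lambda>_::nat \<times> nat \<times> nat. D" ..
  interpret R: prob_space "row_law n" by (rule prob_space_row)
  interpret Q: product_sigma_finite "\<lambda>_::nat \<times> nat. row_law n" ..
  interpret PD: product_sigma_finite "\<lambda>_::nat. D" ..
  show meas: "unrow \<in> measurable M1 M0"
    unfolding unrow_def[abs_def]
  proof (rule measurable_restrict)
    fix x assume "x \<in> I"
    then obtain l i r where x: "x = (l, i, r)" "(l, i) \<in> J" "r \<in> {..<n}" by auto
    have "(\<lambda>f. f (l, i) r) \<in> measurable M1 D"
      by (rule measurable_compose[OF measurable_component_singleton[OF x(2)] measurable_component_singleton[OF x(3)]])
    then show "(\<lambda>f. case x of (l, i, r) \<Rightarrow> f (l, i) r) \<in> measurable M1 D" by (simp add: x)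
  qed
  show "distr M1 M0 unrow = M0"
  proof (rule P.PiM_eqI)
    fix A assume A: "\<And>x. x \<in> I \<Longrightarrow> A x \<in> sets D"
    have "unrow -` Pi\<^sub>E I A \<inter> space M1 = (\<Pi>\<^sub>E j\<in>J. \<Pi>\<^sub>E r\<in>{..<n}. A (fst j, snd j, r))"
    proof -
      have AD: "A x \<subseteq> space D" if "x \<in> I" for x using sets.sets_into_space[OF A[OF that]] .
      have "f \<in> unrow -` Pi\<^sub>E I A \<inter> space M1 \<longleftrightarrow> f \<in> (\<Pi>\<^sub>E j\<in>J. \<Pi>\<^sub>E r\<in>{..<n}. A (fst j, snd j, r))" for f
      proof
        assume f: "f \<in> unrow -` Pi\<^sub>E I A \<inter> space M1"
        then have "f (l, i) r \<in> A (l, i, r)" if "l < p" "i < m" "r < n" for l i r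
          using that by (fastforce simp: unrow_def PiE_def Pi_def)
        then show "f \<in> (\<Pi>\<^sub>E j\<in>J. \<Pi>\<^sub>E r\<in>{..<n}. A (fst j, snd j, r))"
          using f by (auto simp: space_PiM PiE_iff)
      next
        assume f: "f \<in> (\<Pi>\<^sub>E j\<in>J. \<Pi>\<^sub>E r\<in>{..<n}. A (fst j, snd j, r))"
        have "f (l, i) r \<in> A (l, i, r)" if "l < p" "i < m" "r < n" for l i r
          using f that by (auto simp: PiE_iff)
        moreover have "f \<in> space M1"
          using f AD by (fastforce simp: space_PiM PiE_iff)
        ultimately show "f \<in> unrow -` Pi\<^sub>E I A \<inter> space M1"
          by (auto simp: unrow_def)
      qed
      then show ?thesis by blast
    qed
    moreover have "emeasure M1 (\<Pi>\<^sub>E j\<in>J. \<Pi>\<^sub>E r\<in>{..<n}. A (fst j, snd j, r))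
      = (\<Prod>j\<in>J. emeasure (row_law n) (\<Pi>\<^sub>E r\<in>{..<n}. A (fst j, snd j, r)))"
      using A by (intro Q.emeasure_PiM sets_PiM_I_finite) auto
    moreover have "\<dots> = (\<Prod>j\<in>J. \<Prod>r<n. emeasure D (A (fst j, snd j, r)))"
      using A by (intro prod.cong refl PD.emeasure_PiM) auto
    moreover have "\<dots> = (\<Prod>x\<in>I. emeasure D (A x))"
    proof -
      have "(\<Prod>j\<in>J. \<Prod>r<n. emeasure D (A (fst j, snd j, r))) = (\<Prod>l<p. \<Prod>i<m. \<Prod>r<n. emeasure D (A (l, i, r)))"
        by (subst prod.cartesian_product) (simp add: case_prod_beta)
      also have "\<dots> = (\<Prod>x\<in>I. emeasure D (A x))"
        by (simp add: prod.cartesian_product case_prod_beta)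
      finally show ?thesis .
    qed
    ultimately show "emeasure (distr M1 M0 unrow) (Pi\<^sub>E I A) = (\<Prod>x\<in>I. emeasure D (A x))"
      using A by (subst emeasure_distr[OF meas]) (auto intro!: sets_PiM_I_finite)
  qed auto
qed

lemma sum_J: "(\<Sum>j\<in>J. F j) = (\<Sum>l<p. \<Sum>i<m. F (l, i))" for F :: "nat \<times> nat \<Rightarrow> real"
  by (subst sum.cartesian_product) (simp add: case_prod_beta)

definition "z1 = (\<lambda>s. 1 / sqrt (sqn k z) * z s)"

lemma sqn_z1: "sqn k z1 = 1"
  unfolding z1_def sqn_scale using z by (simp add: power_divide)

text \<open>Row \<open>j\<close> of the lifted design: its inner product with \<open>(e, \<parallel>z\<parallel>/sqrt m v)\<close> is \<open>u + w X\<close> when \<open>v\<^sub>0 = 0\<close>.  The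
  coordinate of \<open>v\<^sub>0\<close> is zeroed because the cross moments of the two blocks vanish only orthogonally to
  the all-ones vector.\<close>
definition "Yrow j s = (if s < k then (\<lambda>r. Z r s) else if s = k then (\<lambda>r. 0)
    else (\<lambda>r. sqrt (real m) * B (snd j) (s - k) * colcomb k Z z1 r))" for j :: "nat \<times> nat"

definition "perp v = v(0 := 0)" for v :: vect

lemma Yrow_comb:
  "(\<lambda>r. \<Sum>s<k + h. \<theta> s * Yrow j s r)
    = colcomb k Z (\<lambda>s. \<theta> s + sqrt (real m) * W (perp (\<lambda>s. \<theta> (k + s))) (snd j) * z1 s)"
proof
  fix r
  have "(\<Sum>s<h. \<theta> (k + s) * Yrow j (k + s) r) = (\<Sum>s<h. sqrt (real m) * (B (snd j) s * perp (\<lambda>s. \<theta> (k + s)) s) * colcomb k Z z1 r)"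
    by (intro sum.cong refl) (simp add: Yrow_def perp_def)
  also have "\<dots> = sqrt (real m) * W (perp (\<lambda>s. \<theta> (k + s))) (snd j) * colcomb k Z z1 r"
    by (simp add: W_def sum_distrib_left sum_distrib_right)
  finally have 1: "(\<Sum>s<h. \<theta> (k + s) * Yrow j (k + s) r) = sqrt (real m) * W (perp (\<lambda>s. \<theta> (k + s))) (snd j) * colcomb k Z z1 r" .
  have 2: "(\<Sum>s<k. \<theta> s * Yrow j s r) = colcomb k Z \<theta> r"
    by (simp add: Yrow_def colcomb_def)
  show "(\<Sum>s<k + h. \<theta> s * Yrow j s r) = colcomb k Z (\<lambda>s. \<theta> s + sqrt (real m) * W (perp (\<lambda>s. \<theta> (k + s))) (snd j) * z1 s) r"
    unfolding sum_lessThan_plus 1 2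
    by (simp add: colcomb_def distrib_right sum.distrib sum_distrib_left mult.assoc)
qed

text \<open>The cross term is a multiple of the sum of \<open>W v\<close> over the sensors, which is
  0 since \<open>perp\<close> removes the first coefficient. The squares add up because
  \<open>B\<close> is an isometry.\<close>

lemma sum_sqn_Yrow:
  "(\<Sum>j\<in>J. sqn n (\<lambda>r. \<Sum>s<k + h. \<theta> s * Yrow j s r))
    = real (card J) * (sqn k \<theta> + sqn h (perp (\<lambda>s. \<theta> (k + s))))"
proof -
  define v where "v = perp (\<lambda>s. \<theta> (k + s))"
  have W0: "(\<Sum>i<m. W v i) = 0" by (simp add: sum_W v_def perp_def)
  have sm: "(sqrt (real m))\<^sup>2 = real m" by simp
  have "(\<Sum>j\<in>J. sqn n (\<lambda>r. \<Sum>s<k + h. \<theta> s * Yrow j s r))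
    = (\<Sum>j\<in>J. sqn k \<theta> + 2 * sqrt (real m) * ip k \<theta> z1 * W v (snd j) + real m * (W v (snd j))\<^sup>2)"
    unfolding Yrow_comb sqn_colcomb[OF Z] sqn_add sqn_z1 v_def[symmetric]
    by (intro sum.cong refl) (simp add: power_mult_distrib sm)
  also have "\<dots> = (\<Sum>l<p. \<Sum>i<m. sqn k \<theta> + 2 * sqrt (real m) * ip k \<theta> z1 * W v i + real m * (W v i)\<^sup>2)"
    unfolding sum_J snd_conv ..
  also have "\<dots> = real p * (real m * sqn k \<theta> + real m * sqn h v)"
    by (simp add: sum.distrib sum_distrib_left[symmetric] W0 sqn_W)
  finally show ?thesis by (simp add: v_def algebra_simps)
qed

lemma sum_sqn_Yrow_le:
  "(\<Sum>j\<in>J. sqn n (\<lambda>r. \<Sum>s<k + h. \<theta> s * Yrow j s r)) \<le> real (card J) * sqn (k + h) \<theta>"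
proof -
  have "sqn h (perp (\<lambda>s. \<theta> (k + s))) \<le> sqn h (\<lambda>s. \<theta> (k + s))"
    unfolding sqn_def by (intro sum_mono) (simp add: perp_def)
  then show ?thesis unfolding sum_sqn_Yrow
    by (intro mult_left_mono) (simp_all add: sqn_def sum_lessThan_plus)
qed

text \<open>The dimension parameter of the sample-size condition. It bounds both the number
  \<open>k + h\<close> of unknowns and the summed squared norms of the columns of each lifted
  row.\<close>

definition "Dim = real k + (mu_max m h B)\<^sup>2 * real h"

lemma Dim_eq: "Dim = real k + real m * (Max ((\<lambda>i. sqrt (\<Sum>j<h. (B i j)\<^sup>2)) ` {..<m}))\<^sup>2"
  using h by (simp add: Dim_def mu_max_def power_mult_distrib)

lemma row_norm_le: "i < m \<Longrightarrow> (\<Sum>j<h. (B i j)\<^sup>2) \<le> (Max ((\<lambda>i. sqrt (\<Sum>j<h. (B i j)\<^sup>2)) ` {..<m}))\<^sup>2"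
proof -
  assume i: "i < m"
  have "sqrt (\<Sum>j<h. (B i j)\<^sup>2) \<le> Max ((\<lambda>i. sqrt (\<Sum>j<h. (B i j)\<^sup>2)) ` {..<m})"
    using i by (intro Max_ge) auto
  then have "(sqrt (\<Sum>j<h. (B i j)\<^sup>2))\<^sup>2 \<le> (Max ((\<lambda>i. sqrt (\<Sum>j<h. (B i j)\<^sup>2)) ` {..<m}))\<^sup>2"
    by (intro power_mono) (auto intro: sum_nonneg)
  then show ?thesis by (simp add: sum_nonneg)
qed

text \<open>The squared Frobenius norm of \<open>B\<close> equals \<open>h\<close> and is at most
  \<open>m\<close> times the largest squared row norm.\<close>

lemma kh_le_Dim: "real (k + h) \<le> Dim"
proof -
  have "real h = (\<Sum>j<h. \<Sum>i<m. (B i j)\<^sup>2)"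
    using B by (simp add: orthonormal_cols_def power2_eq_square)
  also have "\<dots> = (\<Sum>i<m. \<Sum>j<h. (B i j)\<^sup>2)" by (rule sum.swap)
  also have "\<dots> \<le> (\<Sum>i<m. (Max ((\<lambda>i. sqrt (\<Sum>j<h. (B i j)\<^sup>2)) ` {..<m}))\<^sup>2)"
    by (intro sum_mono row_norm_le) simp
  finally show ?thesis unfolding Dim_eq by simp
qed

lemma sqn_col: "s < k \<Longrightarrow> sqn n (\<lambda>r. Z r s) = 1"
  using Z by (simp add: orthonormal_cols_def sqn_def power2_eq_square)

lemma sum_sqn_rows_le:
  assumes "j \<in> J"
  shows "(\<Sum>s<k + h. sqn n (Yrow j s)) \<le> Dim"
proof -
  have "(\<Sum>s<h. sqn n (Yrow j (k + s))) \<le> (\<Sum>s<h. real m * (B (snd j) s)\<^sup>2)"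
  proof (rule sum_mono)
    fix s
    show "sqn n (Yrow j (k + s)) \<le> real m * (B (snd j) s)\<^sup>2"
    proof (cases "s = 0")
      case True
      then show ?thesis by (simp add: Yrow_def sqn_def)
    next
      case False
      then have "Yrow j (k + s) = (\<lambda>r. (sqrt (real m) * B (snd j) s) * colcomb k Z z1 r)"
        by (simp add: Yrow_def)
      then have "sqn n (Yrow j (k + s)) = (sqrt (real m) * B (snd j) s)\<^sup>2 * 1"
        by (simp only: sqn_scale sqn_colcomb[OF Z] sqn_z1)
      then show ?thesis by (simp add: power_mult_distrib)
    qed
  qed
  also have "\<dots> \<le> real m * (Max ((\<lambda>i. sqrt (\<Sum>j<h. (B i j)\<^sup>2)) ` {..<m}))\<^sup>2"
    unfolding sum_distrib_left[symmetric] using assms by (intro mult_left_mono row_norm_le) auto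
  finally have "(\<Sum>s<h. sqn n (Yrow j (k + s))) \<le> real m * (Max ((\<lambda>i. sqrt (\<Sum>j<h. (B i j)\<^sup>2)) ` {..<m}))\<^sup>2" .
  moreover have "(\<Sum>s<k. sqn n (Yrow j s)) = real k"
    by (simp add: Yrow_def sqn_col)
  ultimately show ?thesis unfolding sum_lessThan_plus Dim_eq by simp
qed

lemma ip_z1_col: "s < k \<Longrightarrow> ip n (colcomb k Z z1) (\<lambda>r. Z r s) = z1 s"
proof -
  assume s: "s < k"
  have "(\<Sum>r<n. colcomb k Z z1 r * colcomb k Z (\<lambda>s'. if s' = s then 1 else 0) r) = (\<Sum>s'<k. z1 s' * (if s' = s then 1 else 0))"
    by (rule sum_colcomb_mult[OF Z])
  moreover have "colcomb k Z (\<lambda>s'. if s' = s then 1 else 0) = (\<lambda>r. Z r s)"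
    using s by (simp add: colcomb_def if_distrib[of "\<lambda>x. x * _"] cong: if_cong)
  ultimately show ?thesis using s by (simp add: ip_def if_distrib[of "\<lambda>x. _ * x"] cong: if_cong)
qed

lemma descent_const_unrow:
  assumes "l < p" "i < m"
  shows "descent.U n k Z (unrow f) e l i = lin n (colcomb k Z e) (f (l, i))"
proof -
  have La: "descent.La n Z (unrow f) l i s = lin n (\<lambda>r. Z r s) (f (l, i))" for s
    using assms unfolding descent.La_def[OF descent] lin_def by (intro sum.cong refl) (simp add: unrow_def)
  show ?thesis unfolding descent.U_def[OF descent] La lin_colcomb ..
qed

lemma avg_unrow:
  "descent.avg m p (\<lambda>l i. F (l, i)) = 1 / real (card J) * (\<Sum>j\<in>J. F j)"
  unfolding descent.avg_def[OF descent] by (simp add: sum_J mult.commute)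

end

section \<open>Probability of the isometry and initialisation events\<close>

text \<open>The trace method needs moment orders that are powers of two; rounding up costs at most a
  factor 2.\<close>

lemma ex_power_of_2_between:
  fixes x :: real
  assumes "1 \<le> x"
  obtains s :: nat where "x \<le> 2 ^ s" "2 ^ s \<le> 2 * x"
proof -
  define s where "s = nat \<lceil>log 2 x\<rceil>"
  have l: "0 \<le> log 2 x" using assms by simp
  have s: "log 2 x \<le> real s" "real s \<le> log 2 x + 1" using l unfolding s_def by linarith+
  have e: "2 ^ s = 2 powr real s" by (simp add: powr_realpow)
  have x: "2 powr log 2 x = x" using assms by simp
  have "2 powr log 2 x \<le> 2 powr real s" "2 powr real s \<le> 2 powr (log 2 x + 1)"
    using s by (intro powr_mono; simp)+
  then show ?thesis using that[of s] unfolding e powr_add x by simp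
qed

context sampled_problem
begin

abbreviation "obs f \<equiv> meas m n k h Z B (unrow f) z b"
abbreviation "start f \<equiv> zeta0 m p n k Z (unrow f) (obs f)"
abbreviation "rowcomb \<theta> j \<equiv> \<lambda>r. \<Sum>s<k + h. \<theta> s * Yrow j s r"

lemma card_J: "real (card J) = real m * real p"
  by (simp add: mult.commute)

sublocale M1: prob_space M1
  by (intro prob_space_PiM prob_space_row)

lemma lin_component_measurable:
  assumes "j \<in> J"
  shows "(\<lambda>f. lin n y (f j)) \<in> borel_measurable M1"
  by (rule measurable_compose[OF measurable_component_singleton[OF assms] lin_measurable])

text \<open>The starting point has mean exactly \<open>z\<close>, because the gains of
  \<open>b\<close> average to 1. Each of the \<open>k\<close> coordinates may deviate by
  \<open>\<delta> / sqrt k\<close> relative to the norm of \<open>z\<close>, in either direction,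
  which gives \<open>2 k\<close> events.\<close>

lemma init_event:
  assumes \<delta>: "0 < \<delta>" "\<delta> \<le> 1" and \<rho>1: "\<rho> \<le> 1"
  obtains E where "E \<in> sets M1"
    "measure M1 E \<ge> 1 - 2 * real k * exp (- (cB * (\<delta>\<^sup>2 / real k)) * real (card J))"
    "\<And>f. f \<in> E \<Longrightarrow> sqn k (\<lambda>s. start f s - z s) \<le> \<delta>\<^sup>2 * sqn k z"
proof -
  define \<tau> where "\<tau> = \<delta> / sqrt (real k)"
  have k1: "1 \<le> sqrt (real k)" "0 < sqrt (real k)" using k by auto
  have \<tau>2: "\<tau>\<^sup>2 = \<delta>\<^sup>2 / real k" by (simp add: \<tau>_def power_divide)
  have "\<delta> \<le> sqrt (real k)" using \<delta>(2) k1(1) by linarith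
  then have \<tau>: "0 < \<tau>" "\<tau> \<le> 1" using \<delta>(1) k1(2) unfolding \<tau>_def
    by (simp_all only: divide_le_eq_1_pos divide_pos_pos)
  define T where "T s f = (\<Sum>j\<in>J. W b (snd j) * (lin n (colcomb k Z z1) (f j) * lin n (\<lambda>r. Z r s) (f j) - ip n (colcomb k Z z1) (\<lambda>r. Z r s)))" for s f
  define bad where "bad s \<sigma> = {f\<in>space M1. \<tau> * real (card J) \<le> \<sigma> * T s f}" for s and \<sigma> :: real
  have [measurable]: "T s \<in> borel_measurable M1" for s
    unfolding T_def[abs_def]
    by (intro borel_measurable_sum borel_measurable_times borel_measurable_diff borel_measurable_const lin_component_measurable)
  have sets: "bad s \<sigma> \<in> sets M1" for s \<sigma> unfolding bad_def by measurable
  have pbad: "measure M1 (bad s \<sigma>) \<le> exp (- (cB * \<tau>\<^sup>2) * real (card J))" if "s < k" "\<bar>\<sigma>\<bar> = 1" for s \<sigma>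
  proof -
    have u: "sqn n (colcomb k Z z1) \<le> 1" "sqn n (\<lambda>r. Z r s) \<le> 1"
      using that by (simp_all add: sqn_colcomb[OF Z] sqn_z1 sqn_col)
    have g: "\<bar>\<sigma> * W b (snd j)\<bar> \<le> 2" if "j \<in> J" for j
      using W_b[of "snd j"] that \<rho>1 \<open>\<bar>\<sigma>\<bar> = 1\<close> by (auto simp: abs_mult)
    have "\<sigma> * T s f = (\<Sum>j\<in>J. (\<sigma> * W b (snd j)) * (lin n (colcomb k Z z1) (f j) * lin n (\<lambda>r. Z r s) (f j) - ip n (colcomb k Z z1) (\<lambda>r. Z r s)))" for f
      unfolding T_def sum_distrib_left by (intro sum.cong refl) (simp only: ac_simps)
    then show ?thesis unfolding bad_def
      using bernstein_lin[of J n "colcomb k Z z1" "\<lambda>r. Z r s" "\<lambda>j. \<sigma> * W b (snd j)" \<tau>, OF _ u g \<tau>] by simp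
  qed
  define A where "A = (\<Union>s<k. bad s 1 \<union> bad s (- 1))"
  have A: "A \<in> sets M1" unfolding A_def using sets by auto
  have "measure M1 A \<le> (\<Sum>s<k. measure M1 (bad s 1 \<union> bad s (- 1)))"
    unfolding A_def by (intro M1.finite_measure_subadditive_finite) (use sets in auto)
  also have "\<dots> \<le> (\<Sum>s<k. 2 * exp (- (cB * \<tau>\<^sup>2) * real (card J)))"
  proof (rule sum_mono)
    fix s assume "s \<in> {..<k}"
    then have "measure M1 (bad s 1) + measure M1 (bad s (- 1)) \<le> 2 * exp (- (cB * \<tau>\<^sup>2) * real (card J))"
      using pbad[of s 1] pbad[of s "- 1"] by simp
    then show "measure M1 (bad s 1 \<union> bad s (- 1)) \<le> 2 * exp (- (cB * \<tau>\<^sup>2) * real (card J))"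
      using measure_Un_le[OF sets sets, of s 1 s "-1"] by linarith
  qed
  also have "\<dots> = 2 * real k * exp (- (cB * (\<delta>\<^sup>2 / real k)) * real (card J))" by (simp add: \<tau>2)
  finally have pA: "measure M1 A \<le> 2 * real k * exp (- (cB * (\<delta>\<^sup>2 / real k)) * real (card J))" .
  show ?thesis
  proof (rule that[of "space M1 - A"])
    show "space M1 - A \<in> sets M1" using A by auto
    show "measure M1 (space M1 - A) \<ge> 1 - 2 * real k * exp (- (cB * (\<delta>\<^sup>2 / real k)) * real (card J))"
      using M1.prob_compl[OF A] pA by simp
    fix f assume f: "f \<in> space M1 - A"
    define c where "c = real (card J)"
    have c: "0 < c" using m p by (simp add: c_def)
    have Tle: "\<bar>T s f\<bar> \<le> \<tau> * c" if "s < k" for s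
    proof -
      have "f \<in> space M1" "f \<notin> bad s 1" "f \<notin> bad s (- 1)" using f that unfolding A_def by auto
      then show ?thesis unfolding bad_def c_def by auto
    qed
    define q where "q = sqrt (sqn k z)"
    have q: "0 < q" "q\<^sup>2 = sqn k z" using z by (simp_all add: q_def)
    have zz: "z s = q * z1 s" for s using q unfolding z1_def q_def by simp
    have linz: "lin n (colcomb k Z z) a = q * lin n (colcomb k Z z1) a" for a
    proof -
      have "colcomb k Z z = (\<lambda>r. q * colcomb k Z z1 r)"
        unfolding colcomb_def sum_distrib_left by (intro ext sum.cong refl) (simp add: zz)
      then show ?thesis by (simp only: lin_scale)
    qed
    have sumW: "(\<Sum>j\<in>J. W b (snd j)) = c"
      unfolding sum_J snd_conv sum_W b0 c_def by simp
    have key: "start f s - z s = q * (T s f / c)" if s: "s < k" for s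
    proof -
      have "start f s
        = 1 / (real m * real p) * (\<Sum>l<p. \<Sum>i<m. (\<Sum>r<n. unrow f (l, i, r) * Z r s) * obs f l i)"
        using s by (simp add: zeta0_def)
      also have "(\<Sum>l<p. \<Sum>i<m. (\<Sum>r<n. unrow f (l, i, r) * Z r s) * obs f l i)
          = (\<Sum>j\<in>J. q * (W b (snd j) * (lin n (colcomb k Z z1) (f j) * lin n (\<lambda>r. Z r s) (f j))))"
        unfolding sum_J
      proof (rule sum.cong[OF refl], rule sum.cong[OF refl])
        fix l i assume li: "l \<in> {..<p}" "i \<in> {..<m}"
        have "(\<Sum>r<n. unrow f (l, i, r) * Z r s) = lin n (\<lambda>r. Z r s) (f (l, i))"
          unfolding lin_def using li by (intro sum.cong refl) (simp add: unrow_def)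
        moreover have "obs f l i = W b i * (q * lin n (colcomb k Z z1) (f (l, i)))"
          using li descent.y_eq[OF descent, of i n Z "unrow f" l] descent_const_unrow[of l i f z] by (simp add: linz)
        ultimately show "(\<Sum>r<n. unrow f (l, i, r) * Z r s) * obs f l i
          = q * (W b (snd (l, i)) * (lin n (colcomb k Z z1) (f (l, i)) * lin n (\<lambda>r. Z r s) (f (l, i))))"
          by simp
      qed
      also have "1 / (real m * real p) * \<dots> = q * (1 / c * (\<Sum>j\<in>J. W b (snd j) * (lin n (colcomb k Z z1) (f j) * lin n (\<lambda>r. Z r s) (f j))))"
        unfolding c_def card_J by (simp add: sum_distrib_left[symmetric])
      also have "(\<Sum>j\<in>J. W b (snd j) * (lin n (colcomb k Z z1) (f j) * lin n (\<lambda>r. Z r s) (f j))) = T s f + c * z1 s"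
        unfolding T_def ip_z1_col[OF s] by (simp add: right_diff_distrib sum_subtractf sum_distrib_right[symmetric] sumW)
      also have "q * (1 / c * (T s f + c * z1 s)) = q * (T s f / c) + z s"
        unfolding zz[of s] using c by (simp add: field_simps)
      finally show ?thesis by simp
    qed
    have "sqn k (\<lambda>s. start f s - z s) \<le> (\<Sum>s<k. q\<^sup>2 * \<tau>\<^sup>2)"
      unfolding sqn_def
    proof (rule sum_mono)
      fix s assume "s \<in> {..<k}"
      then have s: "s < k" by simp
      have "\<bar>T s f / c\<bar> \<le> \<bar>\<tau>\<bar>" using Tle[OF s] c \<tau> by (simp add: field_simps)
      then have "(T s f / c)\<^sup>2 \<le> \<tau>\<^sup>2" by (simp only: abs_le_square_iff)
      then show "(start f s - z s)\<^sup>2 \<le> q\<^sup>2 * \<tau>\<^sup>2"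
        unfolding key[OF s] power_mult_distrib by (intro mult_left_mono) auto
    qed
    also have "\<dots> = \<delta>\<^sup>2 * sqn k z" using k by (simp add: q \<tau>2)
    finally show "sqn k (\<lambda>s. start f s - z s) \<le> \<delta>\<^sup>2 * sqn k z" .
  qed
qed

lemma isometric_of_bounds:
  assumes up: "\<And>e. (\<Sum>j\<in>J. (lin n (colcomb k Z e) (f j))\<^sup>2) \<le> 8 * real (card J) * sqn k e"
    and lo: "\<And>\<theta>. 19 / 20 * (\<Sum>j\<in>J. sqn n (rowcomb \<theta> j)) - 1 / 20 * real (card J) * sqn (k + h) \<theta>
      \<le> (\<Sum>j\<in>J. (lin n (rowcomb \<theta> j) (f j))\<^sup>2)"
    and \<rho>: "\<rho> \<le> 1 / 31"
  shows "isometric_descent m h B \<rho> b n k p Z (unrow f) z"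
proof (intro isometric_descent.intro descent isometric_descent_axioms.intro \<rho>)
  let ?U = "descent.U n k Z (unrow f)"
  have c: "0 < real (card J)" using m p by simp
  have cancel: "1 / x * (8 * x * y) = 8 * y" if "0 < x" for x y :: real
    using that by simp
  have cancel2: "1 / x * (19 / 20 * (x * y) - 1 / 20 * x * y) = 9 / 10 * y" if "0 < x" for x y :: real
    using that by (simp add: field_simps)
  have avg: "descent.avg m p (\<lambda>l i. G l i) = 1 / real (card J) * (\<Sum>j\<in>J. F j)"
    if "\<And>l i. l < p \<Longrightarrow> i < m \<Longrightarrow> G l i = F (l, i)" for G and F :: "nat \<times> nat \<Rightarrow> real"
    unfolding avg_unrow[symmetric] by (rule descent.avg_cong[OF descent]) (rule that)
  fix e :: vect
  have "descent.avg m p (\<lambda>l i. (?U e l i)\<^sup>2) = 1 / real (card J) * (\<Sum>j\<in>J. (lin n (colcomb k Z e) (f j))\<^sup>2)"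
    by (rule avg) (simp add: descent_const_unrow)
  also have "\<dots> \<le> 1 / real (card J) * (8 * real (card J) * sqn k e)" using c by (intro mult_left_mono up) auto
  also have "\<dots> = 8 * sqn k e" using c by (rule cancel)
  finally show "descent.avg m p (\<lambda>l i. (?U e l i)\<^sup>2) \<le> 8 * sqn k e" .
  fix v :: vect assume v0: "v 0 = 0"
  \<comment> \<open>With the gain error scaled by \<open>q\<close>, the metric of
    \<open>\<Delta>\<close> becomes the plain squared norm of \<open>\<theta>\<close>.\<close>
  define q where "q = sqrt (sqn k z / real m)"
  have q2: "q\<^sup>2 = sqn k z / real m" using z by (simp add: q_def)
  have qm: "sqrt (real m) * q = sqrt (sqn k z)" using m by (simp add: q_def real_sqrt_divide)
  define \<theta> where "\<theta> s = (if s < k then e s else q * v (s - k))" for s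
  have pv: "perp (\<lambda>s. \<theta> (k + s)) = (\<lambda>s. q * v s)" using v0 by (auto simp: perp_def \<theta>_def fun_eq_iff)
  have s1: "sqn k \<theta> = sqn k e" unfolding sqn_def by (intro sum.cong refl) (simp add: \<theta>_def)
  have s2: "sqn h (\<lambda>s. \<theta> (k + s)) = sqn k z / real m * sqn h v"
    unfolding \<theta>_def by (simp add: sqn_scale q2)
  have Wq: "W (\<lambda>s. q * v s) i = q * W v i" for i by (simp add: W_def sum_distrib_left ac_simps)
  have comb: "(rowcomb \<theta> j) = colcomb k Z (\<lambda>s. e s + W v (snd j) * z s)" for j
    unfolding Yrow_comb pv Wq
  proof -
    have "\<theta> s + sqrt (real m) * (q * W v (snd j)) * z1 s = e s + W v (snd j) * z s" if "s < k" for s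
    proof -
      have "sqrt (real m) * (q * W v (snd j)) * z1 s = W v (snd j) * ((sqrt (real m) * q) * z1 s)" by (simp only: ac_simps)
      also have "(sqrt (real m) * q) * z1 s = z s" unfolding qm z1_def using z by simp
      finally show ?thesis using that by (simp add: \<theta>_def)
    qed
    then show "colcomb k Z (\<lambda>s. \<theta> s + sqrt (real m) * (q * W v (snd j)) * z1 s) = colcomb k Z (\<lambda>s. e s + W v (snd j) * z s)"
      unfolding colcomb_def by (intro ext sum.cong refl) simp
  qed
  have "descent.avg m p (\<lambda>l i. (?U e l i + W v i * ?U z l i)\<^sup>2)
      = 1 / real (card J) * (\<Sum>j\<in>J. (lin n (rowcomb \<theta> j) (f j))\<^sup>2)"
  proof (rule avg)
    fix l i assume li: "l < p" "i < m"
    have "?U e l i + W v i * ?U z l i = ?U (\<lambda>s. e s + W v i * z s) l i"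
      by (rule descent.U_comb[OF descent, symmetric])
    then show "(?U e l i + W v i * ?U z l i)\<^sup>2
      = (lin n (rowcomb \<theta> (l, i)) (f (l, i)))\<^sup>2"
      unfolding comb snd_conv using descent_const_unrow[OF li] by simp
  qed
  also have "\<dots> \<ge> 1 / real (card J) * (19 / 20 * (\<Sum>j\<in>J. sqn n (rowcomb \<theta> j)) - 1 / 20 * real (card J) * sqn (k + h) \<theta>)"
    using c by (intro mult_left_mono lo) auto
  moreover have "1 / real (card J) * (19 / 20 * (\<Sum>j\<in>J. sqn n (rowcomb \<theta> j)) - 1 / 20 * real (card J) * sqn (k + h) \<theta>)
      = 9 / 10 * (sqn k e + sqn k z / real m * sqn h v)"
  proof -
    have "sqn h (perp (\<lambda>s. \<theta> (k + s))) = sqn k z / real m * sqn h v"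
      unfolding pv sqn_scale q2 ..
    moreover have "sqn (k + h) \<theta> = sqn k e + sqn k z / real m * sqn h v"
      unfolding s1[symmetric] s2[symmetric] by (simp add: sqn_def sum_lessThan_plus)
    ultimately show ?thesis unfolding sum_sqn_Yrow s1 using cancel2[OF c] by (simp only:)
  qed
  ultimately show "9 / 10 * (sqn k e + sqn k z / real m * sqn h v)
      \<le> descent.avg m p (\<lambda>l i. (?U e l i + gain_setting.W h B v i * ?U z l i)\<^sup>2)"
    by linarith
qed

lemma good_event:
  assumes \<delta>: "0 < \<delta>" "\<delta> \<le> 1" and t: "1 \<le> t" and \<rho>: "\<rho> \<le> 1 / 31"
    and C3: "7 \<le> cB * C" "1920000 * K4 \<le> C" "1 \<le> C"
    and size: "C * (t * Dim * (1 + ln (real m * real p))) \<le> real m * real p * \<delta>\<^sup>2"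
  obtains E where "E \<in> sets M1" "measure M1 E \<ge> 1 - 4 * (real m * real p) powr (- t)"
    "\<And>f. f \<in> E \<Longrightarrow> isometric_descent m h B \<rho> b n k p Z (unrow f) z"
    "\<And>f. f \<in> E \<Longrightarrow> sqn k (\<lambda>s. start f s - z s) \<le> \<delta>\<^sup>2 * sqn k z"
proof -
  define N where "N = real m * real p"
  \<comment> \<open>The added 1 keeps \<open>L\<close> at least 1 when \<open>mp = 1\<close>, where
    the logarithm vanishes.\<close>
  define L where "L = 1 + ln N"
  define P where "P = t * Dim * L"
  have cJ: "real (card J) = N" unfolding N_def by (rule card_J)
  have "1 * 1 \<le> real m * real p" using m p by (intro mult_mono) auto
  then have N: "1 \<le> N" by (simp add: N_def)
  then have L: "1 \<le> L" by (simp add: L_def)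
  have tL: "1 \<le> t * L" using mult_mono[of 1 t 1 L] t L by simp
  have Dim: "real k \<le> Dim" "real (k + h) \<le> Dim" "1 \<le> Dim" using kh_le_Dim h by auto
  have P: "t * L \<le> P" "Dim \<le> P" "0 < P"
  proof -
    have e: "P = (t * L) * Dim" by (simp add: P_def)
    show "t * L \<le> P" unfolding e using mult_left_mono[of 1 Dim "t * L"] Dim tL by simp
    show "Dim \<le> P" unfolding e using mult_right_mono[of 1 "t * L" Dim] Dim tL by simp
    then show "0 < P" using Dim by simp
  qed
  have \<delta>2: "\<delta>\<^sup>2 \<le> 1" using \<delta> by (simp add: power_le_one)
  have size': "C * P \<le> N * \<delta>\<^sup>2" using size by (simp add: N_def P_def L_def)
  also have "\<dots> \<le> N * 1" using N \<delta>2 by (intro mult_left_mono) auto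
  finally have CP: "C * P \<le> N" by simp
  have "1 * P \<le> C * P" using C3 P by (intro mult_right_mono) auto
  then have PN: "P \<le> N" using CP by simp
  have powr: "N powr (- t) = exp (- (t * ln N))" using N by (simp add: powr_def)
  \<comment> \<open>One half of the exponent \<open>2 t L\<close> produces the failure probability,
    the other half swallows a prefactor \<open>N\<close>, such as the number of coordinates or
    unknowns.\<close>
  have small: "N * exp (- (2 * (t * L))) \<le> N powr (- t)"
  proof -
    have "N * exp (- (2 * (t * L))) = exp (ln N - 2 * (t * L))" using N by (simp add: exp_diff exp_minus field_simps)
    also have "\<dots> \<le> exp (- (t * ln N))"
    proof -
      have "1 * ln N \<le> t * ln N" using t N by (intro mult_right_mono) auto
      then have "ln N - 2 * (t * L) \<le> - (t * ln N)" using t by (simp add: L_def algebra_simps)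
      then show ?thesis by simp
    qed
    finally show ?thesis unfolding powr .
  qed
  obtain E1 where E1: "E1 \<in> sets M1" "measure M1 E1 \<ge> 1 - 2 * real k * exp (- (cB * (\<delta>\<^sup>2 / real k)) * real (card J))"
    "\<And>f. f \<in> E1 \<Longrightarrow> sqn k (\<lambda>s. start f s - z s) \<le> \<delta>\<^sup>2 * sqn k z"
  proof (rule init_event[OF \<delta>])
    show "\<rho> \<le> 1" using \<rho> by simp
  qed (rule that; assumption)
  have p1: "2 * real k * exp (- (cB * (\<delta>\<^sup>2 / real k)) * real (card J)) \<le> 2 * N powr (- t)"
  proof -
    have k0: "0 < real k" using k by simp
    have "real k * (7 * (t * L)) \<le> Dim * (7 * (t * L))" using Dim tL by (intro mult_right_mono) auto
    also have "\<dots> = 7 * P" by (simp add: P_def)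
    also have "\<dots> \<le> cB * C * P" using C3 P by (intro mult_right_mono) auto
    also have "\<dots> = cB * (C * P)" by simp
    also have "\<dots> \<le> cB * (N * \<delta>\<^sup>2)" using cB_pos size' by (intro mult_left_mono) auto
    finally have "7 * (t * L) \<le> cB * (\<delta>\<^sup>2 / real k) * N" using k0 by (simp add: field_simps)
    then have "exp (- (cB * (\<delta>\<^sup>2 / real k)) * N) \<le> exp (- (2 * (t * L)))" using tL by simp
    moreover have "2 * real k \<le> 2 * N" using Dim P PN by simp
    ultimately have "2 * real k * exp (- (cB * (\<delta>\<^sup>2 / real k)) * N) \<le> 2 * N * exp (- (2 * (t * L)))"
      using N by (intro mult_mono) auto
    then show ?thesis unfolding cJ using small by simp
  qed
  obtain E2 where E2: "E2 \<in> sets M1" "measure M1 E2 \<ge> 1 - exp (6 * real k - cB * real (card J))"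
    "\<And>f e. f \<in> E2 \<Longrightarrow> (\<Sum>j\<in>J. (lin n (colcomb k Z e) (f j))\<^sup>2) \<le> 8 * real (card J) * sqn k e"
  proof (rule upper_isometry[of J n k Z])
    show "finite J" by simp
    show "orthonormal_cols n k Z" by (rule Z)
    show "1 \<le> k" by (rule k)
  qed (rule that; assumption)
  have p2: "exp (6 * real k - cB * real (card J)) \<le> N powr (- t)"
  proof -
    \<comment> \<open>Of the 7, six units pay for the size of the net and one for the
      probability.\<close>
    have "7 * P \<le> cB * C * P" using C3 P by (intro mult_right_mono) auto
    also have "\<dots> = cB * (C * P)" by simp
    also have "\<dots> \<le> cB * N" using cB_pos CP by (intro mult_left_mono) auto
    finally have "6 * real k - cB * N \<le> - P" using Dim P by linarith
    also have "\<dots> \<le> - (t * ln N)"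
    proof -
      have "t * ln N \<le> t * L" using t by (intro mult_left_mono) (auto simp: L_def)
      then show ?thesis using P by linarith
    qed
    finally show ?thesis unfolding cJ powr by simp
  qed
  obtain s :: nat where s: "2 * (t * L) \<le> 2 ^ s" "2 ^ s \<le> 2 * (2 * (t * L))"
    using ex_power_of_2_between[of "2 * (t * L)"] tL by auto
  let ?q = "160000 * K4 * Dim * 2 ^ s"
  \<comment> \<open>\<open>lower_isometry\<close> bounds the rows at every index, whereas
    \<open>B\<close> is controlled only for rows below \<open>m\<close>; hence the extension by
    zero.\<close>
  define Y where "Y j = (if j \<in> J then Yrow j else (\<lambda>s r. 0))" for j
  have q0: "?q \<le> 640000 * K4 * P"
  proof -
    have "?q \<le> 160000 * K4 * Dim * (2 * (2 * (t * L)))"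
      using K4_pos Dim s by (intro mult_left_mono) auto
    then show ?thesis by (simp add: P_def)
  qed
  \<comment> \<open>The base of the tail bound is then at most \<open>1 / 3 \<le> exp (- 1)\<close>,
    so a moment of order \<open>2 ^ s\<close> fails with probability of order
    \<open>exp (- (2 ^ s))\<close> up to the dimension.\<close>
  have q1: "3 * ?q \<le> N"
  proof -
    have "3 * ?q \<le> 1920000 * K4 * P" using q0 by simp
    also have "\<dots> \<le> C * P" using C3 P by (intro mult_right_mono) auto
    finally show ?thesis using CP by simp
  qed
  have K0: "0 \<le> K4 * Dim * 2 ^ s" using K4_pos Dim by simp
  obtain E3 where E3: "E3 \<in> sets M1"
    "measure M1 E3 \<ge> 1 - real (k + h) * (?q / real (card J)) ^ (2 ^ s)"
    "\<And>f \<theta>. f \<in> E3 \<Longrightarrow> (\<Sum>j\<in>J. (lin n (\<lambda>r. \<Sum>s<k + h. \<theta> s * Y j s r) (f j))\<^sup>2)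
        \<ge> 19 / 20 * (\<Sum>j\<in>J. sqn n (\<lambda>r. \<Sum>s<k + h. \<theta> s * Y j s r)) - 1 / 20 * real (card J) * sqn (k + h) \<theta>"
  proof (rule lower_isometry[of J Dim n Y "k + h" s])
    show "finite J" by simp
    show "0 < Dim" using Dim by simp
    show "(\<Sum>s<k + h. sqn n (Y j s)) \<le> Dim" for j
    proof (cases "j \<in> J")
      case True
      then show ?thesis unfolding Y_def using sum_sqn_rows_le[OF True] by (simp only: if_True)
    next
      case False
      then have "sqn n (Y j s) = 0" for s by (auto simp: Y_def sqn_def)
      then show ?thesis using Dim by simp
    qed
    show "(\<Sum>j\<in>J. sqn n (\<lambda>r. \<Sum>s<k + h. v s * Y j s r)) \<le> real (card J) * sqn (k + h) v" for v
      using sum_sqn_Yrow_le[of v] unfolding Y_def by (simp only: if_True cong: sum.cong)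
    show "80 * K4 * Dim * 2 ^ s \<le> real (card J)" using q1 K0 unfolding cJ by simp
  qed (rule that; assumption)
  have p3: "real (k + h) * (?q / real (card J)) ^ (2 ^ s) \<le> N powr (- t)"
  proof -
    have nn: "0 \<le> ?q / N"
      using K4_pos Dim N by (intro divide_nonneg_nonneg mult_nonneg_nonneg) auto
    have "?q / N \<le> 1 / 3" using q1 N by (simp add: field_simps)
    also have "\<dots> \<le> exp (- 1)" using exp_le by (simp add: exp_minus field_simps)
    finally have "(?q / N) ^ (2 ^ s) \<le> exp (- 1) ^ (2 ^ s)"
      by (rule power_mono) (rule nn)
    also have "\<dots> = exp (- (2 ^ s))" by (simp flip: exp_of_nat_mult)
    also have "\<dots> \<le> exp (- (2 * (t * L)))" using s by simp
    finally have "real (k + h) * (?q / N) ^ (2 ^ s) \<le> N * exp (- (2 * (t * L)))"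
      using Dim P PN N zero_le_power[OF nn] by (intro mult_mono) auto
    then show ?thesis unfolding cJ using small by linarith
  qed
  show ?thesis
  proof (rule that[of "E1 \<inter> E2 \<inter> E3"])
    show "E1 \<inter> E2 \<inter> E3 \<in> sets M1" using E1 E2 E3 by auto
    have "measure M1 (space M1 - (E1 \<inter> E2 \<inter> E3)) \<le> measure M1 ((space M1 - E1) \<union> (space M1 - E2) \<union> (space M1 - E3))"
      using E1 E2 E3 by (intro M1.finite_measure_mono) auto
    also have "\<dots> \<le> measure M1 (space M1 - E1) + measure M1 (space M1 - E2) + measure M1 (space M1 - E3)"
    proof -
      have m: "space M1 - E1 \<in> sets M1" "space M1 - E2 \<in> sets M1" "space M1 - E3 \<in> sets M1" using E1 E2 E3 by auto
      show ?thesis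
        using measure_Un_le[OF sets.Un[OF m(1,2)] m(3)] measure_Un_le[OF m(1,2)] by linarith
    qed
    finally have "1 - measure M1 (E1 \<inter> E2 \<inter> E3) \<le> (1 - measure M1 E1) + (1 - measure M1 E2) + (1 - measure M1 E3)"
      using M1.prob_compl[of E1] M1.prob_compl[of E2] M1.prob_compl[of E3] M1.prob_compl[of "E1 \<inter> E2 \<inter> E3"] E1 E2 E3 by auto
    then show "measure M1 (E1 \<inter> E2 \<inter> E3) \<ge> 1 - 4 * (real m * real p) powr (- t)"
      unfolding N_def[symmetric] using E1(2) E2(2) E3(2) p1 p2 p3 by linarith
    fix f assume f: "f \<in> E1 \<inter> E2 \<inter> E3"
    show "sqn k (\<lambda>s. start f s - z s) \<le> \<delta>\<^sup>2 * sqn k z"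
      using E1(3) f by blast
    have "19 / 20 * (\<Sum>j\<in>J. sqn n (rowcomb \<theta> j)) - 1 / 20 * real (card J) * sqn (k + h) \<theta>
      \<le> (\<Sum>j\<in>J. (lin n (rowcomb \<theta> j) (f j))\<^sup>2)" for \<theta>
      using E3(3)[of f \<theta>] f unfolding Y_def by (simp only: if_True Int_iff cong: sum.cong)
    then show "isometric_descent m h B \<rho> b n k p Z (unrow f) z"
      using E2(3) f \<rho> by (intro isometric_of_bounds) auto
  qed
qed

end

section \<open>Linear convergence\<close>

context sampled_problem
begin

lemma convergence_probability:
  assumes \<delta>: "0 < \<delta>" and t: "1 \<le> t"
    and C: "7 \<le> cB * C" "1920000 * K4 \<le> C" "1 \<le> C"
    and size: "C * (t * Dim * (1 + ln (real m * real p))) \<le> real m * real p * \<delta>\<^sup>2"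
    and \<eta>: "0 < 1 - 31 * \<rho> - 4 * \<delta>"
    and \<mu>: "0 < \<mu>" "\<mu> < 1 / 1000 * (1 - 31 * \<rho> - 4 * \<delta>) / real m"
  defines "Dl \<equiv> \<lambda>\<omega> j. Delta m k h z b (fst (iterates m p n k h Z B \<omega> z b \<rho> \<mu> j))
      (snd (iterates m p n k h Z B \<omega> z b \<rho> \<mu> j))"
  shows "measure M0 {\<omega> \<in> space M0.
      (\<forall>j. Dl \<omega> j \<le> (1 - (1 - 31 * \<rho> - 4 * \<delta>) * \<mu>) ^ j * (\<delta>\<^sup>2 + \<rho>\<^sup>2) * sqn k z) \<and> Dl \<omega> \<longlonglongrightarrow> 0}
    \<ge> 1 - 4 * (real m * real p) powr (- t)"
proof -
  define \<eta> where "\<eta> = 1 - 31 * \<rho> - 4 * \<delta>"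
  have \<rho>0: "0 \<le> \<rho>" by (rule \<rho>_nonneg)
  have \<eta>1: "0 < \<eta>" "\<eta> \<le> 1" "\<rho> \<le> 1 / 31" "\<delta> \<le> 1" using \<eta> \<rho>0 \<delta> by (auto simp: \<eta>_def)
  have m0: "0 < real m" "1 \<le> real m" using m by simp_all
  have \<mu>m: "\<mu> * real m < 1 / 1000 * \<eta>" using \<mu>(2) m0 by (simp add: \<eta>_def pos_less_divide_eq)
  then have \<mu>m': "\<mu> * real m \<le> 1 / 1000" using \<eta>1 by simp
  have "\<mu> \<le> \<mu> * real m" using \<mu> m0 mult_left_mono[of 1 "real m" \<mu>] by simp
  then have \<mu>1: "\<mu> < 1" using \<mu>m' by linarith
  have "\<eta> * \<mu> \<le> 1 * \<mu>" using \<eta>1 \<mu> by (intro mult_right_mono) auto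
  moreover have "0 < \<eta> * \<mu>" using \<eta>1 \<mu> by simp
  ultimately have q: "0 \<le> 1 - \<eta> * \<mu>" "1 - \<eta> * \<mu> < 1" using \<mu>1 by linarith+
  define bnd where "bnd j = (1 - \<eta> * \<mu>) ^ j * (\<delta>\<^sup>2 + \<rho>\<^sup>2) * sqn k z" for j
  have nonneg: "0 \<le> Dl \<omega> j" for \<omega> j
    unfolding Dl_def Delta_def using z by (intro add_nonneg_nonneg mult_nonneg_nonneg divide_nonneg_nonneg sqn_nonneg) auto
  have "bnd \<longlonglongrightarrow> 0 * (\<delta>\<^sup>2 + \<rho>\<^sup>2) * sqn k z"
    unfolding bnd_def[abs_def] using q by (intro tendsto_intros LIMSEQ_power_zero) auto
  then have lim: "bnd \<longlonglongrightarrow> 0" by simp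
  have conv: "Dl \<omega> \<longlonglongrightarrow> 0" if "\<forall>j. Dl \<omega> j \<le> bnd j" for \<omega>
    by (rule tendsto_sandwich[OF _ _ tendsto_const lim]) (use that nonneg in auto)
  define G where "G = {\<omega> \<in> space M0. \<forall>j. Dl \<omega> j \<le> bnd j}"
  have [measurable]: "(\<lambda>\<omega>. Dl \<omega> j) \<in> borel_measurable M0" for j
    unfolding Dl_def Delta_def sqn_def using iterates_measurable[of \<mu> j] by measurable
  have G: "G \<in> sets M0" unfolding G_def by measurable
  obtain E where E: "E \<in> sets M1" "measure M1 E \<ge> 1 - 4 * (real m * real p) powr (- t)"
    "\<And>f. f \<in> E \<Longrightarrow> isometric_descent m h B \<rho> b n k p Z (unrow f) z"
    "\<And>f. f \<in> E \<Longrightarrow> sqn k (\<lambda>s. start f s - z s) \<le> \<delta>\<^sup>2 * sqn k z"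
    by (rule good_event[OF \<delta> \<eta>1(4) t \<eta>1(3) C size]) (rule that; assumption)
  have "E \<subseteq> unrow -` G \<inter> space M1"
  proof
    fix f assume f: "f \<in> E"
    then have sp: "f \<in> space M1" using sets.sets_into_space[OF E(1)] by auto
    then have "unrow f \<in> space M0" using distr_unrow(2) by (rule measurable_space[rotated])
    moreover have "Dl (unrow f) j \<le> bnd j" for j
      using isometric_descent.iterates_bound[OF E(3)[OF f] E(4)[OF f] \<delta> \<eta>_def \<eta>1(1) \<mu>(1) \<mu>m', of j]
      unfolding Dl_def bnd_def by simp
    ultimately show "f \<in> unrow -` G \<inter> space M1" using sp by (auto simp: G_def)
  qed
  then have "measure M1 E \<le> measure M1 (unrow -` G \<inter> space M1)"
    by (rule M1.finite_measure_mono) (use measurable_sets[OF distr_unrow(2) G] in simp)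
  also have "\<dots> = measure (distr M1 M0 unrow) G"
    using measure_distr[OF distr_unrow(2) G] by simp
  also have "\<dots> = measure M0 G" by (simp only: distr_unrow(1))
  finally have "1 - 4 * (real m * real p) powr (- t) \<le> measure M0 G" using E(2) by linarith
  \<comment> \<open>The geometric bound already forces convergence, so the limit clause does not
    shrink the event.\<close>
  moreover have "{\<omega> \<in> space M0. (\<forall>j. Dl \<omega> j \<le> (1 - (1 - 31 * \<rho> - 4 * \<delta>) * \<mu>) ^ j * (\<delta>\<^sup>2 + \<rho>\<^sup>2) * sqn k z) \<and> Dl \<omega> \<longlonglongrightarrow> 0} = G"
    unfolding G_def bnd_def[symmetric] \<eta>_def[symmetric] using conv by auto
  ultimately show ?thesis by simp
qed

end

text \<open>The infimum defining the sub-Gaussian norm need not be attained; an admissible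
  \<open>s\<close> below \<open>2 * \<alpha>\<close> exists, and doubling \<open>\<alpha>\<close> is
  the origin of the 4.\<close>

lemma subgaussian_lawI:
  assumes "prob_space D" "sets D = sets borel" "integrable D (\<lambda>x. x)" "(\<integral>x. x \<partial>D) = 0" "(\<integral>x. x\<^sup>2 \<partial>D) = 1"
    and norm: "has_subg_norm D \<alpha>" and \<alpha>: "0 < \<alpha>"
  shows "subgaussian_law D (1 / (4 * \<alpha>\<^sup>2))"
proof -
  interpret prob_space D by fact
  obtain s where s: "s \<in> subg_set D" "s < 2 * \<alpha>"
  proof -
    have "Inf (subg_set D) < 2 * \<alpha>" "subg_set D \<noteq> {}" using norm \<alpha> by (auto simp: has_subg_norm_def)
    then show ?thesis using cInf_lessD[of "subg_set D" "2 * \<alpha>"] that by blast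
  qed
  then have s0: "0 < s" and le: "(\<integral>\<^sup>+x. ennreal (exp (x\<^sup>2 / s\<^sup>2)) \<partial>D) \<le> 2" by (auto simp: subg_set_def)
  have "1 / (4 * \<alpha>\<^sup>2) * x\<^sup>2 \<le> x\<^sup>2 / s\<^sup>2" for x :: real
  proof -
    have "s\<^sup>2 \<le> (2 * \<alpha>)\<^sup>2" using s s0 by (intro power_mono) auto
    then have "x\<^sup>2 / (2 * \<alpha>)\<^sup>2 \<le> x\<^sup>2 / s\<^sup>2" using s0 \<alpha> by (intro divide_left_mono) auto
    then show ?thesis by (simp add: power_mult_distrib)
  qed
  then have "(\<integral>\<^sup>+x. ennreal (exp (1 / (4 * \<alpha>\<^sup>2) * x\<^sup>2)) \<partial>D) \<le> (\<integral>\<^sup>+x. ennreal (exp (x\<^sup>2 / s\<^sup>2)) \<partial>D)"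
    by (intro nn_integral_mono ennreal_leI) simp
  then have "(\<integral>\<^sup>+x. ennreal (exp (1 / (4 * \<alpha>\<^sup>2) * x\<^sup>2)) \<partial>D) \<le> 2" using le by (rule order_trans)
  then show ?thesis using assms by unfold_locales auto
qed

text \<open>Passes from the single logarithm of the trace method to the squared one in the
  sample-size condition. As \<open>ln x\<close> is at least 1/2, the 1 is at most
  \<open>4 (ln x)^2\<close> and \<open>ln N\<close> at most \<open>2 (ln x)^2\<close>.\<close>

lemma one_add_ln_le:
  fixes N x :: real
  assumes "1 \<le> N" "N \<le> x" "2 \<le> x"
  shows "1 + ln N \<le> 6 * (ln x)\<^sup>2"
proof -
  have "ln 2 \<le> ln x" "ln N \<le> ln x" using assms by simp_all
  moreover have "(1::real) / 2 \<le> ln 2"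
  proof (subst ln_ge_iff)
    show "exp (1 / 2) \<le> (2::real)" using exp_bound[of "1 / 2"] by (simp add: power2_eq_square)
  qed simp
  ultimately have l: "1 / 2 \<le> ln x" "ln N \<le> ln x" by linarith+
  have "1 / 2 * ln x \<le> ln x * ln x" using l by (intro mult_right_mono) auto
  then show ?thesis using l unfolding power2_eq_square by linarith
qed

theorem mainTheorem9:
  shows "\<exists>c>0. \<forall>\<alpha>>0. \<forall>c\<^sub>0>0. \<exists>C\<^sub>1>0. \<exists>C\<^sub>2>0. \<exists>C>0.
    \<forall>(D :: real measure) (n::nat) (m::nat) (p::nat) (k::nat) (h::nat)
      (Z::matr) (B::matr) (z::vect) (b::vect) (\<delta>::real) (t::real) (\<rho>::real) (\<mu>::real).
      prob_space D \<and> sets D = sets borel \<and>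
      integrable D (\<lambda>x. x) \<and> (\<integral>x. x \<partial>D) = 0 \<and> (\<integral>x. x\<^sup>2 \<partial>D) = 1 \<and>
      has_subg_norm D \<alpha> \<and>
      1 \<le> n \<and> 1 \<le> m \<and> 1 \<le> p \<and>
      subspace_setting n m k h Z B \<and>
      (\<exists>i<n. mv n k Z z i \<noteq> 0) \<and>
      ((\<integral>x. x ^ 4 \<partial>D) = 1 \<longrightarrow>
         n > 1 \<and> (\<Sum>i<n. (mv n k Z z i) ^ 4) / (sqn n (mv n k Z z))\<^sup>2 \<le> 1 - c\<^sub>0 / real n) \<and>
      b 0 = sqrt (real m) \<and> in_G \<rho> m (mv m h B b) \<and>
      0 < \<delta> \<and> \<delta> < 1 \<and> 1 \<le> t \<and>
      real n \<ge> C\<^sub>1 * t * ln (real m * real p) \<and>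
      real m * real p \<ge> C\<^sub>2 * t * \<delta> powr (-2) * (real k + (mu_max m h B)\<^sup>2 * real h)
                         * (ln (real m * (real p + real n)))\<^sup>2 * ln (1 / \<delta>) \<and>
      \<rho> < (1 - 4 * \<delta>) / 31 \<and>
      0 < \<mu> \<and> \<mu> < c * (1 - 31 * \<rho> - 4 * \<delta>) / real m
    \<longrightarrow>
      (let M = PiM ({..<p} \<times> {..<m} \<times> {..<n}) (\<lambda>_. D);
           \<eta> = 1 - 31 * \<rho> - 4 * \<delta>;
           Dl = (\<lambda>\<omega> j. Delta m k h z b (fst (iterates m p n k h Z B \<omega> z b \<rho> \<mu> j))
                                      (snd (iterates m p n k h Z B \<omega> z b \<rho> \<mu> j)))
       in measure M {\<omega> \<in> space M.
             (\<forall>j. Dl \<omega> j \<le> (1 - \<eta> * \<mu>) ^ j * (\<delta>\<^sup>2 + \<rho>\<^sup>2) * sqn k z) \<and> Dl \<omega> \<longlonglongrightarrow> 0}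
          \<ge> 1 - C * (real m * real p) powr (- t))"
proof (rule exI[of _ "1 / 1000"], intro conjI allI impI, goal_cases)
  case (2 \<alpha> c\<^sub>0)
  define \<kappa> where "\<kappa> = 1 / (4 * \<alpha>\<^sup>2)"
  \<comment> \<open>The largest of the thresholds from the starting point and upper isometry (both
    through \<open>cB\<close>) and from the lower isometry (through \<open>K4\<close>). It depends
    on \<open>\<alpha>\<close> alone.\<close>
  define C3 where "C3 = max 1 (max (7 / subgaussian_law.cB \<kappa>) (1920000 * subgaussian_law.K4 \<kappa>))"
  have C3: "1 \<le> C3" by (simp add: C3_def)
  show ?case
  \<comment> \<open>The 6 comes from \<open>one_add_ln_le\<close>. The 4 counts failure terms: two
    units for the starting point, one for each isometry.\<close>
  proof (rule exI[of _ 1], rule conjI[OF zero_less_one], rule exI[of _ "6 * C3"], rule conjI,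
      use C3 in simp, rule exI[of _ 4], rule conjI, simp, intro allI impI, elim conjE)
    fix D :: "real measure" and n m p k h :: nat and Z B :: matr and z b :: vect and \<delta> t \<rho> \<mu> :: real
    assume D: "prob_space D" "sets D = sets borel" "integrable D (\<lambda>x. x)" "(\<integral>x. x \<partial>D) = 0" "(\<integral>x. x\<^sup>2 \<partial>D) = 1"
        "has_subg_norm D \<alpha>"
      and n: "1 \<le> n" and m: "1 \<le> m" and p: "1 \<le> p" and S: "subspace_setting n m k h Z B"
      and zne: "\<exists>i<n. mv n k Z z i \<noteq> 0"
      and b0: "b 0 = sqrt (real m)" and bG: "in_G \<rho> m (mv m h B b)"
      and \<delta>: "0 < \<delta>" "\<delta> < 1" and t: "1 \<le> t"
      and size: "6 * C3 * t * \<delta> powr (-2) * (real k + (mu_max m h B)\<^sup>2 * real h)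
                         * (ln (real m * (real p + real n)))\<^sup>2 * ln (1 / \<delta>) \<le> real m * real p"
      and \<rho>: "\<rho> < (1 - 4 * \<delta>) / 31"
      and \<mu>: "0 < \<mu>" "\<mu> < 1 / 1000 * (1 - 31 * \<rho> - 4 * \<delta>) / real m"
    have law: "subgaussian_law D \<kappa>" unfolding \<kappa>_def by (rule subgaussian_lawI[OF D 2(1)])
    have "\<exists>s<k. z s \<noteq> 0"
    proof (rule ccontr)
      assume "\<not> (\<exists>s<k. z s \<noteq> 0)"
      then have "mv n k Z z i = 0" for i by (simp add: mv_def)
      then show False using zne by simp
    qed
    then obtain s0 where s0: "s0 < k" "z s0 \<noteq> 0" by blast
    then have "sqn k z \<noteq> 0" unfolding sqn_eq_0_iff by blast
    then have zpos: "0 < sqn k z" using sqn_nonneg[of k z] by simp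
    interpret sampled_problem D \<kappa> m h B \<rho> b n k p Z z
      by (intro sampled_problem.intro law gain_setting.intro sampled_problem_axioms.intro)
         (use S m p b0 bG zpos s0(1) in \<open>auto simp: subspace_setting_def\<close>)
    have \<rho>0: "0 \<le> \<rho>" by (rule \<rho>_nonneg)
    \<comment> \<open>A nonnegative radius \<open>\<rho>\<close> forces
      \<open>\<delta> < 1 / 4\<close>; therefore \<open>ln (1 / \<delta>)\<close> is at least 1 and
      can be inserted as a factor.\<close>
    have \<delta>4: "\<delta> < 1 / 4" using \<rho> \<rho>0 by simp
    have "1 * 1 \<le> real m * real p" using m p by (intro mult_mono) auto
    then have N: "1 \<le> real m * real p" by simp
    have x: "real m * real p \<le> real m * (real p + real n)" by (intro mult_left_mono) auto
    have "1 * (1 + 1) \<le> real m * (real p + real n)" using m p n by (intro mult_mono add_mono) auto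
    then have L: "1 + ln (real m * real p) \<le> 6 * (ln (real m * (real p + real n)))\<^sup>2"
      by (intro one_add_ln_le N x) simp
    have ln4: "1 \<le> ln (1 / \<delta>)"
    proof -
      have "exp 1 \<le> (4::real)" using exp_le by simp
      also have "\<dots> \<le> 1 / \<delta>" using \<delta>(1) \<delta>4 by (simp add: field_simps)
      finally show ?thesis using \<delta> by (simp add: ln_ge_iff)
    qed
    have Dim0: "0 \<le> Dim" by (simp add: Dim_def)
    have "C3 * (t * Dim * (1 + ln (real m * real p))) \<le> C3 * (t * Dim * (6 * (ln (real m * (real p + real n)))\<^sup>2))"
      using C3 t Dim0 L by (intro mult_left_mono) auto
    also have "\<dots> = (6 * C3 * t * Dim * (ln (real m * (real p + real n)))\<^sup>2) * 1" by simp
    also have "\<dots> \<le> (6 * C3 * t * Dim * (ln (real m * (real p + real n)))\<^sup>2) * ln (1 / \<delta>)"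
      using C3 t Dim0 ln4 by (intro mult_left_mono) auto
    also have "\<dots> = (6 * C3 * t * \<delta> powr (-2) * Dim * (ln (real m * (real p + real n)))\<^sup>2 * ln (1 / \<delta>)) * \<delta>\<^sup>2"
    proof -
      have "\<delta> powr (-2) * \<delta>\<^sup>2 = 1" using \<delta> by (simp add: powr_minus powr_numeral)
      then show ?thesis by (simp add: ac_simps)
    qed
    also have "\<dots> \<le> real m * real p * \<delta>\<^sup>2"
      unfolding Dim_def by (intro mult_right_mono size) simp
    finally have size': "C3 * (t * Dim * (1 + ln (real m * real p))) \<le> real m * real p * \<delta>\<^sup>2" .
    have "7 / cB \<le> C3" by (simp add: C3_def)
    then have c1: "7 \<le> cB * C3" using cB_pos by (simp add: field_simps)
    have c2: "1920000 * K4 \<le> C3" by (simp add: C3_def)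
    have \<eta>: "0 < 1 - 31 * \<rho> - 4 * \<delta>" using \<rho> by simp
    show "let M = PiM ({..<p} \<times> {..<m} \<times> {..<n}) (\<lambda>_. D);
           \<eta> = 1 - 31 * \<rho> - 4 * \<delta>;
           Dl = (\<lambda>\<omega> j. Delta m k h z b (fst (iterates m p n k h Z B \<omega> z b \<rho> \<mu> j))
                                      (snd (iterates m p n k h Z B \<omega> z b \<rho> \<mu> j)))
       in measure M {\<omega> \<in> space M.
             (\<forall>j. Dl \<omega> j \<le> (1 - \<eta> * \<mu>) ^ j * (\<delta>\<^sup>2 + \<rho>\<^sup>2) * sqn k z) \<and> Dl \<omega> \<longlonglongrightarrow> 0}
          \<ge> 1 - 4 * (real m * real p) powr (- t)"
      unfolding Let_def by (rule convergence_probability[OF \<delta>(1) t c1 c2 C3 size' \<eta> \<mu>])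
  qed
qed simp

end
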